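(* There is a constant $c$ and an algorithm which takes as input a connected $K_{2,3}$-induced minor-free graph $G$ with $n$ vertices and $m$ edges, runs in time $O(nm)$, and outputs a graph $H$ such that $V(H)=V(G)$, the tree-width of $H$ is at most two, and $|d_G(u,v)-d_H(u,v)|\leq c$ for all $u,v\in V(G)$.
   Context: All graphs are finite, undirected, unweighted and simple. For a graph $X$ and vertices $u,v$ of $X$, $d_X(u,v)$ is the length (number of edges) of a shortest $(u,v)$-path in $X$. A graph $F$ is an induced minor of a graph $G$ if $F$ can be obtained from $G$ by a sequence of edge contractions and vertex deletions; otherwise $G$ is $F$-induced minor-free. $K_{2,3}$ is the complete bipartite graph with parts of sizes 2 and 3. The constant $c$ does not depend on $G$. *)

theory Defs
  imports "Graph_Theory.Graph_Theory"
begin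

text \<open>
  Finite simple undirected graphs are the library's \<open>pair_graph\<close>s: every edge \<open>{u, v}\<close> is present
  as the two arcs \<open>(u, v)\<close> and \<open>(v, u)\<close>.  Consequently the number of edges is half the number of arcs.
\<close>

definition num_edges :: "'a pair_pre_digraph \<Rightarrow> nat" where
  "num_edges G = card (parcs G) div 2"

text \<open>
  The library's \<open>\<mu>\<close> is the least cost of a walk, and infinite if there is none; with unit costs it
  is the number of edges of a shortest path.
\<close>

definition gdist :: "'a pair_pre_digraph \<Rightarrow> 'a \<Rightarrow> 'a \<Rightarrow> ereal" where
  "gdist G u v = wf_digraph.\<mu> (with_proj G) (\<lambda>_. 1) u v"


section \<open>Induced minors\<close>

definition delete_vertex :: "'a \<Rightarrow> 'a pair_pre_digraph \<Rightarrow> 'a pair_pre_digraph" where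
  "delete_vertex v G =
     \<lparr> pverts = pverts G - {v}, parcs = {(x, y) \<in> parcs G. x \<noteq> v \<and> y \<noteq> v} \<rparr>"

text \<open>
  Contracting the edge \<open>{u, v}\<close>: the merged vertex keeps the name \<open>u\<close>; the loop and the parallel
  edges that arise are suppressed.
\<close>

definition contract_edge :: "'a \<Rightarrow> 'a \<Rightarrow> 'a pair_pre_digraph \<Rightarrow> 'a pair_pre_digraph" where
  "contract_edge u v G = (let f = id(v := u) in
     \<lparr> pverts = pverts G - {v}, parcs = {(f x, f y) | x y. (x, y) \<in> parcs G \<and> f x \<noteq> f y} \<rparr>)"

inductive induced_minor :: "'a pair_pre_digraph \<Rightarrow> 'a pair_pre_digraph \<Rightarrow> bool" where
  refl: "induced_minor G G"
| delete: "induced_minor F G \<Longrightarrow> v \<in> pverts F \<Longrightarrow> induced_minor (delete_vertex v F) G"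
| contract: "induced_minor F G \<Longrightarrow> (u, v) \<in> parcs F \<Longrightarrow> induced_minor (contract_edge u v F) G"

text \<open>
  \<open>complete_bipartite_digraph\<close> is closed under isomorphism, so this forbids every copy of \<open>K\<^sub>2\<^sub>,\<^sub>3\<close>.
\<close>

definition K23_induced_minor_free :: "'a pair_pre_digraph \<Rightarrow> bool" where
  "K23_induced_minor_free G \<longleftrightarrow>
     \<not> (\<exists>F. induced_minor F G \<and> complete_bipartite_digraph 2 3 (with_proj F))"


section \<open>Tree-width\<close>

text \<open>
  The library's \<open>tree\<close> is not the undirected notion: in a symmetric digraph it counts going back and
  forth along a single edge as a cycle (of length 2).
\<close>

definition undirected_tree :: "'a pair_pre_digraph \<Rightarrow> bool" where
  "undirected_tree T \<longleftrightarrow> pair_graph T \<and> connected (with_proj T) \<and>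
     \<not> (\<exists>p. pre_digraph.cycle (with_proj T) p \<and> 3 \<le> length p)"

definition tree_decomposition ::
  "'a pair_pre_digraph \<Rightarrow> 'b pair_pre_digraph \<Rightarrow> ('b \<Rightarrow> 'a set) \<Rightarrow> bool" where
  "tree_decomposition G T B \<longleftrightarrow>
     undirected_tree T \<and>
     (\<Union>t\<in>pverts T. B t) = pverts G \<and>
     (\<forall>(u, v)\<in>parcs G. \<exists>t\<in>pverts T. u \<in> B t \<and> v \<in> B t) \<and>
     (\<forall>v\<in>pverts G. connected (induce_subgraph (with_proj T) {t \<in> pverts T. v \<in> B t}))"

definition decomposition_width :: "'b pair_pre_digraph \<Rightarrow> ('b \<Rightarrow> 'a set) \<Rightarrow> nat" where
  "decomposition_width T B = Max ((\<lambda>t. card (B t)) ` pverts T) - 1"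

text \<open>
  Decomposition trees are finite, so taking their nodes to be natural numbers is no restriction.
\<close>

definition treewidth :: "'a pair_pre_digraph \<Rightarrow> nat" where
  "treewidth G = (LEAST k. \<exists>(T :: nat pair_pre_digraph) B.
     tree_decomposition G T B \<and> decomposition_width T B = k)"


section \<open>A word RAM\<close>

text \<open>
  Memory consists of arrays of natural numbers; \<open>s a i\<close> is cell \<open>i\<close> of array \<open>a\<close>.  Array names occur
  in programs as literals only, so a program uses a fixed number \<open>r\<close> of arrays, which can be
  interleaved in a single memory by storing cell \<open>i\<close> of array \<open>a\<close> at address \<open>r * i + a\<close>.  Scalar
  variables are arrays of which only cell 0 is used.
\<close>

type_synonym state = "nat \<Rightarrow> nat \<Rightarrow> nat"

datatype aexp =
    Const nat
  | Cell nat aexp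
  | Add aexp aexp
  | Sub aexp aexp
  | Mul aexp aexp

datatype bexp =
    Less aexp aexp
  | Equal aexp aexp
  | Neg bexp
  | Conj bexp bexp

datatype com =
    Skip
  | Store nat aexp aexp
  | Seq com com
  | Cond bexp com com
  | While bexp com

text \<open>
  All constants, addresses, intermediate results and cell contents that occur have to be smaller than
  the word bound \<open>W\<close>; otherwise evaluation fails and the program has no run.
  Subtraction is truncated at 0.
\<close>

definition fit :: "nat \<Rightarrow> nat \<Rightarrow> nat option" where
  "fit W x = (if x < W then Some x else None)"

definition lift2 :: "('a \<Rightarrow> 'b \<Rightarrow> 'c option) \<Rightarrow> 'a option \<Rightarrow> 'b option \<Rightarrow> 'c option" where
  "lift2 f x y = Option.bind x (\<lambda>a. Option.bind y (f a))"

fun aval :: "nat \<Rightarrow> state \<Rightarrow> aexp \<Rightarrow> nat option" where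
  "aval W s (Const k) = fit W k"
| "aval W s (Cell a e) = Option.bind (aval W s e) (\<lambda>i. fit W (s a i))"
| "aval W s (Add e f) = lift2 (\<lambda>x y. fit W (x + y)) (aval W s e) (aval W s f)"
| "aval W s (Sub e f) = lift2 (\<lambda>x y. fit W (x - y)) (aval W s e) (aval W s f)"
| "aval W s (Mul e f) = lift2 (\<lambda>x y. fit W (x * y)) (aval W s e) (aval W s f)"

fun bval :: "nat \<Rightarrow> state \<Rightarrow> bexp \<Rightarrow> bool option" where
  "bval W s (Less e f) = lift2 (\<lambda>x y. Some (x < y)) (aval W s e) (aval W s f)"
| "bval W s (Equal e f) = lift2 (\<lambda>x y. Some (x = y)) (aval W s e) (aval W s f)"
| "bval W s (Neg b) = map_option Not (bval W s b)"
| "bval W s (Conj b c) = lift2 (\<lambda>x y. Some (x \<and> y)) (bval W s b) (bval W s c)"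

text \<open>
  \<open>exec W c s t s'\<close>: started in \<open>s\<close>, program \<open>c\<close> halts in \<open>s'\<close> after \<open>t\<close> steps.  Each assignment and
  each test costs one step: the expressions of a program have constant size, so charging every
  operation separately would change the running time by a constant factor only.
\<close>

inductive exec :: "nat \<Rightarrow> com \<Rightarrow> state \<Rightarrow> nat \<Rightarrow> state \<Rightarrow> bool" for W :: nat where
  Skip: "exec W Skip s 1 s"
| Store: "aval W s i = Some j \<Longrightarrow> aval W s e = Some x \<Longrightarrow>
    exec W (Store a i e) s 1 (s(a := (s a)(j := x)))"
| Seq: "exec W c s t s' \<Longrightarrow> exec W d s' t' s'' \<Longrightarrow> exec W (Seq c d) s (t + t') s''"
| CondTrue: "bval W s b = Some True \<Longrightarrow> exec W c s t s' \<Longrightarrow> exec W (Cond b c d) s (1 + t) s'"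
| CondFalse: "bval W s b = Some False \<Longrightarrow> exec W d s t s' \<Longrightarrow> exec W (Cond b c d) s (1 + t) s'"
| WhileFalse: "bval W s b = Some False \<Longrightarrow> exec W (While b c) s 1 s"
| WhileTrue: "bval W s b = Some True \<Longrightarrow> exec W c s t s' \<Longrightarrow> exec W (While b c) s' t' s'' \<Longrightarrow>
    exec W (While b c) s (1 + t + t') s''"

inductive_cases SkipE: "exec W Skip s t s'"
inductive_cases StoreE: "exec W (Store a i e) s t s'"
inductive_cases SeqE: "exec W (Seq c d) s t s'"
inductive_cases CondE: "exec W (Cond b c d) s t s'"
inductive_cases WhileE: "exec W (While b c) s t s'"

lemma exec_deterministic:
  "exec W c s t s' \<Longrightarrow> exec W c s u r \<Longrightarrow> t = u \<and> s' = r"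
proof (induction arbitrary: u r rule: exec.induct)
  case (Skip s)
  from Skip show ?case by (rule SkipE) simp
next
  case (Store s i j e x a)
  from Store(3) show ?case by (rule StoreE) (simp add: Store(1,2))
next
  case (Seq c s t s' d t' s'')
  from Seq.prems obtain t1 s1 t2
    where *: "exec W c s t1 s1" "exec W d s1 t2 r" "u = t1 + t2" by (rule SeqE)
  from Seq.IH(1)[OF *(1)] have "t = t1" "s' = s1" by simp_all
  with Seq.IH(2)[of t2 r] *(2,3) show ?case by simp
next
  case (CondTrue s b c t s' d)
  from CondTrue.prems obtain t1 where "exec W c s t1 r" "u = 1 + t1"
    by (rule CondE) (simp_all add: CondTrue.hyps)
  with CondTrue.IH[of t1 r] show ?case by simp
next
  case (CondFalse s b d t s' c)
  from CondFalse.prems obtain t1 where "exec W d s t1 r" "u = 1 + t1"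
    by (rule CondE) (simp_all add: CondFalse.hyps)
  with CondFalse.IH[of t1 r] show ?case by simp
next
  case (WhileFalse s b c)
  from WhileFalse.prems show ?case by (rule WhileE) (simp_all add: WhileFalse.hyps)
next
  case (WhileTrue s b c t s' t' s'')
  from WhileTrue.prems obtain t1 s1 t2
    where *: "exec W c s t1 s1" "exec W (While b c) s1 t2 r" "u = 1 + t1 + t2"
    by (rule WhileE) (simp_all add: WhileTrue.hyps)
  from WhileTrue.IH(1)[OF *(1)] have "t = t1" "s' = s1" by simp_all
  with WhileTrue.IH(2)[of t2 r] *(2,3) show ?case by simp
qed


section \<open>Graphs in memory\<close>

text \<open>
  Adjacency lists of a graph on \<open>{0, ..., n - 1}\<close> in arrays \<open>a\<close>, \<open>a + 1\<close>, \<open>a + 2\<close>: cell 0 of array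
  \<open>a\<close> holds \<open>n\<close>; the neighbours of \<open>v\<close>, each once and in any order, are the cells of array \<open>a + 2\<close>
  from index \<open>s (a + 1) v\<close> up to but excluding index \<open>s (a + 1) (v + 1)\<close>.
\<close>

definition stores_graph :: "nat \<Rightarrow> state \<Rightarrow> nat pair_pre_digraph \<Rightarrow> bool" where
  "stores_graph a s G \<longleftrightarrow>
     pverts G = {..<s a 0} \<and>
     s (a + 1) 0 = 0 \<and>
     (\<forall>v\<in>pverts G. s (a + 1) v \<le> s (a + 1) (v + 1) \<and>
        bij_betw (s (a + 2)) {s (a + 1) v..<s (a + 1) (v + 1)} {w. (v, w) \<in> parcs G})"

text \<open>The input graph is in arrays 0, 1, 2, and all other cells are 0.\<close>

definition input_state :: "state \<Rightarrow> nat pair_pre_digraph \<Rightarrow> bool" where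
  "input_state s G \<longleftrightarrow>
     stores_graph 0 s G \<and>
     (\<forall>i>0. s 0 i = 0) \<and>
     (\<forall>i>s 0 0. s 1 i = 0) \<and>
     (\<forall>i\<ge>s 1 (s 0 0). s 2 i = 0) \<and>
     (\<forall>a>2. \<forall>i. s a i = 0)"

end

(*
  Partition the vertices into layers by their distance from a root, and each layer into clusters, two
  vertices being in the same cluster if they are connected outside the ball of smaller radius.  Three
  vertices of a cluster C cannot be pairwise far apart: if C is at distance k from the root, the ball of
  radius k - 2 and the component of C outside the ball of radius k - 1 are connected, and together
  with three pairwise non-adjacent vertices of layer k - 1 that have neighbours in C they would
  contract to an induced minor K_{2,3}.  Hence a cluster either has bounded diameter or splits into two
  groups of bounded diameter that are far from each other.

  Let Q be the quotient of G by the groups; H is Q with every vertex attached as a leaf to the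
  representative of its group.  The quotient map does not increase distances.  Conversely, a shortest
  path in Q is monotone with respect to the layers except for at most three turns: a group with two
  lower neighbours in Q sits above both groups of a split cluster, and between two such turns the path
  can be shifted to the sibling groups, which descend in parallel.  A monotone path in Q lifts to G
  with constant additive error.  A group of a split cluster has a single lower neighbour in Q, a
  bounded cluster has at most two; this gives bags of size three.

  Distances and clusters are computed by two breadth-first searches from every vertex; everything
  else takes time O(n^2), which is O(nm) as G is connected.
*)

theory Submission
  imports Defs
begin

section \<open>Distances\<close>

text \<open>The danger is an error that grows with the length of a path. Consecutive edges of a path
  in \<open>Q\<close> may be realised at different places of a group, so a naive lift to
  \<open>G\<close> pays the diameter of a group at every step. The lift therefore follows a genuine
  descending path of \<open>G\<close> that is only required to visit the right clusters: each
  cluster has at most one cluster below it, and each group of a split cluster has its lower group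
  forced. A turn does cost a constant, hence the bound on their number.

  The constants determine one another. Groups of a split cluster have radius 3 = 1 + 1 + 1, their
  lower neighbours are within 1 + 3 + 3 + 1 = 8, so two groups must be 9 apart, and 9 + 3 + 3 = 15
  is the threshold. Every group has radius at most 14; the errors are 28 = 14 + 14 for a jump, 42
  for a descent, 84 for a descent followed by an ascent, 252 for a walk with one peak and 280 = 252
  + 28 in total.

  Leaders and witnesses enter through assumed properties only, so the construction is correct
  whichever candidates the program selects.\<close>

definition rdist :: "'a rel \<Rightarrow> 'a \<Rightarrow> 'a \<Rightarrow> nat" where
  "rdist E u v = (LEAST k. (u, v) \<in> E ^^ k)"

lemma rdist_le: "(u, v) \<in> E ^^ k \<Longrightarrow> rdist E u v \<le> k"
  unfolding rdist_def by (rule Least_le)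

lemma rdist_relpow: "(u, v) \<in> E\<^sup>* \<Longrightarrow> (u, v) \<in> E ^^ rdist E u v"
  unfolding rdist_def rtrancl_power by (rule LeastI_ex)

lemma (in pair_wf_digraph) awalk_relpow:
  "awalk u p v \<Longrightarrow> (u, v) \<in> parcs G ^^ length p"
proof (induction p arbitrary: u)
  case Nil
  then show ?case by (simp add: awalk_def)
next
  case (Cons e p)
  from Cons.prems have "(u, snd e) \<in> parcs G" "awalk (snd e) p v"
    by (auto simp: awalk_Cons_iff)
  with Cons.IH have "(u, v) \<in> parcs G ^^ Suc (length p)" by (blast intro: relpow_Suc_I2)
  then show ?case by simp
qed

lemma (in pair_wf_digraph) relpow_awalk:
  "(u, v) \<in> parcs G ^^ k \<Longrightarrow> u \<in> pverts G \<Longrightarrow> \<exists>p. awalk u p v \<and> length p = k"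
proof (induction k arbitrary: u)
  case 0
  then have "awalk u [] v" by (simp add: awalk_def)
  then show ?case by (intro exI[of _ "[]"]) simp
next
  case (Suc k)
  then obtain w where w: "(u, w) \<in> parcs G" "(w, v) \<in> parcs G ^^ k" by (metis relpow_Suc_D2)
  with Suc.IH[of w] obtain p where "awalk w p v" "length p = k" by (auto dest: in_arcsD2)
  with w have "awalk u ((u, w) # p) v" "length ((u, w) # p) = Suc k"
    using Suc.prems by (auto simp: awalk_Cons_iff)
  then show ?case by blast
qed

text \<open>The infimum over walks is attained at a walk of length \<open>rdist\<close>, so it is a
  minimum. All later arguments about distances use powers of the arc relation, which apply equally
  to restricted relations and to the output.\<close>

lemma gdist_eq_rdist:
  assumes "pair_graph G" "u \<in> pverts G" "(u, v) \<in> (parcs G)\<^sup>*"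
  shows "gdist G u v = ereal (real (rdist (parcs G) u v))"
proof -
  interpret pair_graph G by fact
  have cost: "awalk_cost (\<lambda>_. 1) p = real (length p)" for p
    by (induction p) auto
  obtain p where p: "awalk u p v" "length p = rdist (parcs G) u v"
    using relpow_awalk[OF rdist_relpow] assms by blast
  have "\<mu> (\<lambda>_. 1) u v \<le> ereal (real (rdist (parcs G) u v))"
    using min_cost_le_walk_cost[OF p(1), of "\<lambda>_. 1"] p(2) by (simp only: cost)
  moreover have "ereal (real (rdist (parcs G) u v)) \<le> \<mu> (\<lambda>_. 1) u v"
    unfolding \<mu>_def by (rule INF_greatest) (auto simp: cost intro!: rdist_le awalk_relpow)
  ultimately show ?thesis unfolding gdist_def by (rule antisym)
qed

lemma sym_pair_graph: "pair_graph G \<Longrightarrow> sym (parcs G)"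
  using pair_sym_digraph.pair_sym_arcs[of G] 
  by (auto simp: symmetric_def pair_graph_def pair_pseudo_graph_def)

lemma pair_graph_iff:
  "pair_graph G \<longleftrightarrow> finite (pverts G) \<and> parcs G \<subseteq> pverts G \<times> pverts G \<and> sym (parcs G) \<and> irrefl (parcs G)"
    (is "?L \<longleftrightarrow> ?R")
proof
  assume ?L
  then interpret pair_graph G .
  have "(x, x) \<notin> parcs G" for x using pair_no_loops[of "(x, x)"] by auto
  then show ?R using pair_finite_verts sym_pair_graph[OF \<open>?L\<close>]
    by (auto simp: irrefl_def dest: wellformed')
next
  assume ?R
  moreover from this have "finite (parcs G)" by (meson finite_SigmaI finite_subset)
  ultimately show ?L
    by unfold_locales (auto simp: irrefl_def symmetric_def)
qed

lemma mk_symmetric_parcs: "parcs (mk_symmetric (with_proj G)) = parcs G \<union> (parcs G)\<inverse>"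
  by (auto simp: mk_symmetric_def)

text \<open>\<open>connected\<close> refers to the symmetric closure, which is \<open>G\<close>
  itself because arcs come in opposite pairs.\<close>

lemma connected_rtrancl:
  assumes "pair_graph G" "connected (with_proj G)" "u \<in> pverts G" "v \<in> pverts G"
  shows "(u, v) \<in> (parcs G)\<^sup>*"
proof -
  have "u \<rightarrow>\<^sup>*\<^bsub>with_proj (mk_symmetric (with_proj G))\<^esub> v"
    using assms(2-4) unfolding connected_def strongly_connected_def by (auto simp: mk_symmetric_def)
  then have "(u, v) \<in> (parcs (mk_symmetric (with_proj G)))\<^sup>*"
    by (drule_tac reachable_rtranclI) simp
  moreover have "parcs (mk_symmetric (with_proj G)) = parcs G"
    using sym_pair_graph[OF assms(1)] by (auto simp: mk_symmetric_parcs dest: symD)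
  ultimately show ?thesis by simp
qed

section \<open>Induced minors from connected branch sets\<close>

text \<open>\<open>f\<close> sends a vertex to the representative of its branch set: a contraction
  keeps the name of one endpoint, so the names of the minor are vertices of
  \<open>G\<close>.\<close>

definition quotient_graph :: "('a \<Rightarrow> 'a) \<Rightarrow> 'a pair_pre_digraph \<Rightarrow> 'a pair_pre_digraph" where
  "quotient_graph f G =
    \<lparr> pverts = f ` pverts G, parcs = {(f x, f y) | x y. (x, y) \<in> parcs G \<and> f x \<noteq> f y} \<rparr>"

lemma induced_minor_trans:
  assumes "induced_minor F G" "induced_minor G H"
  shows "induced_minor F H"
  using assms by (induction rule: induced_minor.induct) (auto intro: induced_minor.intros)

text \<open>Contracting a single edge at a representative preserves all hypotheses and the final
  quotient, so induction on the number of vertices applies. When \<open>f\<close> is the identity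
  there is nothing left to contract.\<close>

lemma induced_minor_quotient_graph:
  assumes "finite (pverts G)" "parcs G \<subseteq> pverts G \<times> pverts G" "irrefl (parcs G)"
    and "\<And>v. v \<in> pverts G \<Longrightarrow>
      f v \<in> pverts G \<and> f (f v) = f v \<and> (f v, v) \<in> {(x, y) \<in> parcs G. f x = f y}\<^sup>*"
  shows "induced_minor (quotient_graph f G) G"
  using assms
proof (induction "card (pverts G)" arbitrary: G rule: less_induct)
  case less
  show ?case
  proof (cases "\<forall>v\<in>pverts G. f v = v")
    case True
    then have img: "f ` pverts G = pverts G" by force
    have "{(f x, f y) | x y. (x, y) \<in> parcs G \<and> f x \<noteq> f y} = parcs G" (is "?A = _")
    proof
      show "?A \<subseteq> parcs G" using True less.prems(2) by fastforce
      show "parcs G \<subseteq> ?A"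
      proof
        fix e assume e: "e \<in> parcs G"
        obtain x y where xy: "e = (x, y)" by force
        have "x \<in> pverts G" "y \<in> pverts G" "x \<noteq> y"
          using e xy less.prems(2,3) by (auto simp: irrefl_def)
        with e xy True show "e \<in> ?A" by force
      qed
    qed
    with img have "quotient_graph f G = G"
      by (simp add: quotient_graph_def)
    then show ?thesis by (simp add: induced_minor.refl)
  next
    case False
    then obtain v where v: "v \<in> pverts G" "f v \<noteq> v" by blast
    define r where "r = f v"
    define F where "F = {(x, y) \<in> parcs G. f x = f y}"
    have r: "r \<in> pverts G" "f r = r" "(r, v) \<in> F\<^sup>*" "r \<noteq> v"
      using less.prems(4)[OF v(1)] v by (auto simp: r_def F_def)
    \<comment> \<open>The first edge of a path from the representative into its fibre. Since
      \<open>r\<close> survives the contraction, \<open>f\<close> still maps every remaining vertex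
      to a remaining one.\<close>
    from r(3,4) obtain w where "(r, w) \<in> F" by (metis converse_rtranclE)
    then have w: "(r, w) \<in> parcs G" "f w = r" "w \<noteq> r" "w \<in> pverts G"
      using r(2) less.prems(2,3) by (auto simp: F_def irrefl_def)
    define g where "g = id(w := r)"
    define G' where "G' = contract_edge r w G"
    have G': "pverts G' = pverts G - {w}"
      "parcs G' = {(g x, g y) | x y. (x, y) \<in> parcs G \<and> g x \<noteq> g y}"
      by (auto simp: G'_def contract_edge_def g_def Let_def)
    have fg: "f (g x) = f x" for x using r(2) w(2) by (simp add: g_def)
    have gV: "g x \<in> pverts G - {w}" if "x \<in> pverts G" for x using that r w by (auto simp: g_def)
    have "induced_minor (quotient_graph f G') G'"
    proof (rule less.hyps)
      show "card (pverts G') < card (pverts G)"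
        unfolding G' by (rule card_Diff1_less[OF less.prems(1) w(4)])
      show "finite (pverts G')" using less.prems(1) by (simp add: G')
      show "parcs G' \<subseteq> pverts G' \<times> pverts G'"
        using less.prems(2) gV unfolding G' by blast
      show "irrefl (parcs G')" by (auto simp: G' irrefl_def)
    next
      fix x assume x: "x \<in> pverts G'"
      then have xG: "x \<in> pverts G" "x \<noteq> w" by (auto simp: G')
      note * = less.prems(4)[OF xG(1)]
      have "f x \<noteq> w" using * w(2,3) by auto
      have step: "(g a, g b) \<in> {(x, y) \<in> parcs G'. f x = f y}\<^sup>*" if "(a, b) \<in> F" for a b
      proof (cases "g a = g b")
        case False
        then have "(g a, g b) \<in> {(x, y) \<in> parcs G'. f x = f y}"
          using that by (auto simp: G' fg F_def)
        then show ?thesis by blast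
      qed simp
      have "(g (f x), g b) \<in> {(x, y) \<in> parcs G'. f x = f y}\<^sup>*" if "(f x, b) \<in> F\<^sup>*" for b
        using that by (induction rule: rtrancl_induct) (auto dest: step)
      from this[of x] * \<open>f x \<noteq> w\<close> xG
      show "f x \<in> pverts G' \<and> f (f x) = f x \<and> (f x, x) \<in> {(x, y) \<in> parcs G'. f x = f y}\<^sup>*"
        by (auto simp: G' F_def g_def)
    qed
    moreover have "quotient_graph f G' = quotient_graph f G"
    proof -
      have "f w \<in> f ` (pverts G - {w})" using r(1,2) w(2,3) by (intro image_eqI[of _ _ r]) auto
      then have "f ` (pverts G - {w}) = f ` pverts G" by blast
      moreover have "{(f x, f y) | x y. (x, y) \<in> parcs G' \<and> f x \<noteq> f y}
          = {(f x, f y) | x y. (x, y) \<in> parcs G \<and> f x \<noteq> f y}" (is "?L = ?R")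
      proof
        show "?L \<subseteq> ?R"
        proof
          fix e assume "e \<in> ?L"
          then obtain x y where "e = (f (g x), f (g y))" "(x, y) \<in> parcs G" "f (g x) \<noteq> f (g y)"
            unfolding G' by auto
          then show "e \<in> ?R" unfolding fg by blast
        qed
        show "?R \<subseteq> ?L"
        proof
          fix e assume "e \<in> ?R"
          then obtain x y where e: "e = (f x, f y)" "(x, y) \<in> parcs G" "f x \<noteq> f y" by blast
          then have "g x \<noteq> g y" by (metis fg)
          then have "(g x, g y) \<in> parcs G'" "f (g x) = f x" "f (g y) = f y"
            using e(2) fg unfolding G' by blast+
          then have "e = (f (g x), f (g y))" "(g x, g y) \<in> parcs G'" "f (g x) \<noteq> f (g y)"
            using e by simp_all
          then show "e \<in> ?L" by blast
        qed
      qed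
      ultimately show ?thesis by (simp add: quotient_graph_def G'(1))
    qed
    moreover have "induced_minor G' G"
      unfolding G'_def by (intro induced_minor.contract induced_minor.refl w(1))
    ultimately show ?thesis by (metis induced_minor_trans)
  qed
qed

lemma induced_minor_delete_set:
  assumes "finite S" "S \<subseteq> pverts G" "parcs G \<subseteq> pverts G \<times> pverts G"
  shows "induced_minor \<lparr> pverts = pverts G - S, parcs = parcs G \<inter> (pverts G - S) \<times> (pverts G - S) \<rparr> G"
  using assms
proof (induction S rule: finite_induct)
  case empty
  then have "\<lparr> pverts = pverts G - {}, parcs = parcs G \<inter> (pverts G - {}) \<times> (pverts G - {}) \<rparr> = G"
    by (simp add: Int_absorb2)
  then show ?case by (simp add: induced_minor.refl)
next
  case (insert v S)
  let ?F = "\<lparr> pverts = pverts G - S, parcs = parcs G \<inter> (pverts G - S) \<times> (pverts G - S) \<rparr>"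
  have "induced_minor (delete_vertex v ?F) G"
    using insert by (intro induced_minor.delete) auto
  also have "delete_vertex v ?F = \<lparr> pverts = pverts G - insert v S,
      parcs = parcs G \<inter> (pverts G - insert v S) \<times> (pverts G - insert v S) \<rparr>"
    by (auto simp: delete_vertex_def)
  finally show ?case .
qed

lemma induced_minor_restrict:
  assumes "finite (pverts G)" "parcs G \<subseteq> pverts G \<times> pverts G" "S \<subseteq> pverts G"
  shows "induced_minor \<lparr> pverts = S, parcs = parcs G \<inter> S \<times> S \<rparr> G"
  using induced_minor_delete_set[of "pverts G - S" G] assms
  by (simp add: double_diff)

text \<open>Branch sets \<open>A\<close> and \<open>B\<close> on the side of size two, and single vertices on the other side.\<close>
lemma K23_induced_minor_free_no_independent:
  assumes G: "pair_graph G" and free: "K23_induced_minor_free G"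
    and sub: "A \<subseteq> pverts G" "B \<subseteq> pverts G" "I \<subseteq> pverts G"
    and conA: "\<And>v. v \<in> A \<Longrightarrow> (a, v) \<in> (parcs G \<inter> A \<times> A)\<^sup>*" "a \<in> A"
    and conB: "\<And>v. v \<in> B \<Longrightarrow> (b, v) \<in> (parcs G \<inter> B \<times> B)\<^sup>*" "b \<in> B"
    and disj: "A \<inter> B = {}" "A \<inter> I = {}" "B \<inter> I = {}"
    and anti: "\<And>x y. x \<in> A \<Longrightarrow> y \<in> B \<Longrightarrow> (x, y) \<notin> parcs G"
    and adj: "\<And>i. i \<in> I \<Longrightarrow> \<exists>x\<in>A. (x, i) \<in> parcs G" "\<And>i. i \<in> I \<Longrightarrow> \<exists>y\<in>B. (y, i) \<in> parcs G"
    and I: "card I = 3"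
  shows "\<exists>i\<in>I. \<exists>j\<in>I. (i, j) \<in> parcs G"
proof (rule ccontr)
  assume ind: "\<not> (\<exists>i\<in>I. \<exists>j\<in>I. (i, j) \<in> parcs G)"
  have E: "finite (pverts G)" "parcs G \<subseteq> pverts G \<times> pverts G" "sym (parcs G)" "irrefl (parcs G)"
    using G by (auto simp: pair_graph_iff)
  define S where "S = A \<union> B \<union> I"
  define f where "f x = (if x \<in> A then a else if x \<in> B then b else x)" for x
  define F where "F = \<lparr> pverts = S, parcs = parcs G \<inter> S \<times> S \<rparr>"
  have F: "induced_minor F G"
    unfolding F_def S_def using sub E by (intro induced_minor_restrict) auto
  have "induced_minor (quotient_graph f F) F"
  proof (rule induced_minor_quotient_graph)
    show "finite (pverts F)" using E(1) sub by (auto simp: F_def S_def intro: finite_subset)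
    show "irrefl (parcs F)" using E(4) by (auto simp: F_def irrefl_def)
    show "parcs F \<subseteq> pverts F \<times> pverts F" by (auto simp: F_def)
    fix v assume "v \<in> pverts F"
    then consider "v \<in> A" | "v \<in> B" | "v \<in> I" by (auto simp: F_def S_def)
    then show "f v \<in> pverts F \<and> f (f v) = f v \<and> (f v, v) \<in> {(x, y) \<in> parcs F. f x = f y}\<^sup>*"
    proof cases
      case 1
      have "parcs G \<inter> A \<times> A \<subseteq> {(x, y) \<in> parcs F. f x = f y}"
        by (auto simp: F_def S_def f_def)
      then have "(a, v) \<in> {(x, y) \<in> parcs F. f x = f y}\<^sup>*" using conA(1)[OF 1] by (rule rtrancl_mono[THEN subsetD])
      moreover have "f v = a" "f a = a" "a \<in> pverts F" using 1 conA(2) disj by (auto simp: f_def F_def S_def)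
      ultimately show ?thesis by simp
    next
      case 2
      have "parcs G \<inter> B \<times> B \<subseteq> {(x, y) \<in> parcs F. f x = f y}"
        using disj by (auto simp: F_def S_def f_def)
      then have "(b, v) \<in> {(x, y) \<in> parcs F. f x = f y}\<^sup>*" using conB(1)[OF 2] by (rule rtrancl_mono[THEN subsetD])
      moreover have "f v = b" "f b = b" "b \<in> pverts F" using 2 conB(2) disj by (auto simp: f_def F_def S_def)
      ultimately show ?thesis by simp
    next
      case 3
      then show ?thesis using disj by (auto simp: f_def F_def S_def)
    qed
  qed
  then have "induced_minor (quotient_graph f F) G" using F by (rule induced_minor_trans)
  moreover have "complete_bipartite_digraph 2 3 (with_proj (quotient_graph f F))"
  proof -
    have fA: "f x = a" if "x \<in> A" for x using that by (simp add: f_def)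
    have fB: "f x = b" if "x \<in> B" for x using that disj by (auto simp: f_def)
    have fI: "f x = x" if "x \<in> I" for x using that disj by (auto simp: f_def)
    have ab: "a \<noteq> b" "a \<notin> I" "b \<notin> I" using conA(2) conB(2) disj by auto
    have V: "pverts (quotient_graph f F) = {a, b} \<union> I"
      using conA(2) conB(2) by (auto simp: quotient_graph_def F_def S_def fA fB fI) (force simp: fA fB fI)+
    have sym: "(y, x) \<in> parcs G" if "(x, y) \<in> parcs G" for x y using that E(3) by (auto dest: symD)
    have ax: "(a, i) \<in> parcs (quotient_graph f F)" "(i, a) \<in> parcs (quotient_graph f F)" if i: "i \<in> I" for i
    proof -
      from adj(1)[OF i] obtain x where x: "x \<in> A" "(x, i) \<in> parcs G" by blast
      then have "(x, i) \<in> parcs F" "(i, x) \<in> parcs F" "f x = a" "f i = i" "a \<noteq> i"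
        using i ab by (auto simp: F_def S_def fA fI intro: sym)
      then show "(a, i) \<in> parcs (quotient_graph f F)" "(i, a) \<in> parcs (quotient_graph f F)"
        unfolding quotient_graph_def by (auto) metis+
    qed
    have bx: "(b, i) \<in> parcs (quotient_graph f F)" "(i, b) \<in> parcs (quotient_graph f F)" if i: "i \<in> I" for i
    proof -
      from adj(2)[OF i] obtain x where x: "x \<in> B" "(x, i) \<in> parcs G" by blast
      then have "(x, i) \<in> parcs F" "(i, x) \<in> parcs F" "f x = b" "f i = i" "b \<noteq> i"
        using i ab by (auto simp: F_def S_def fB fI intro: sym)
      then show "(b, i) \<in> parcs (quotient_graph f F)" "(i, b) \<in> parcs (quotient_graph f F)"
        unfolding quotient_graph_def by (auto) metis+
    qed
    have "parcs (quotient_graph f F) \<subseteq> {a, b} \<times> I \<union> I \<times> {a, b}"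
    proof
      fix e assume "e \<in> parcs (quotient_graph f F)"
      then obtain x y where e: "e = (f x, f y)" "(x, y) \<in> parcs G" "x \<in> S" "y \<in> S" "f x \<noteq> f y"
        by (auto simp: quotient_graph_def F_def)
      then show "e \<in> {a, b} \<times> I \<union> I \<times> {a, b}"
        using ind anti sym[OF e(2)] by (auto simp: S_def fA fB fI)
    qed
    then have "parcs (quotient_graph f F) = {a, b} \<times> I \<union> I \<times> {a, b}"
      using ax bx by auto
    moreover have "finite I" using I by (simp add: card_ge_0_finite)
    ultimately have "finite (pverts (quotient_graph f F))" "{a, b} \<inter> I = {}" "card {a, b} = 2"
      "parcs (quotient_graph f F) = {a, b} \<times> I \<union> I \<times> {a, b}"
      using V ab by auto
    then show ?thesis
      unfolding complete_bipartite_digraph_pair_def using V I by blast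
  qed
  ultimately show False using free by (auto simp: K23_induced_minor_free_def)
qed

section \<open>Layers, clusters and groups\<close>

lemma relpow_sym: "sym E \<Longrightarrow> (u, v) \<in> E ^^ k \<Longrightarrow> (v, u) \<in> E ^^ k"
  by (induction k arbitrary: v) (auto dest: symD intro: relpow_Suc_I2 simp del: relpow.simps(2) elim!: relpow_Suc_E)

lemma relpow_trans: "(a, b) \<in> R ^^ m \<Longrightarrow> (b, c) \<in> R ^^ n \<Longrightarrow> (a, c) \<in> R ^^ (m + n)"
  by (auto simp: relpow_add)

lemma rdist_self [simp]: "rdist E u u = 0"
  using rdist_le[of u u 0 E] by simp

locale layered =
  fixes V :: "'a set" and E :: "'a rel" and r :: 'a
  assumes finV: "finite V" and EV: "E \<subseteq> V \<times> V" and symE: "sym E" and irreflE: "irrefl E"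
    and rV: "r \<in> V" and conn: "u \<in> V \<Longrightarrow> v \<in> V \<Longrightarrow> (u, v) \<in> E\<^sup>*"
begin

abbreviation d where "d \<equiv> rdist E"
abbreviation lev where "lev \<equiv> d r"

lemma E_V: "(u, v) \<in> E \<Longrightarrow> u \<in> V" "(u, v) \<in> E \<Longrightarrow> v \<in> V" using EV by auto
lemma E_sym: "(u, v) \<in> E \<Longrightarrow> (v, u) \<in> E" using symE by (auto dest: symD)

lemma relpow_d: "u \<in> V \<Longrightarrow> v \<in> V \<Longrightarrow> (u, v) \<in> E ^^ d u v"
  by (intro rdist_relpow conn)

lemma d_sym: "u \<in> V \<Longrightarrow> v \<in> V \<Longrightarrow> d u v = d v u"
  by (intro antisym rdist_le) (auto intro: relpow_sym symE relpow_d)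

lemma d_tri: "u \<in> V \<Longrightarrow> v \<in> V \<Longrightarrow> w \<in> V \<Longrightarrow> d u w \<le> d u v + d v w"
  by (rule rdist_le) (auto simp: relpow_add intro: relpow_d)

lemma d_edge: "(u, v) \<in> E \<Longrightarrow> d u v \<le> 1"
  by (rule rdist_le) auto

lemma d_0: "u \<in> V \<Longrightarrow> v \<in> V \<Longrightarrow> d u v = 0 \<Longrightarrow> u = v"
  using relpow_d[of u v] by simp

lemma lev_edge: "(u, v) \<in> E \<Longrightarrow> lev v \<le> Suc (lev u)"
  using d_tri[OF rV E_V(1) E_V(2), of u v u v] d_edge[of u v] by simp

lemma lev_edge_cases:
  assumes "(u, v) \<in> E"
  obtains "lev u = lev v" | "lev u = Suc (lev v)" | "lev v = Suc (lev u)"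
  using lev_edge[OF assms] lev_edge[OF E_sym[OF assms]] by linarith

lemma lower_neighbour:
  assumes "v \<in> V" "lev v = Suc k"
  obtains w where "(v, w) \<in> E" "lev w = k"
proof -
  from relpow_d[OF rV assms(1)] assms(2) obtain w where w: "(r, w) \<in> E ^^ k" "(w, v) \<in> E"
    by auto
  moreover have "lev w = k" using rdist_le[OF w(1)] lev_edge[OF w(2)] assms(2) by simp
  ultimately show ?thesis using that E_sym by blast
qed

definition above :: "nat \<Rightarrow> 'a rel" where
  "above k = E \<inter> {x. k \<le> lev x} \<times> {x. k \<le> lev x}"

text \<open>The classes of \<open>sc\<close> are the intersections of a layer with the components of the subgraph
  induced by that layer and everything farther from the root.\<close>
definition sc :: "'a \<Rightarrow> 'a \<Rightarrow> bool" where
  "sc u v \<longleftrightarrow> lev u = lev v \<and> (u, v) \<in> (above (lev u))\<^sup>*"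

lemma sym_above: "sym (above k)" using symE by (auto simp: above_def sym_def)

lemma sc_refl [simp]: "sc u u" by (simp add: sc_def)
lemma sc_sym: "sc u v \<Longrightarrow> sc v u" by (auto simp: sc_def intro: symD[OF sym_rtrancl[OF sym_above]])
lemma sc_trans: "sc u v \<Longrightarrow> sc v w \<Longrightarrow> sc u w" by (auto simp: sc_def)
lemma sc_lev: "sc u v \<Longrightarrow> lev u = lev v" by (simp add: sc_def)

lemma above_rtrancl_V: "(u, v) \<in> (above k)\<^sup>* \<Longrightarrow> u \<in> V \<Longrightarrow> v \<in> V"
  by (induction rule: rtrancl_induct) (auto simp: above_def dest: E_V)

lemma above_rtrancl_lev: "(u, v) \<in> (above k)\<^sup>* \<Longrightarrow> k \<le> lev u \<Longrightarrow> k \<le> lev v"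
  by (induction rule: rtrancl_induct) (auto simp: above_def)

lemma sc_V: "sc u v \<Longrightarrow> u \<in> V \<Longrightarrow> v \<in> V"
  using above_rtrancl_V unfolding sc_def by blast

lemma sc_edge: "(u, v) \<in> E \<Longrightarrow> lev u = lev v \<Longrightarrow> sc u v"
  by (auto simp: sc_def above_def)

text \<open>The path joining \<open>u\<close> and \<open>v\<close> remains admissible when the
  threshold drops by one layer, and the two descending edges extend it to \<open>a\<close> and
  \<open>b\<close>. Thus all lower neighbours of a cluster lie in one cluster.\<close>

lemma sc_lower:
  assumes "sc u v" "(u, a) \<in> E" "lev u = Suc (lev a)" "(v, b) \<in> E" "lev v = Suc (lev b)"
  shows "sc a b"
proof -
  have "above (lev u) \<subseteq> above (lev a)" using assms(3) by (auto simp: above_def)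
  then have "(u, v) \<in> (above (lev a))\<^sup>*" using assms(1) rtrancl_mono unfolding sc_def by blast
  moreover have "(a, u) \<in> above (lev a)" "(v, b) \<in> above (lev a)"
    using assms E_sym by (auto simp: above_def sc_def)
  ultimately have "(a, b) \<in> (above (lev a))\<^sup>*"
    by (meson converse_rtrancl_into_rtrancl rtrancl.rtrancl_into_rtrancl)
  then show ?thesis using assms by (auto simp: sc_def)
qed

lemma ball_connected:
  assumes "v \<in> V" "lev v \<le> k"
  shows "(r, v) \<in> (E \<inter> {x\<in>V. lev x \<le> k} \<times> {x\<in>V. lev x \<le> k})\<^sup>*"
  using assms
proof (induction "lev v" arbitrary: v)
  case 0
  then show ?case using d_0[OF rV 0(2)] by simp
next
  case (Suc l)
  from Suc.hyps(2) obtain w where w: "(v, w) \<in> E" "lev w = l"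
    using lower_neighbour[of v l] Suc.prems(1) by metis
  then have "(r, w) \<in> (E \<inter> {x\<in>V. lev x \<le> k} \<times> {x\<in>V. lev x \<le> k})\<^sup>*"
    using Suc.hyps Suc.prems by (intro Suc.hyps(1)) (auto dest: E_V)
  moreover have "(w, v) \<in> E \<inter> {x\<in>V. lev x \<le> k} \<times> {x\<in>V. lev x \<le> k}"
    using w Suc.hyps Suc.prems E_sym by (auto dest: E_V)
  ultimately show ?case by (rule rtrancl_into_rtrancl)
qed

text \<open>Otherwise the ball below the three lower neighbours and the component above them, contracted
  to single vertices, would form a \<open>K\<^sub>2\<^sub>,\<^sub>3\<close> with these neighbours.\<close>
lemma lower_neighbours_close:
  assumes free: "K23_induced_minor_free \<lparr> pverts = V, parcs = E \<rparr>"
    and sc: "sc u v" "sc u w" and lev: "lev u = Suc k"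
    and E: "(u, a) \<in> E" "(v, b) \<in> E" "(w, c) \<in> E"
    and lev': "lev a = k" "lev b = k" "lev c = k"
  shows "d a b \<le> 1 \<or> d a c \<le> 1 \<or> d b c \<le> 1"
proof (rule ccontr)
  assume far: "\<not> ?thesis"
  then have ne: "a \<noteq> b" "a \<noteq> c" "b \<noteq> c" by (metis rdist_self zero_le_one)+
  have V: "a \<in> V" "b \<in> V" "c \<in> V" "u \<in> V" using E by (auto dest: E_V)
  define A where "A = {x\<in>V. lev x \<le> k - 1}"
  define B where "B = {x. (u, x) \<in> (above (Suc k))\<^sup>*}"
  \<comment> \<open>Layer 0 contains only the root, whereas \<open>a\<close> and \<open>b\<close>
    differ. Hence \<open>k - 1\<close> is not truncated and the ball \<open>A\<close> is disjoint
    from the three vertices.\<close>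
  have "k \<noteq> 0" using ne lev' d_0[OF rV] V by metis
  have "B \<subseteq> V" using V above_rtrancl_V by (auto simp: B_def)
  have Blev: "Suc k \<le> lev x" if "x \<in> B" for x using that above_rtrancl_lev lev by (auto simp: B_def)
  have "\<exists>i\<in>{a, b, c}. \<exists>j\<in>{a, b, c}. (i, j) \<in> parcs \<lparr> pverts = V, parcs = E \<rparr>"
  proof (rule K23_induced_minor_free_no_independent[OF _ free])
    show "pair_graph \<lparr> pverts = V, parcs = E \<rparr>"
      using finV EV symE irreflE by (simp add: pair_graph_iff)
    show "(r, x) \<in> (parcs \<lparr> pverts = V, parcs = E \<rparr> \<inter> A \<times> A)\<^sup>*" if "x \<in> A" for x
      using ball_connected[of x "k - 1"] that by (auto simp: A_def)
    show "r \<in> A" using rV by (simp add: A_def)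
    show "A \<subseteq> pverts \<lparr> pverts = V, parcs = E \<rparr>" by (auto simp: A_def)
    show "B \<subseteq> pverts \<lparr> pverts = V, parcs = E \<rparr>" using \<open>B \<subseteq> V\<close> by simp
    show "{a, b, c} \<subseteq> pverts \<lparr> pverts = V, parcs = E \<rparr>" using V by simp
    show "u \<in> B" by (simp add: B_def)
    show "(u, x) \<in> (parcs \<lparr> pverts = V, parcs = E \<rparr> \<inter> B \<times> B)\<^sup>*" if "x \<in> B" for x
    proof -
      from that have "(u, x) \<in> (above (Suc k))\<^sup>*" by (simp add: B_def)
      then show ?thesis
      proof (induction rule: rtrancl_induct)
        case (step y z)
        then have "y \<in> B" "z \<in> B" "(y, z) \<in> E"
          unfolding B_def by (auto intro: rtrancl_into_rtrancl) (auto simp: above_def)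
        then have "(y, z) \<in> E \<inter> B \<times> B" by simp
        with step.IH show ?case by (auto intro: rtrancl_into_rtrancl)
      qed simp
    qed
    show "A \<inter> B = {}" "A \<inter> {a, b, c} = {}" "B \<inter> {a, b, c} = {}"
      using Blev lev' \<open>k \<noteq> 0\<close> by (fastforce simp: A_def)+
    show "(x, y) \<notin> parcs \<lparr> pverts = V, parcs = E \<rparr>" if "x \<in> A" "y \<in> B" for x y
      using that Blev[of y] \<open>k \<noteq> 0\<close> lev_edge[of x y] by (auto simp: A_def)
    show "\<exists>x\<in>A. (x, i) \<in> parcs \<lparr> pverts = V, parcs = E \<rparr>" if "i \<in> {a, b, c}" for i
    proof -
      have "i \<in> V" "lev i = Suc (k - 1)" using that V lev' \<open>k \<noteq> 0\<close> by auto
      then obtain x where "(i, x) \<in> E" "lev x = k - 1" by (rule lower_neighbour)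
      then show ?thesis using E_sym by (auto simp: A_def dest: E_V)
    qed
    have "v \<in> B" "w \<in> B" using sc lev by (auto simp: B_def sc_def)
    then show "\<exists>y\<in>B. (y, i) \<in> parcs \<lparr> pverts = V, parcs = E \<rparr>" if "i \<in> {a, b, c}" for i
      using that E \<open>u \<in> B\<close> by auto
    show "card {a, b, c} = 3" using ne by simp
  qed
  then show False using far ne d_edge d_sym V irreflE by (fastforce simp: irrefl_def)
qed

text \<open>One edge down, at most one edge across between lower neighbours, and one edge up: 1 + 1
  + 1.\<close>

lemma cluster_triple:
  assumes free: "K23_induced_minor_free \<lparr> pverts = V, parcs = E \<rparr>"
    and "u \<in> V" and sc: "sc u v" "sc u w"
  shows "d u v \<le> 3 \<or> d u w \<le> 3 \<or> d v w \<le> 3"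
proof (cases "lev u")
  case 0
  then have "u = v" using d_0[OF rV, of u] d_0[OF rV, of v] sc_V[OF sc(1)] sc_lev[OF sc(1)] assms(2) by simp
  then show ?thesis by simp
next
  case (Suc k)
  have V: "v \<in> V" "w \<in> V" "lev v = Suc k" "lev w = Suc k"
    using sc_V sc sc_lev Suc \<open>u \<in> V\<close> by metis+
  obtain a where a: "(u, a) \<in> E" "lev a = k" using lower_neighbour[OF \<open>u \<in> V\<close> Suc] .
  obtain b where b: "(v, b) \<in> E" "lev b = k" using lower_neighbour[OF V(1,3)] .
  obtain c where c: "(w, c) \<in> E" "lev c = k" using lower_neighbour[OF V(2,4)] .
  have step: "d x y \<le> 3" if "(x, a) \<in> E" "(y, b) \<in> E" "d a b \<le> 1" for x y a b
  proof -
    note V = E_V[OF that(1)] E_V[OF that(2)]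
    have "d x y \<le> d x a + (d a b + d b y)" using d_tri[of x a y] d_tri[of a b y] V by linarith
    then show ?thesis using that d_edge[of x a] d_edge[of b y] E_sym by fastforce
  qed
  show ?thesis
    using lower_neighbours_close[OF free sc Suc a(1) b(1) c(1) a(2) b(2) c(2)] step a b c by blast
qed

end

text \<open>A cluster that spreads is cut into two groups: the vertices near its leader \<open>ld v\<close> and those
  near the witness \<open>far (ld v)\<close>.  The threshold 15 keeps the two groups so far apart (9 or more) that
  the lower neighbours of one group stay together.\<close>
locale grouping = layered +
  fixes ld :: "'a \<Rightarrow> 'a" and far :: "'a \<Rightarrow> 'a option" and rep :: "'a \<Rightarrow> 'a"
  assumes triple: "u \<in> V \<Longrightarrow> sc u v \<Longrightarrow> sc u w \<Longrightarrow> d u v \<le> 3 \<or> d u w \<le> 3 \<or> d v w \<le> 3"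
    and ld_sc: "v \<in> V \<Longrightarrow> sc v (ld v)" and ld_eq: "u \<in> V \<Longrightarrow> sc u v \<Longrightarrow> ld u = ld v"
    and far_Some: "v \<in> V \<Longrightarrow> far (ld v) = Some y \<Longrightarrow> sc (ld v) y \<and> 15 \<le> d (ld v) y"
    and far_None: "v \<in> V \<Longrightarrow> far (ld v) = None \<Longrightarrow> d (ld v) v < 15"
    and rep_def: "v \<in> V \<Longrightarrow>
      rep v = (case far (ld v) of None \<Rightarrow> ld v | Some y \<Rightarrow> if 3 < d (ld v) v then y else ld v)"
begin

lemma ld_V: "v \<in> V \<Longrightarrow> ld v \<in> V" using ld_sc sc_V by blast

text \<open>Leader and witness are at least 15 apart, so in the triple formed with \<open>v\<close>
  the short pair must contain \<open>v\<close>.\<close>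

lemma far_near:
  assumes "v \<in> V" "far (ld v) = Some y"
  shows "d v (rep v) \<le> 3"
proof (cases "3 < d (ld v) v")
  case True
  have "d (ld v) y \<le> 3 \<or> d (ld v) v \<le> 3 \<or> d y v \<le> 3"
    using assms far_Some ld_sc sc_sym by (intro triple) (auto intro: ld_V)
  moreover have "y \<in> V" using far_Some[OF assms] sc_V ld_V[OF assms(1)] by blast
  ultimately show ?thesis using assms far_Some[OF assms] True by (auto simp: rep_def d_sym)
next
  case False
  then show ?thesis using assms by (auto simp: rep_def d_sym ld_V)
qed

lemma rep_sc: "v \<in> V \<Longrightarrow> sc v (rep v)"
  using ld_sc far_Some by (auto simp: rep_def split: option.splits intro: sc_trans)

lemma rep_V: "v \<in> V \<Longrightarrow> rep v \<in> V" using rep_sc sc_V by blast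
lemma rep_lev: "v \<in> V \<Longrightarrow> lev (rep v) = lev v" using rep_sc sc_lev by metis

lemma rep_rep: "v \<in> V \<Longrightarrow> rep (rep v) = rep v"
proof -
  assume v: "v \<in> V"
  have *: "ld (rep v) = ld v" using ld_eq[OF v rep_sc[OF v]] by simp
  show ?thesis
    unfolding rep_def[OF rep_V[OF v]] * using far_Some[OF v] by (auto simp: rep_def[OF v] split: option.splits)
qed

lemma d_rep: "v \<in> V \<Longrightarrow> d v (rep v) \<le> 14"
  using far_near[of v] far_None[of v] by (cases "far (ld v)") (auto simp: rep_def d_sym ld_V)

text \<open>Two different representatives of a cluster are its leader and its witness; 15 less the
  two radii of 3 leaves 9.\<close>

lemma separated:
  assumes "u \<in> V" "sc u v" "rep u \<noteq> rep v"
  shows "far (ld u) \<noteq> None" "9 \<le> d u v"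
proof -
  have v: "v \<in> V" and ld: "ld v = ld u" using sc_V ld_eq[of u v] assms by auto
  show "far (ld u) \<noteq> None" using assms(3) by (cases "far (ld u)") (auto simp: rep_def[OF assms(1)] rep_def[OF v] ld)
  then obtain y where y: "far (ld u) = Some y" by blast
  have *: "15 \<le> d (rep u) (rep v)"
    using far_Some[OF assms(1) y] assms(1,3) v ld y ld_V[OF assms(1)] sc_V
    by (auto simp: rep_def d_sym split: if_splits)
  have "d (rep u) (rep v) \<le> d (rep u) u + (d u v + d v (rep v))"
    using d_tri[of "rep u" u "rep v"] d_tri[of u v "rep v"] rep_V v assms(1)
    by (meson add_left_mono le_trans)
  then show "9 \<le> d u v" using far_near[OF assms(1) y] far_near[of v y] v ld y * assms(1)
    by (simp add: d_sym rep_V)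
qed

text \<open>Only the leader and the witness are fixed by \<open>rep\<close>. This pigeonhole
  principle later forces two descending chains to meet.\<close>

lemma two_reps:
  assumes "p \<in> V" "sc p q" "sc p s" "rep p = p" "rep q = q" "rep s = s"
  shows "p = q \<or> p = s \<or> q = s"
proof -
  have V: "q \<in> V" "s \<in> V" "ld q = ld p" "ld s = ld p" using assms sc_V ld_eq by metis+
  have "rep x \<in> (case far (ld p) of None \<Rightarrow> {ld p} | Some y \<Rightarrow> {ld p, y})" if "x \<in> V" "ld x = ld p" for x
    using that by (auto simp: rep_def split: option.splits)
  from this[of p] this[of q] this[of s] show ?thesis
    using assms V by (auto split: option.splits)
qed

lemma unsplit:
  assumes "q \<in> V" "rep q = q" "\<And>q'. sc q q' \<Longrightarrow> rep q' = q' \<Longrightarrow> q' = q" "sc q v"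
  shows "rep v = q"
  using assms rep_sc[of v] sc_V[of q v] rep_rep[of v] by (meson sc_trans)

section \<open>The quotient by the groups and its edges towards the root\<close>

definition Q :: "'a rel" where
  "Q = {(rep a, rep b) | a b. (a, b) \<in> E \<and> rep a \<noteq> rep b}"

definition U :: "'a rel" where
  "U = {(p, q) \<in> Q. lev p = Suc (lev q)}"

lemma U_edge:
  assumes "(p, q) \<in> U"
  obtains a b where "(a, b) \<in> E" "rep a = p" "rep b = q" "lev a = Suc (lev b)"
    "a \<in> V" "b \<in> V" "sc a p" "sc b q"
proof -
  from assms obtain a b where "(a, b) \<in> E" "rep a = p" "rep b = q" "lev p = Suc (lev q)"
    by (auto simp: U_def Q_def)
  moreover from this have "a \<in> V" "b \<in> V" by (auto dest: E_V)
  ultimately show ?thesis using that rep_lev rep_sc by metis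
qed

lemma U_V: "(p, q) \<in> U \<Longrightarrow> p \<in> V" "(p, q) \<in> U \<Longrightarrow> q \<in> V"
  "(p, q) \<in> U \<Longrightarrow> rep p = p" "(p, q) \<in> U \<Longrightarrow> rep q = q"
  by (auto elim!: U_edge simp: rep_V rep_rep)

lemma U_lev: "(p, q) \<in> U \<Longrightarrow> lev p = Suc (lev q)" by (simp add: U_def)

lemma UI: "(a, b) \<in> E \<Longrightarrow> lev a = Suc (lev b) \<Longrightarrow> (rep a, rep b) \<in> U"
  using rep_lev[OF E_V(1), of a b] rep_lev[OF E_V(2), of a b] by (fastforce simp: U_def Q_def)

lemma Q_sym:
  assumes "(p, q) \<in> Q"
  shows "(q, p) \<in> Q"
proof -
  from assms obtain a b where "p = rep a" "q = rep b" "(a, b) \<in> E" "rep a \<noteq> rep b"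
    unfolding Q_def by blast
  moreover from this have "(b, a) \<in> E" "rep b \<noteq> rep a" using E_sym by auto
  ultimately show ?thesis unfolding Q_def by blast
qed

text \<open>Adjacent vertices of one layer belong to one cluster and are too close for different
  groups, so no edge of \<open>Q\<close> stays within a layer.\<close>

lemma Q_cases:
  assumes "(p, q) \<in> Q"
  obtains "(p, q) \<in> U" | "(q, p) \<in> U"
proof -
  from assms obtain a b where ab: "p = rep a" "q = rep b" "(a, b) \<in> E" "rep a \<noteq> rep b"
    by (auto simp: Q_def)
  have "lev a \<noteq> lev b"
  proof
    assume "lev a = lev b"
    then have "9 \<le> d a b" using separated(2)[of a b] sc_edge ab by (auto dest: E_V)
    then show False using d_edge[OF ab(3)] by simp
  qed
  then have "lev a = Suc (lev b) \<or> lev b = Suc (lev a)" using lev_edge_cases[OF ab(3)] by metis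
  then show ?thesis using that UI ab E_sym by blast
qed

lemma U_Q: "U \<subseteq> Q" by (auto simp: U_def)

lemma U_ex:
  assumes "p \<in> V" "rep p = p" "lev p = Suc k"
  obtains q where "(p, q) \<in> U"
proof -
  from assms obtain b where "(p, b) \<in> E" "lev b = k" by (metis lower_neighbour)
  then show ?thesis using UI[of p b] assms that by auto
qed

text \<open>Edges of \<open>U\<close> are realised by edges of \<open>G\<close> between arbitrary
  members of the two groups, so this transfers \<open>sc_lower\<close>: the sequence of clusters on
  a descent depends only on the cluster where it starts.\<close>

lemma U_sc:
  assumes "(p, q) \<in> U" "(p', q') \<in> U" "sc p p'"
  shows "sc q q'"
proof -
  from assms(1) obtain a b where ab: "(a, b) \<in> E" "lev a = Suc (lev b)" "sc a p" "sc b q"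
    by (rule U_edge)
  from assms(2) obtain a' b' where ab': "(a', b') \<in> E" "lev a' = Suc (lev b')" "sc a' p'" "sc b' q'"
    by (rule U_edge)
  have "sc a a'" using ab(3) ab'(3) assms(3) by (meson sc_trans sc_sym)
  then have "sc b b'" using sc_lower ab(1,2) ab'(1,2) by blast
  then show ?thesis using ab(4) ab'(4) by (meson sc_trans sc_sym)
qed

text \<open>The sibling \<open>p'\<close> says that the cluster of \<open>p\<close> is split; its groups then have radius at most 3
  around their representatives, so that the lower neighbours of one group are within distance 8.\<close>
lemma U_unique:
  assumes "(p, q) \<in> U" "(p, q') \<in> U" "sc p p'" "rep p' = p'" "p \<noteq> p'"
  shows "q = q'"
proof -
  from assms(1) obtain a b where ab: "(a, b) \<in> E" "rep a = p" "rep b = q" "lev a = Suc (lev b)"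
    "a \<in> V" "b \<in> V" "sc a p" by (rule U_edge)
  from assms(2) obtain a' b' where ab': "(a', b') \<in> E" "rep a' = p" "rep b' = q'" "lev a' = Suc (lev b')"
    "a' \<in> V" "b' \<in> V" "sc a' p" by (rule U_edge)
  have p: "p \<in> V" "rep p = p" using U_V assms by blast+
  have "far (ld p) \<noteq> None" using separated(1)[of p p'] assms p by auto
  then obtain y where "far (ld p) = Some y" by blast
  then have "d a p \<le> 3" "d p a' \<le> 3"
    using far_near[of a y] far_near[of a' y] ld_eq[of a p] ld_eq[of a' p] ab ab' p by (auto simp: d_sym)
  moreover have "d b b' \<le> d b a + (d a p + (d p a' + d a' b'))"
    using d_tri[of b a b'] d_tri[of a p b'] d_tri[of p a' b'] ab ab' p by linarith
  ultimately have "d b b' < 9"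
    using d_edge[of b a] d_edge[of a' b'] ab(1) ab'(1) E_sym by fastforce
  moreover have "sc b b'" using sc_lower ab ab' sc_sym sc_trans by meson
  ultimately show ?thesis using separated(2)[of b b'] ab ab' by fastforce
qed

text \<open>Following lower neighbours from a vertex of the group of \<open>p\<close> one stays in the groups of the
  chain, except that a jump inside an unsplit cluster may be necessary; only the last jump counts.\<close>
lemma U_relpow_lift:
  assumes "(p, q) \<in> U ^^ j" "p \<in> V" "rep p = p"
  shows "(\<exists>w\<in>V. rep w = q \<and> d p w \<le> j + 28) \<and> (\<exists>w\<in>V. sc w q \<and> d p w \<le> j) \<and> q \<in> V \<and> rep q = q"
  using assms(1)
proof (induction j arbitrary: q)
  case 0
  then show ?case using assms by (auto intro!: bexI[of _ p])
next
  case (Suc j)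
  then obtain q0 where q0: "(p, q0) \<in> U ^^ j" "(q0, q) \<in> U" by auto
  from Suc.IH[OF q0(1)] obtain w w0 where
    w: "w \<in> V" "rep w = q0" "d p w \<le> j + 28" and w0: "w0 \<in> V" "sc w0 q0" "d p w0 \<le> j" by auto
  have q: "q0 \<in> V" "rep q0 = q0" "q \<in> V" "rep q = q" using U_V[OF q0(2)] by auto
  \<comment> \<open>Every vertex of the cluster has a lower neighbour in \<open>G\<close>; the group
    reached may be the wrong one, the cluster cannot.\<close>
  have down: "\<exists>x. (v, x) \<in> E \<and> (rep v, rep x) \<in> U \<and> sc x q \<and> d p x \<le> Suc (d p v)"
    if v: "v \<in> V" "sc v q0" for v
  proof -
    have "lev v = Suc (lev q)" using U_lev[OF q0(2)] sc_lev[OF v(2)] by simp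
    then obtain x where x: "(v, x) \<in> E" "lev x = lev q" by (rule lower_neighbour[OF v(1)])
    then have U: "(rep v, rep x) \<in> U" using \<open>lev v = _\<close> by (intro UI) auto
    have "sc (rep v) q0" using v rep_sc sc_sym sc_trans by meson
    then have "sc (rep x) q" using U_sc[OF U q0(2)] by blast
    moreover have "sc x (rep x)" using x by (auto intro: rep_sc dest: E_V)
    ultimately have "sc x q" by (metis sc_trans)
    moreover have "d p x \<le> Suc (d p v)"
      using d_tri[of p v x] d_edge[OF x(1)] assms(2) v x by (auto dest: E_V)
    ultimately show ?thesis using x U by blast
  qed
  from down[OF w0(1,2)] w0(3) have lower: "\<exists>w\<in>V. sc w q \<and> d p w \<le> Suc j"
    by (metis E_V(2) Suc_le_mono le_trans)
  have "\<exists>x\<in>V. rep x = q \<and> d p x \<le> Suc j + 28"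
  \<comment> \<open>If the cluster of \<open>q0\<close> is split, its groups have unique lower
    groups and \<open>w\<close> descends into the group of \<open>q\<close> at no extra cost.
    Otherwise the descent restarts from \<open>w0\<close>, whose distance carries no error so far,
    and a jump of at most 14 + 14 inside the group leads to an edge that realises
    \<open>(q0, q)\<close>.\<close>
  proof (cases "\<exists>q'. sc q0 q' \<and> rep q' = q' \<and> q' \<noteq> q0")
    case True
    then obtain q' where q': "sc q0 q'" "rep q' = q'" "q' \<noteq> q0" by blast
    have "sc w q0" using rep_sc w by blast
    from down[OF w(1) this] obtain x where x: "(w, x) \<in> E" "(q0, rep x) \<in> U" "d p x \<le> Suc (d p w)"
      using w(2) by auto
    have "rep x = q" using U_unique[OF x(2) q0(2) q'(1,2)] q'(3) by blast
    then show ?thesis using x w(3) by (metis E_V(2) Suc_le_mono add_Suc le_trans)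
  next
    case False
    from q0(2) obtain a b where ab: "(a, b) \<in> E" "rep a = q0" "rep b = q" "a \<in> V" "b \<in> V"
      by (rule U_edge)
    have "rep w0 = q0" using unsplit[of q0 w0] False q w0(2) sc_sym by metis
    then have "d w0 q0 \<le> 14" "d a q0 \<le> 14" using d_rep[of w0] d_rep[of a] w0 ab by auto
    moreover have "d p b \<le> d p w0 + (d w0 q0 + (d q0 a + d a b))"
      using d_tri[of p w0 b] d_tri[of w0 q0 b] d_tri[of q0 a b] ab w0 q assms by linarith
    ultimately have "d p b \<le> Suc j + 28"
      using w0(3) d_edge[OF ab(1)] d_sym[of q0 a] q ab by linarith
    then show ?thesis using ab by auto
  qed
  with lower q show ?case by blast
qed

lemma U_relpow_d:
  assumes "(p, q) \<in> U ^^ j" "p \<in> V" "rep p = p"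
  shows "d p q \<le> j + 42" "q \<in> V" "rep q = q"
proof -
  from U_relpow_lift[OF assms] obtain w where w: "w \<in> V" "rep w = q" "d p w \<le> j + 28" 
    and q: "q \<in> V" "rep q = q" by blast
  show "q \<in> V" "rep q = q" by fact+
  have "d p q \<le> d p w + d w q" using d_tri w q assms by blast
  then show "d p q \<le> j + 42" using d_rep[OF w(1)] w by simp
qed

text \<open>A walk in \<open>Q\<close> without peaks approaches the root and then moves away from it (\<open>UD\<close>).  A peak is
  a vertex \<open>z\<close> where a walk turns towards the root again; \<open>UD1\<close> is the case of exactly one peak.\<close>
definition UD :: "'a \<Rightarrow> 'a \<Rightarrow> nat \<Rightarrow> bool" where
  "UD p q l \<longleftrightarrow> (\<exists>w i j. (p, w) \<in> U ^^ i \<and> (q, w) \<in> U ^^ j \<and> i + j = l)"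

definition UD1 :: "'a \<Rightarrow> 'a \<Rightarrow> nat \<Rightarrow> bool" where
  "UD1 p q l \<longleftrightarrow> (\<exists>y z x l1 l2. UD p y l1 \<and> (z, y) \<in> U \<and> (z, x) \<in> U \<and> x \<noteq> y \<and> UD x q l2 \<and> l1 + l2 + 2 = l)"

lemma relpow_U_Q: "(p, q) \<in> U ^^ i \<Longrightarrow> (p, q) \<in> Q ^^ i"
  by (induction i arbitrary: q) (auto simp: U_def)

lemma relpow_UD_Q:
  assumes "UD p q l"
  shows "(p, q) \<in> Q ^^ l"
proof -
  from assms obtain w i j where w: "(p, w) \<in> U ^^ i" "(q, w) \<in> U ^^ j" and l: "i + j = l"
    unfolding UD_def by blast
  have "sym Q" by (blast intro: symI Q_sym)
  then have "(w, q) \<in> Q ^^ j" by (rule relpow_sym) (rule relpow_U_Q[OF w(2)])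
  then have "(p, q) \<in> Q ^^ i O Q ^^ j" using relpow_U_Q[OF w(1)] by (rule relcompI[rotated])
  then show ?thesis by (simp only: relpow_add[symmetric] l)
qed

lemma UD_d:
  assumes "UD p q l" "p \<in> V" "rep p = p" "q \<in> V" "rep q = q"
  shows "d p q \<le> l + 84"
proof -
  from assms(1) obtain w i j where w: "(p, w) \<in> U ^^ i" "(q, w) \<in> U ^^ j" "i + j = l"
    unfolding UD_def by blast
  note 1 = U_relpow_d[OF w(1) assms(2,3)] and 2 = U_relpow_d[OF w(2) assms(4,5)]
  show ?thesis using d_tri[of p w q] d_sym[of w q] 1 2 assms w(3) by linarith
qed

text \<open>Both sides contribute 84, and the two edges at the peak 42 each beyond their length: 84
  + 84 + 84.\<close>

lemma UD1_d:
  assumes "UD1 p q l" "p \<in> V" "rep p = p" "q \<in> V" "rep q = q"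
  shows "d p q \<le> l + 252"
proof -
  from assms(1) obtain y z x l1 l2 where *: "UD p y l1" "(z, y) \<in> U" "(z, x) \<in> U" "UD x q l2" "l1 + l2 + 2 = l"
    unfolding UD1_def by blast
  note V = U_V[OF *(2)] U_V[OF *(3)]
  have yx: "d y x \<le> 86"
  proof -
    have "d y z \<le> 43" "d z x \<le> 43"
      using U_relpow_d(1)[of z y 1] U_relpow_d(1)[of z x 1] *(2,3) V by (auto simp: d_sym)
    then show ?thesis using d_tri[of y z x] V by simp
  qed
  have "d p q \<le> d p y + (d y x + d x q)"
    using d_tri[of p y q] d_tri[of y x q] V assms by linarith
  then show ?thesis using UD_d[OF *(1)] UD_d[OF *(4)] yx V assms *(5) by linarith
qed

text \<open>Siblings descend through the same clusters. Once the two chains meet, the second one can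
  follow the first; until then they occupy the two groups of each cluster.\<close>

lemma sibling_chain:
  assumes "(y, w) \<in> U ^^ m" "y \<in> V" "rep y = y" "sc y x" "rep x = x" "x \<noteq> y"
  shows "(x, w) \<in> U ^^ m \<or> (\<exists>w'. (x, w') \<in> U ^^ m \<and> sc w w' \<and> w' \<noteq> w \<and> rep w' = w' \<and> w' \<in> V)"
  using assms(1)
proof (induction m arbitrary: w)
  case 0
  then show ?case using assms(2-) sc_V by auto
next
  case (Suc m)
  then obtain w0 where w0: "(y, w0) \<in> U ^^ m" "(w0, w) \<in> U" by auto
  from Suc.IH[OF w0(1)] show ?case
  proof
    assume "(x, w0) \<in> U ^^ m"
    then show ?thesis using w0(2) by auto
  next
    assume "\<exists>w'. (x, w') \<in> U ^^ m \<and> sc w0 w' \<and> w' \<noteq> w0 \<and> rep w' = w' \<and> w' \<in> V"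
    then obtain w' where w': "(x, w') \<in> U ^^ m" "sc w0 w'" "rep w' = w'" "w' \<in> V" by blast
    have "lev w' = Suc (lev w)" using U_lev[OF w0(2)] sc_lev[OF w'(2)] by simp
    then obtain w'' where w'': "(w', w'') \<in> U" using U_ex w' by metis
    have "sc w w''" using U_sc[OF w0(2) w'' w'(2)] .
    moreover have "(x, w'') \<in> U ^^ Suc m" using w'(1) w'' by auto
    ultimately show ?thesis using U_V[OF w''] by (cases "w'' = w") auto
  qed
qed

text \<open>A walk with two peaks \<open>z\<close> and \<open>q\<close> can be shortened: the walk between the peaks can be replaced
  by one that starts or ends at the sibling, because siblings descend in parallel.\<close>
lemma shortcut:
  assumes z: "(z, y) \<in> U" "(z, x) \<in> U" "x \<noteq> y"
    and q: "(q, y') \<in> U" "(q, x') \<in> U" "x' \<noteq> y'"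
    and xy': "UD x y' l"
  shows "UD y y' l \<or> UD x x' l \<or> UD y x' l"
proof -
  from xy' obtain w i j where w: "(x, w) \<in> U ^^ i" "(y', w) \<in> U ^^ j" "i + j = l"
    unfolding UD_def by blast
  note V = U_V[OF z(1)] U_V[OF z(2)] U_V[OF q(1)] U_V[OF q(2)]
  have sc: "sc x y" "sc y' x'" using U_sc z q by (meson sc_refl)+
  have 1: "(y, w) \<in> U ^^ i \<or> (\<exists>w'. (y, w') \<in> U ^^ i \<and> sc w w' \<and> w' \<noteq> w \<and> rep w' = w' \<and> w' \<in> V)"
    using sibling_chain[OF w(1) _ _ sc(1)] V z(3) by blast
  have 2: "(x', w) \<in> U ^^ j \<or> (\<exists>w'. (x', w') \<in> U ^^ j \<and> sc w w' \<and> w' \<noteq> w \<and> rep w' = w' \<and> w' \<in> V)"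
    using sibling_chain[OF w(2) _ _ sc(2)] V q(3) by blast
  show ?thesis
  proof (cases "(y, w) \<in> U ^^ i \<or> (x', w) \<in> U ^^ j")
    case True
    then show ?thesis using w unfolding UD_def by blast
  next
    case False
    with 1 2 obtain w1 w2 where w12: "(y, w1) \<in> U ^^ i" "sc w w1" "w1 \<noteq> w" "rep w1 = w1"
      "(x', w2) \<in> U ^^ j" "sc w w2" "w2 \<noteq> w" "rep w2 = w2" by blast
    have "w \<in> V" "rep w = w" using U_relpow_d[OF w(1)] V by auto
    \<comment> \<open>Both chains avoid \<open>w\<close> but end in its cluster, which has at most
      two representatives.\<close>
    then have "w1 = w2" using two_reps[of w w1 w2] w12 by blast
    then show ?thesis using w12 w(3) unfolding UD_def by blast
  qed
qed

text \<open>If the walk ends while descending, the new edge prolongs the descent. Otherwise its last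
  edge ascends from some \<open>q1\<close> to \<open>q\<close>; the new edge either undoes it or
  makes \<open>q\<close> a peak.\<close>

lemma UD_peak_cases:
  assumes "UD p q l" "(q, q') \<in> U"
  shows "(\<exists>l'\<le>Suc l. UD p q' l') \<or> (\<exists>q1 l'. UD p q1 l' \<and> (q, q1) \<in> U \<and> q' \<noteq> q1 \<and> Suc l' = l)"
proof -
  from assms(1) obtain w i j where w: "(p, w) \<in> U ^^ i" "(q, w) \<in> U ^^ j" "i + j = l"
    unfolding UD_def by blast
  show ?thesis
  proof (cases j)
    case 0
    then have "(p, q') \<in> U ^^ Suc i" using w assms(2) by auto
    then have "UD p q' (Suc l)" using w 0 unfolding UD_def by (intro exI[of _ q'] exI[of _ "Suc i"] exI[of _ 0]) auto
    then show ?thesis by blast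
  next
    case (Suc j')
    then obtain q1 where q1: "(q, q1) \<in> U" "(q1, w) \<in> U ^^ j'" using w(2) by (metis relpow_Suc_D2)
    then have "UD p q1 (i + j')" using w unfolding UD_def by blast
    moreover have "Suc (i + j') = l" using w Suc by simp
    ultimately show ?thesis using q1(1) by (cases "q' = q1") (metis Suc_n_not_le_n le_SucI le_cases lessI less_imp_le, blast)
  qed
qed

text \<open>An edge away from the root never creates a peak, and an edge towards it at most one. A
  second peak yields a strictly shorter walk with the same ends, so strong induction on the length
  closes this case.\<close>

lemma Q_relpow_UD:
  assumes "(p, q) \<in> Q ^^ l"
  shows "\<exists>l'\<le>l. UD p q l' \<or> UD1 p q l'"
  using assms
proof (induction l arbitrary: p q rule: less_induct)
  case (less l)
  show ?case
  proof (cases l)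
    case 0
    then have "UD p q 0" using less.prems by (auto simp: UD_def)
    then show ?thesis by blast
  next
    case (Suc l0)
    then obtain q0 where q0: "(p, q0) \<in> Q ^^ l0" "(q0, q) \<in> Q" using less.prems by auto
    from less.IH[of l0 p q0] q0 Suc obtain l' where l': "l' \<le> l0" "UD p q0 l' \<or> UD1 p q0 l'" by auto
    have up: "UD a q (Suc k)" if "UD a q0 k" "(q, q0) \<in> U" for a k
    proof -
      from that obtain w i j where "(a, w) \<in> U ^^ i" "(q0, w) \<in> U ^^ j" "i + j = k" unfolding UD_def by blast
      then show ?thesis using that(2) unfolding UD_def
        by (intro exI[of _ w] exI[of _ i] exI[of _ "Suc j"]) (auto intro: relpow_Suc_I2 simp del: relpow.simps)
    qed
    from q0(2) show ?thesis
    proof (cases rule: Q_cases)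
      case 2
      from l'(2) show ?thesis
      proof
        assume "UD p q0 l'"
        then show ?thesis using up[OF _ 2] l' Suc by blast
      next
        assume "UD1 p q0 l'"
        then obtain y z x l1 l2 where "UD p y l1" "(z, y) \<in> U" "(z, x) \<in> U" "x \<noteq> y" "UD x q0 l2" "l1 + l2 + 2 = l'"
          unfolding UD1_def by blast
        then have "UD1 p q (Suc l')" unfolding UD1_def using up[OF _ 2, of x l2]
          by (intro exI[of _ y] exI[of _ z] exI[of _ x] exI[of _ l1] exI[of _ "Suc l2"]) auto
        then show ?thesis using l' Suc by auto
      qed
    next
      case 1
      from l'(2) show ?thesis
      proof
        assume "UD p q0 l'"
        from UD_peak_cases[OF this 1] show ?thesis
        proof
          assume "\<exists>l''\<le>Suc l'. UD p q l''"
          then show ?thesis using l'(1) Suc by (meson Suc_le_mono le_trans)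
        next
          assume "\<exists>q1 l''. UD p q1 l'' \<and> (q0, q1) \<in> U \<and> q \<noteq> q1 \<and> Suc l'' = l'"
          then obtain q1 l'' where "UD p q1 l''" "(q0, q1) \<in> U" "q \<noteq> q1" "Suc l'' = l'" by blast
          moreover have "UD q q 0" by (auto simp: UD_def)
          ultimately have "UD1 p q (Suc l')" unfolding UD1_def using 1
            by (intro exI[of _ q1] exI[of _ q0] exI[of _ q] exI[of _ l''] exI[of _ 0]) auto
          then show ?thesis using l'(1) Suc by auto
        qed
      next
        assume "UD1 p q0 l'"
        then obtain y z x l1 l2 where *: "UD p y l1" "(z, y) \<in> U" "(z, x) \<in> U" "x \<noteq> y" "UD x q0 l2" "l1 + l2 + 2 = l'"
          unfolding UD1_def by blast
        from UD_peak_cases[OF *(5) 1] show ?thesis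
        proof
          assume "\<exists>l''\<le>Suc l2. UD x q l''"
          then obtain l'' where "l'' \<le> Suc l2" "UD x q l''" by blast
          then have "UD1 p q (l1 + l'' + 2)" "l1 + l'' + 2 \<le> l"
            using * l'(1) Suc unfolding UD1_def by (blast, linarith)
          then show ?thesis by blast
        next
          assume "\<exists>q1 l''. UD x q1 l'' \<and> (q0, q1) \<in> U \<and> q \<noteq> q1 \<and> Suc l'' = l2"
          then obtain q1 l'' where q1: "UD x q1 l''" "(q0, q1) \<in> U" "q \<noteq> q1" "Suc l'' = l2" by blast
          have E: "(y, z) \<in> Q ^^ 1" "(z, x) \<in> Q ^^ 1" "(q1, q0) \<in> Q ^^ 1" "(q0, q) \<in> Q ^^ 1"
            using *(2,3) q1(2) 1 U_Q Q_sym by auto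
          have p: "(p, y) \<in> Q ^^ l1" using relpow_UD_Q *(1) by blast
          \<comment> \<open>The walk with peaks \<open>z\<close> and \<open>q0\<close> has
            \<open>l1 + l'' + 4\<close> edges. Bypassing one peak saves two of them, bypassing both
            saves four.\<close>
          have "\<exists>k<l. (p, q) \<in> Q ^^ k"
            using shortcut[OF *(2-4) q1(2) 1 q1(3) q1(1)]
          proof (elim disjE)
            assume "UD y q1 l''"
            have "(p, q) \<in> Q ^^ (l1 + l'' + 1 + 1)"
              by (rule relpow_trans[OF relpow_trans[OF relpow_trans[OF p relpow_UD_Q[OF \<open>UD y q1 l''\<close>]] E(3)] E(4)])
            moreover have "l1 + l'' + 1 + 1 < l" using *(6) l'(1) Suc q1(4) by linarith
            ultimately show ?thesis by blast
          next
            assume "UD x q l''"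
            have "(p, q) \<in> Q ^^ (l1 + 1 + 1 + l'')" by (rule relpow_trans[OF relpow_trans[OF relpow_trans[OF p E(1)] E(2)] relpow_UD_Q[OF \<open>UD x q l''\<close>]])
            moreover have "l1 + 1 + 1 + l'' < l" using *(6) l'(1) Suc q1(4) by linarith
            ultimately show ?thesis by blast
          next
            assume "UD y q l''"
            have "(p, q) \<in> Q ^^ (l1 + l'')" by (rule relpow_trans[OF p relpow_UD_Q[OF \<open>UD y q l''\<close>]])
            moreover have "l1 + l'' < l" using *(6) l'(1) Suc q1(4) by linarith
            ultimately show ?thesis by blast
          qed
          then obtain k where k: "k < l" "(p, q) \<in> Q ^^ k" by blast
          from less.IH[OF k] obtain l'' where "l'' \<le> k" "UD p q l'' \<or> UD1 p q l''" by blast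
          moreover from this have "l'' \<le> l" using k(1) by linarith
          ultimately show ?thesis by blast
        qed
      qed
    qed
  qed
qed

section \<open>The output graph and the comparison of distances\<close>

definition EH :: "'a rel" where
  "EH = Q \<union> {(v, rep v) | v. v \<in> V \<and> rep v \<noteq> v} \<union> {(rep v, v) | v. v \<in> V \<and> rep v \<noteq> v}"

lemma EH_V: "EH \<subseteq> V \<times> V" using EV by (auto simp: EH_def Q_def rep_V dest: E_V)
lemma EH_sym: "sym EH" by (auto simp: sym_def EH_def intro: Q_sym)
lemma EH_irrefl: "irrefl EH" by (auto simp: EH_def irrefl_def Q_def)

text \<open>Stated for an arbitrary relation because it is applied to \<open>E\<close> and to
  \<open>EH\<close>: on both, \<open>rep\<close> maps an edge to an edge of \<open>Q\<close> or
  collapses it.\<close>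

lemma relpow_map_rep:
  assumes "(u, v) \<in> R ^^ k" "\<And>x y. (x, y) \<in> R \<Longrightarrow> rep x = rep y \<or> (rep x, rep y) \<in> Q"
  shows "\<exists>l\<le>k. (rep u, rep v) \<in> Q ^^ l"
  using assms(1)
proof (induction k arbitrary: v)
  case 0
  then show ?case by auto
next
  case (Suc k)
  then obtain w where w: "(u, w) \<in> R ^^ k" "(w, v) \<in> R" by auto
  from Suc.IH[OF w(1)] obtain l where l: "l \<le> k" "(rep u, rep w) \<in> Q ^^ l" by blast
  from assms(2)[OF w(2)] show ?case
  proof
    assume "rep w = rep v"
    then show ?thesis using l by (metis le_SucI)
  next
    assume "(rep w, rep v) \<in> Q"
    then have "(rep u, rep v) \<in> Q ^^ Suc l" using l by auto
    then show ?thesis using l by (metis Suc_le_mono)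
  qed
qed

lemma rtrancl_rep_EH: "v \<in> V \<Longrightarrow> \<exists>k\<le>1. (v, rep v) \<in> EH ^^ k"
proof (cases "rep v = v")
  case True
  then show ?thesis by (intro exI[of _ 0]) auto
next
  case False
  assume "v \<in> V"
  then have "(v, rep v) \<in> EH ^^ 1" using False by (auto simp: EH_def)
  then show ?thesis by blast
qed

text \<open>The image of a shortest path under \<open>rep\<close> is a walk in \<open>Q\<close> that
  is no longer; a pendant edge at each end accounts for the 2.\<close>

lemma EH_walk:
  assumes "u \<in> V" "v \<in> V"
  shows "\<exists>k\<le>d u v + 2. (u, v) \<in> EH ^^ k"
proof -
  have "\<exists>l\<le>d u v. (rep u, rep v) \<in> Q ^^ l"
    by (rule relpow_map_rep[OF relpow_d[OF assms]]) (auto simp: Q_def)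
  then obtain l where l: "l \<le> d u v" "(rep u, rep v) \<in> Q ^^ l" by blast
  have "(a, b) \<in> Q ^^ k \<Longrightarrow> (a, b) \<in> EH ^^ k" for a b k
    by (induction k arbitrary: b) (auto simp: EH_def)
  with l(2) have "(rep u, rep v) \<in> EH ^^ l" by blast
  moreover obtain k1 where k1: "k1 \<le> 1" "(u, rep u) \<in> EH ^^ k1" using rtrancl_rep_EH assms by blast
  moreover obtain k2 where k2: "k2 \<le> 1" "(rep v, v) \<in> EH ^^ k2"
    using rtrancl_rep_EH[OF assms(2)] relpow_sym[OF EH_sym] by blast
  ultimately have "(u, v) \<in> EH ^^ (k1 + l + k2)" by (auto simp: relpow_add)
  then show ?thesis using k1 k2 l by (intro exI[of _ "k1 + l + k2"]) auto
qed

lemma EH_connected: "u \<in> V \<Longrightarrow> v \<in> V \<Longrightarrow> (u, v) \<in> EH\<^sup>*"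
  using EH_walk relpow_imp_rtrancl by blast

lemma dist_EH_le: "u \<in> V \<Longrightarrow> v \<in> V \<Longrightarrow> rdist EH u v \<le> d u v + 2"
  using EH_walk[of u v] rdist_le[of u v _ EH] by (meson le_trans)

text \<open>A path of \<open>EH\<close> is mapped by \<open>rep\<close> to a walk of
  \<open>Q\<close>, which can be replaced by one with at most one peak. The error is 252 for that
  walk and 14 at each end for moving to the representatives.\<close>

lemma dist_le_EH:
  assumes "u \<in> V" "v \<in> V"
  shows "d u v \<le> rdist EH u v + 280"
proof -
  have "\<exists>l\<le>rdist EH u v. (rep u, rep v) \<in> Q ^^ l"
  proof (rule relpow_map_rep[OF rdist_relpow[OF EH_connected[OF assms]]])
    fix x y assume "(x, y) \<in> EH"
    then consider "(x, y) \<in> Q" | "x \<in> V" "y = rep x" | "y \<in> V" "x = rep y" by (auto simp: EH_def)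
    then show "rep x = rep y \<or> (rep x, rep y) \<in> Q"
    proof cases
      case 1
      then have "rep x = x" "rep y = y" by (auto simp: Q_def rep_rep dest: E_V)
      then show ?thesis using 1 by simp
    qed (auto simp: rep_rep)
  qed
  then obtain l where l: "l \<le> rdist EH u v" "(rep u, rep v) \<in> Q ^^ l" by blast
  from Q_relpow_UD[OF l(2)] obtain l' where "l' \<le> l" "UD (rep u) (rep v) l' \<or> UD1 (rep u) (rep v) l'" by blast
  then have "d (rep u) (rep v) \<le> rdist EH u v + 252"
    using UD_d[of "rep u" "rep v" l'] UD1_d[of "rep u" "rep v" l'] l(1) assms by (auto simp: rep_V rep_rep)
  moreover have "d u v \<le> d u (rep u) + (d (rep u) (rep v) + d (rep v) v)"
    using d_tri[of u "rep u" v] d_tri[of "rep u" "rep v" v] rep_V assms by (meson add_left_mono le_trans)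
  ultimately show ?thesis using d_rep[OF assms(1)] d_rep[OF assms(2)] d_sym[of "rep v" v] rep_V assms by simp
qed

end

section \<open>Tree-width\<close>

lemma rtrancl_rtrancl_on:
  assumes "(u, v) \<in> R\<^sup>*" "R \<subseteq> S \<times> S" "u \<in> S"
  shows "(u, v) \<in> rtrancl_on S R"
  using assms by (induction rule: rtrancl_induct) (auto intro: rtrancl_on_into_rtrancl_on)

lemma connected_induce_subgraphI:
  assumes "sym (parcs T)" "t \<in> S" "\<And>v. v \<in> S \<Longrightarrow> (v, t) \<in> (parcs T \<inter> S \<times> S)\<^sup>*"
  shows "connected (induce_subgraph (with_proj T) S)"
proof -
  let ?R = "parcs T \<inter> S \<times> S"
  let ?M = "mk_symmetric (induce_subgraph (with_proj T) S)"
  have M: "pverts ?M = S" "parcs ?M = ?R"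
    using assms(1) by (auto simp: mk_symmetric_def dest: symD)
  have "sym ?R" using assms(1) by (auto simp: sym_def)
  then have sym: "sym (?R\<^sup>*)" by (rule sym_rtrancl)
  have "(u, v) \<in> ?R\<^sup>*" if "u \<in> S" "v \<in> S" for u v
    using assms(3)[OF that(1)] symD[OF sym assms(3)[OF that(2)]] by (rule rtrancl_trans)
  then have "(u, v) \<in> rtrancl_on S ?R" if "u \<in> S" "v \<in> S" for u v
    using that by (intro rtrancl_rtrancl_on) auto
  then show ?thesis
    unfolding connected_def strongly_connected_def reachable_def with_proj_simps M
    using assms(2) by blast
qed

lemma pcas_nth:
  "pcas u p v \<Longrightarrow> i < length p \<Longrightarrow> fst (p ! i) = (if i = 0 then u else snd (p ! (i - 1)))"
proof (induction p arbitrary: u i)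
  case (Cons e p)
  then show ?case by (cases i) (auto simp: nth_Cons split: nat.splits)
qed simp

lemma pcas_last: "pcas u p v \<Longrightarrow> p \<noteq> [] \<Longrightarrow> snd (last p) = v"
  by (induction p arbitrary: u) (auto split: if_splits)

lemma pcas_verts: "pcas u p v \<Longrightarrow> tl (pawalk_verts u p) = map snd p"
proof (induction p arbitrary: u)
  case (Cons e p)
  then show ?case by (cases p) auto
qed simp

text \<open>A vertex of maximal rank on a cycle would be followed and preceded by its parent.\<close>
lemma parent_rank_no_cycle:
  fixes rk :: "'a \<Rightarrow> nat"
  assumes arcs: "\<And>x y. (x, y) \<in> parcs T \<Longrightarrow> (y = par x \<and> rk y < rk x) \<or> (x = par y \<and> rk x < rk y)"
  shows "\<not> (\<exists>p. pre_digraph.cycle (with_proj T) p \<and> 3 \<le> length p)"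
proof
  assume "\<exists>p. pre_digraph.cycle (with_proj T) p \<and> 3 \<le> length p"
  then obtain p u where p: "set p \<subseteq> parcs T" "pcas u p u" "distinct (map snd p)" and l: "3 \<le> length p"
    unfolding pre_digraph.cycle_def pre_digraph.awalk_def cas_with_proj_eq awalk_verts_with_proj_eq
    by (auto simp: pcas_verts)
  define y where "y i = snd (p ! i)" for i
  define prev where "prev i = (if i = 0 then length p - 1 else i - 1)" for i
  define succ where "succ i = (if i = length p - 1 then 0 else i + 1)" for i
  have u: "u = y (length p - 1)" using pcas_last[OF p(2)] l by (cases p) (auto simp: y_def last_conv_nth)
  have arc: "(y (prev i), y i) \<in> parcs T" if "i < length p" for i
  proof -
    have "p ! i = (y (prev i), y i)"
      using pcas_nth[OF p(2) that] u by (auto simp: prod_eq_iff prev_def y_def)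
    moreover have "p ! i \<in> parcs T" using nth_mem[OF that] p(1) by blast
    ultimately show ?thesis by simp
  qed
  have "finite ((\<lambda>i. rk (y i)) ` {..<length p})" "(\<lambda>i. rk (y i)) ` {..<length p} \<noteq> {}" using l
    by (auto simp: lessThan_empty_iff)
  then have "Max ((\<lambda>i. rk (y i)) ` {..<length p}) \<in> (\<lambda>i. rk (y i)) ` {..<length p}" by (rule Max_in)
  then obtain i where i: "i < length p" and "rk (y i) = Max ((\<lambda>i. rk (y i)) ` {..<length p})" by auto
  then have max: "rk (y j) \<le> rk (y i)" if "j < length p" for j using that by simp
  \<comment> \<open>At length 3 or more the two cyclic neighbours of a position are different
    positions; both carry the parent of \<open>y i\<close>, against distinctness.\<close>
  have pi: "prev i < length p" "succ i < length p" "prev (succ i) = i" "prev i \<noteq> succ i"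
    using i l by (auto simp: prev_def succ_def)
  have "y (prev i) = par (y i)" using arcs[OF arc[OF i]] max[OF pi(1)] by auto
  moreover have "y (succ i) = par (y i)" using arcs[OF arc[OF pi(2)]] max[OF pi(2)] pi(3) by auto
  ultimately have "map snd p ! prev i = map snd p ! succ i" using pi by (simp add: y_def)
  then show False using nth_eq_iff_index_eq[OF p(3)] pi by simp
qed

text \<open>The nodes of the decomposition tree are the vertices themselves; the bag of \<open>v\<close> is the topmost
  one that contains \<open>v\<close>.\<close>
lemma treewidth_le_2:
  fixes H :: "nat pair_pre_digraph" and rk par :: "nat \<Rightarrow> nat"
  assumes H: "pair_graph H" and r: "r \<in> pverts H" "B r = {r}"
    and par: "\<And>v. v \<in> pverts H \<Longrightarrow> v \<noteq> r \<Longrightarrow> par v \<in> pverts H \<and> rk (par v) < rk v \<and> B v - {v} \<subseteq> B (par v)"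
    and B: "\<And>v. v \<in> pverts H \<Longrightarrow> v \<in> B v \<and> B v \<subseteq> pverts H \<and> card (B v) \<le> 3"
    and edge: "\<And>u w. (u, w) \<in> parcs H \<Longrightarrow> u \<in> B w \<or> w \<in> B u"
  shows "treewidth H \<le> 2"
proof -
  define V where "V = pverts H"
  note fin = H[unfolded pair_graph_iff, folded V_def]
  note r = r[folded V_def] and par = par[folded V_def] and B = B[folded V_def]
  define T where "T = \<lparr> pverts = V, parcs = {(v, par v) | v. v \<in> V \<and> v \<noteq> r} \<union> {(par v, v) | v. v \<in> V \<and> v \<noteq> r} \<rparr>"
  have TV: "pverts T = V" by (simp add: T_def)
  have arcT: "(v, par v) \<in> parcs T" if "v \<in> V" "v \<noteq> r" for v using that by (auto simp: T_def)
  have T: "pair_graph T"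
    unfolding pair_graph_iff
  proof (intro conjI)
    show "finite (pverts T)" using fin TV by simp
    show "parcs T \<subseteq> pverts T \<times> pverts T" using par by (auto simp: T_def)
    show "sym (parcs T)" by (auto simp: T_def sym_def)
    have "v \<noteq> par v" if "v \<in> V" "v \<noteq> r" for v using par[OF that] by auto
    then show "irrefl (parcs T)" unfolding irrefl_def by (simp add: T_def) metis
  qed
  \<comment> \<open>A set that contains the parent of each of its vertices other than
    \<open>t\<close> is connected: climbing to parents lowers the rank until \<open>t\<close> is
    reached. This serves for the whole tree and for the nodes whose bags contain a given
    vertex.\<close>
  have con: "connected (induce_subgraph (with_proj T) S)"
    if S: "t \<in> S" "S \<subseteq> V" "\<And>v. v \<in> S \<Longrightarrow> v \<noteq> t \<Longrightarrow> v \<noteq> r \<and> par v \<in> S" for S t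
  proof (rule connected_induce_subgraphI)
    show "sym (parcs T)" using T by (simp add: pair_graph_iff)
    show "t \<in> S" by fact
    show "(v, t) \<in> (parcs T \<inter> S \<times> S)\<^sup>*" if "v \<in> S" for v
      using that
    proof (induction "rk v" arbitrary: v rule: less_induct)
      case less
      show ?case
      proof (cases "v = t")
        case False
        then have v: "v \<noteq> r" "par v \<in> S" "v \<in> V" using S less.prems by auto
        then have "(par v, t) \<in> (parcs T \<inter> S \<times> S)\<^sup>*" using less.hyps par by blast
        moreover have "(v, par v) \<in> parcs T \<inter> S \<times> S" using arcT v less.prems by auto
        ultimately show ?thesis by (rule converse_rtrancl_into_rtrancl[rotated])
      qed simp
    qed
  qed
  have "undirected_tree T"
    unfolding undirected_tree_def
  proof (intro conjI)
    show "pair_graph T" by fact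
    have "connected (induce_subgraph (with_proj T) V)" using r(1) par by (intro con[of r]) auto
    moreover have "induce_subgraph (with_proj T) V = with_proj T"
      using T by (auto simp: induce_subgraph_def with_proj_def pair_graph_iff TV)
    ultimately show "connected (with_proj T)" by simp
    show "\<not> (\<exists>p. pre_digraph.cycle (with_proj T) p \<and> 3 \<le> length p)"
      by (rule parent_rank_no_cycle[of _ par rk]) (use par in \<open>auto simp: T_def\<close>)
  qed
  moreover have "(\<Union>t\<in>V. B t) = V" using B by blast
  moreover have "\<exists>t\<in>V. u \<in> B t \<and> w \<in> B t" if "(u, w) \<in> parcs H" for u w
    using edge[OF that] that fin B by blast
  moreover have "connected (induce_subgraph (with_proj T) {t \<in> V. v \<in> B t})" if "v \<in> V" for v
  proof (rule con)
    show "v \<in> {t \<in> V. v \<in> B t}" using B that by simp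
    fix t assume t: "t \<in> {t \<in> V. v \<in> B t}" "t \<noteq> v"
    then have "t \<noteq> r" using r(2) by auto
    then show "t \<noteq> r \<and> par t \<in> {t \<in> V. v \<in> B t}" using par[of t] t by auto
  qed auto
  ultimately have "tree_decomposition H T B"
    unfolding tree_decomposition_def TV V_def[symmetric] by auto
  then have "treewidth H \<le> decomposition_width T B"
    unfolding treewidth_def by (intro Least_le) blast
  also have "\<dots> \<le> 2"
  proof -
    have "Max ((\<lambda>t. card (B t)) ` V) \<le> 3" using fin r(1) B by (subst Max_le_iff) auto
    then show ?thesis by (simp add: decomposition_width_def TV)
  qed
  finally show ?thesis .
qed

section \<open>Tree decomposition of the output graph\<close>

context grouping
begin

text \<open>In an unsplit cluster this is the leader again, so \<open>ld v\<close> and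
  \<open>top v\<close> always list the representatives of the cluster. The bag of
  \<open>top v\<close> contains both, which is why leaders one layer up attach there.\<close>

definition top :: "'a \<Rightarrow> 'a" where
  "top v = (case far (ld v) of None \<Rightarrow> ld v | Some y \<Rightarrow> y)"

definition low :: "'a \<Rightarrow> 'a" where
  "low v = (SOME w. (v, w) \<in> U)"

text \<open>The leader \<open>ld v\<close> of a cluster shares its bag with both groups of the cluster below; the second
  group \<open>top v\<close> shares its bag with the leader and its unique lower group.\<close>

definition tpar :: "'a \<Rightarrow> 'a" where
  "tpar v = (if rep v \<noteq> v then rep v else if v = ld v then top (low v) else ld v)"

definition bag :: "'a \<Rightarrow> 'a set" where
  "bag v = (if rep v \<noteq> v then {v, rep v} else if v = r then {r}
    else if v = ld v then {v, ld (low v), top (low v)} else {v, ld v, low v})"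

text \<open>The order within a layer is leaders, second groups, pendant vertices. Each parent is
  earlier in this order or one layer lower.\<close>

definition rank :: "'a \<Rightarrow> nat" where
  "rank v = 3 * lev v + (if rep v \<noteq> v then 2 else if v = ld v then 0 else 1)"

lemma ld_ld: "v \<in> V \<Longrightarrow> ld (ld v) = ld v" using ld_eq[OF _ ld_sc] by metis

lemma rep_ld: "v \<in> V \<Longrightarrow> rep (ld v) = ld v"
  by (simp add: rep_def ld_V ld_ld split: option.splits)

lemma top_props:
  assumes "v \<in> V"
  shows "sc v (top v)" "top v \<in> V" "ld (top v) = ld v" "rep (top v) = top v"
proof -
  show *: "sc v (top v)" using ld_sc[OF assms] far_Some[OF assms] unfolding top_def
    by (auto split: option.splits intro: sc_trans)
  show "top v \<in> V" using sc_V[OF * assms] .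
  show ld: "ld (top v) = ld v" using ld_eq[OF assms *] by simp
  show "rep (top v) = top v"
    unfolding rep_def[OF \<open>top v \<in> V\<close>] ld using far_Some[OF assms] rep_ld[OF assms]
    by (auto simp: top_def split: option.splits)
qed

lemma rep_cases:
  assumes "q \<in> V" "rep q = q" "sc q s"
  shows "q = ld s \<or> q = top s"
proof -
  have "ld q = ld s" using ld_eq[of q s] assms by simp
  then show ?thesis using assms(2) rep_def[OF assms(1)] by (auto simp: top_def split: option.splits if_splits)
qed

lemma low_U:
  assumes "v \<in> V" "rep v = v" "v \<noteq> r"
  shows "(v, low v) \<in> U"
proof -
  have "lev v \<noteq> 0" using d_0[OF rV assms(1)] assms(3) by auto
  then obtain k where "lev v = Suc k" using not0_implies_Suc by blast
  then obtain q where "(v, q) \<in> U" using U_ex assms by metis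
  then show ?thesis unfolding low_def by (rule someI)
qed

lemma ld_r: "ld r = r" "rep r = r"
proof -
  have "lev (ld r) = 0" using sc_lev[OF ld_sc[OF rV]] by simp
  then show 1: "ld r = r" using d_0[OF rV ld_V[OF rV]] by simp
  then show "rep r = r" using rep_ld[OF rV] by simp
qed

lemma ld_neq_r: "v \<in> V \<Longrightarrow> v \<noteq> r \<Longrightarrow> ld v \<noteq> r"
  using sc_lev[OF ld_sc[of v]] d_0[OF rV, of v] by auto

lemma bag_tpar:
  assumes "v \<in> V" "v \<noteq> r"
  shows "tpar v \<in> V \<and> rank (tpar v) < rank v \<and> bag v - {v} \<subseteq> bag (tpar v)"
proof -
  consider "rep v \<noteq> v" | "rep v = v" "v = ld v" | "rep v = v" "v \<noteq> ld v" by blast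
  then show ?thesis
  proof cases
    case 1
    then show ?thesis using assms(1) rep_rep rep_V rep_lev by (auto simp: tpar_def bag_def rank_def)
  next
    case 2
    define w where "w = low v"
    have U: "(v, w) \<in> U" using low_U assms 2 by (simp add: w_def)
    have w: "w \<in> V" "lev v = Suc (lev w)" using U_V U_lev U by blast+
    have t: "tpar v = top w" "bag v = {v, ld w, top w}"
      using 2 assms by (auto simp: tpar_def bag_def w_def)
    have "rank (top w) < rank v"
      using w top_props[OF w(1)] sc_lev[of w "top w"] 2 by (auto simp: rank_def)
    moreover have "{ld w, top w} \<subseteq> bag (top w)"
    proof (cases "top w = r \<or> top w = ld w")
      case True
      then have "top w = ld w" using top_props(3)[OF w(1)] ld_r by auto
      then show ?thesis by (auto simp: bag_def)
    next
      case False
      then show ?thesis using top_props[OF w(1)] by (auto simp: bag_def)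
    qed
    ultimately show ?thesis using t top_props[OF w(1)] by auto
  next
    case 3
    have l: "ld v \<in> V" "rep (ld v) = ld v" "ld v \<noteq> r" "ld (ld v) = ld v" "sc v (ld v)" "lev (ld v) = lev v"
      using ld_V[OF assms(1)] rep_ld[OF assms(1)] ld_neq_r[OF assms] ld_ld[OF assms(1)]
        ld_sc[OF assms(1)] sc_lev[OF ld_sc[OF assms(1)]] by simp_all
    have U: "(v, low v) \<in> U" "(ld v, low (ld v)) \<in> U" using low_U[of v] low_U[of "ld v"] assms 3(1) l(1-3) by blast+
    \<comment> \<open>Leader and second group have their lower groups in the same cluster, and the
      bag of the leader holds all representatives of that cluster.\<close>
    have "sc (low v) (low (ld v))" using U_sc[OF U l(5)] .
    then have "low v = ld (low (ld v)) \<or> low v = top (low (ld v))"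
      using rep_cases[of "low v" "low (ld v)"] U_V[OF U(1)] by blast
    then show ?thesis using 3 assms l(1-4,6) by (auto simp: tpar_def bag_def rank_def)
  qed
qed

lemma card_3_le: "card {a, b, c} \<le> 3"
  by (simp add: card_insert_if)

lemma bag_props:
  assumes "v \<in> V"
  shows "v \<in> bag v \<and> bag v \<subseteq> V \<and> card (bag v) \<le> 3"
proof -
  have "v \<in> bag v" by (auto simp: bag_def)
  moreover have "bag v \<subseteq> V"
  proof (cases "rep v = v \<and> v \<noteq> r")
    case True
    then have "low v \<in> V" using U_V low_U assms by blast
    then show ?thesis using True assms ld_V top_props by (auto simp: bag_def)
  qed (use assms rep_V rV in \<open>auto simp: bag_def\<close>)
  moreover have "card (bag v) \<le> 3"
    using card_3_le[of v v "rep v"] by (auto simp: bag_def card_3_le)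
  ultimately show ?thesis by blast
qed

text \<open>A leader may have two lower groups, and its bag lists both. A second group exists only
  in a split cluster, where the lower group is unique.\<close>

lemma bag_U:
  assumes "(p, q) \<in> U"
  shows "q \<in> bag p"
proof -
  note V = U_V[OF assms]
  have "p \<noteq> r" using U_lev[OF assms] by auto
  then have l: "(p, low p) \<in> U" using low_U V by blast
  show ?thesis
  proof (cases "p = ld p")
    case True
    have "sc q (low p)" using U_sc[OF assms l] by simp
    then have "q = ld (low p) \<or> q = top (low p)" using rep_cases V by blast
    then show ?thesis using True V \<open>p \<noteq> r\<close> by (auto simp: bag_def)
  next
    case False
    then have "q = low p" using U_unique[OF assms l ld_sc[OF V(1)] rep_ld[OF V(1)]] by blast
    then show ?thesis using False V \<open>p \<noteq> r\<close> by (auto simp: bag_def)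
  qed
qed

lemma bag_EH:
  assumes "(u, w) \<in> EH"
  shows "u \<in> bag w \<or> w \<in> bag u"
proof -
  from assms consider "(u, w) \<in> Q" | "w = rep u" "rep u \<noteq> u" | "u = rep w" "rep w \<noteq> w"
    by (auto simp: EH_def)
  then show ?thesis
  proof cases
    case 1
    then show ?thesis using bag_U by (cases rule: Q_cases) auto
  qed (auto simp: bag_def)
qed

lemma pair_graph_EH: "pair_graph \<lparr> pverts = V, parcs = EH \<rparr>"
  using finV EH_V EH_sym EH_irrefl by (simp add: pair_graph_iff)

end

lemma grouping_treewidth:
  fixes V :: "nat set"
  assumes "grouping V E r ld far rep"
  shows "treewidth \<lparr> pverts = V, parcs = grouping.EH V E rep \<rparr> \<le> 2"
proof -
  interpret grouping V E r ld far rep by fact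
  show ?thesis
    by (rule treewidth_le_2[where r = r and B = bag and par = tpar and rk = rank])
      (use pair_graph_EH bag_tpar bag_props bag_EH ld_r rV in \<open>auto simp: bag_def[of r]\<close>)
qed

section \<open>Program logic\<close>

definition runs :: "nat \<Rightarrow> com \<Rightarrow> state \<Rightarrow> nat \<Rightarrow> (state \<Rightarrow> bool) \<Rightarrow> bool" where
  "runs W c s T Q \<longleftrightarrow> (\<exists>t s'. exec W c s t s' \<and> t \<le> T \<and> Q s')"

text \<open>Evaluation is separated into a total value and a condition \<open>aok\<close> that every
  intermediate result is below \<open>W\<close>, which keeps \<open>option\<close> out of the
  invariants. A truncated difference is bounded by its first operand, hence \<open>Sub\<close>
  contributes no inequality.\<close>

fun av :: "state \<Rightarrow> aexp \<Rightarrow> nat" where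
  "av s (Const k) = k"
| "av s (Cell a e) = s a (av s e)"
| "av s (Add e f) = av s e + av s f"
| "av s (Sub e f) = av s e - av s f"
| "av s (Mul e f) = av s e * av s f"

fun aok :: "nat \<Rightarrow> state \<Rightarrow> aexp \<Rightarrow> bool" where
  "aok W s (Const k) \<longleftrightarrow> k < W"
| "aok W s (Cell a e) \<longleftrightarrow> aok W s e \<and> s a (av s e) < W"
| "aok W s (Add e f) \<longleftrightarrow> aok W s e \<and> aok W s f \<and> av s e + av s f < W"
| "aok W s (Sub e f) \<longleftrightarrow> aok W s e \<and> aok W s f"
| "aok W s (Mul e f) \<longleftrightarrow> aok W s e \<and> aok W s f \<and> av s e * av s f < W"

fun bv :: "state \<Rightarrow> bexp \<Rightarrow> bool" where
  "bv s (Less e f) \<longleftrightarrow> av s e < av s f"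
| "bv s (Equal e f) \<longleftrightarrow> av s e = av s f"
| "bv s (Neg b) \<longleftrightarrow> \<not> bv s b"
| "bv s (Conj b c) \<longleftrightarrow> bv s b \<and> bv s c"

fun bok :: "nat \<Rightarrow> state \<Rightarrow> bexp \<Rightarrow> bool" where
  "bok W s (Less e f) \<longleftrightarrow> aok W s e \<and> aok W s f"
| "bok W s (Equal e f) \<longleftrightarrow> aok W s e \<and> aok W s f"
| "bok W s (Neg b) \<longleftrightarrow> bok W s b"
| "bok W s (Conj b c) \<longleftrightarrow> bok W s b \<and> bok W s c"

lemma aval_av: "aok W s e \<Longrightarrow> aval W s e = Some (av s e) \<and> av s e < W"
  by (induction e) (auto simp: fit_def lift2_def)

lemma bval_bv: "bok W s b \<Longrightarrow> bval W s b = Some (bv s b)"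
  by (induction b) (auto simp: lift2_def aval_av)

text \<open>For loop-free programs only; loops get the junk values \<open>False\<close> here and 0 in \<open>cost\<close>.\<close>
fun wp :: "nat \<Rightarrow> com \<Rightarrow> state \<Rightarrow> (state \<Rightarrow> bool) \<Rightarrow> bool" where
  "wp W Skip s Q \<longleftrightarrow> Q s"
| "wp W (Store a i e) s Q \<longleftrightarrow> aok W s i \<and> aok W s e \<and> Q (s(a := (s a)(av s i := av s e)))"
| "wp W (Seq c d) s Q \<longleftrightarrow> wp W c s (\<lambda>s'. wp W d s' Q)"
| "wp W (Cond b c d) s Q \<longleftrightarrow> bok W s b \<and> (if bv s b then wp W c s Q else wp W d s Q)"
| "wp W (While b c) s Q \<longleftrightarrow> False"

fun cost :: "com \<Rightarrow> nat" where
  "cost Skip = 1"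
| "cost (Store a i e) = 1"
| "cost (Seq c d) = cost c + cost d"
| "cost (Cond b c d) = 1 + max (cost c) (cost d)"
| "cost (While b c) = 0"

lemma runs_weaken: "runs W c s T Q \<Longrightarrow> T \<le> T' \<Longrightarrow> (\<And>s'. Q s' \<Longrightarrow> Q' s') \<Longrightarrow> runs W c s T' Q'"
  unfolding runs_def by (meson le_trans)

lemma runs_Seq:
  assumes "runs W c s T1 R" "\<And>s'. R s' \<Longrightarrow> runs W d s' T2 Q"
  shows "runs W (Seq c d) s (T1 + T2) Q"
  using assms unfolding runs_def by (meson add_mono exec.Seq)

lemma wp_runs: "wp W c s Q \<Longrightarrow> runs W c s (cost c) Q"
proof (induction c arbitrary: s Q)
  case Skip
  have "exec W Skip s 1 s" by (rule exec.Skip)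
  with Skip show ?case by (auto simp: runs_def)
next
  case (Store a i e)
  then have "exec W (Store a i e) s 1 (s(a := (s a)(av s i := av s e)))"
    by (intro exec.Store) (auto simp: aval_av)
  with Store show ?case by (auto simp: runs_def)
next
  case (Seq c d)
  from Seq.prems have "runs W c s (cost c) (\<lambda>s'. wp W d s' Q)" by (intro Seq.IH) simp
  then have "runs W (Seq c d) s (cost c + cost d) Q" by (rule runs_Seq) (rule Seq.IH)
  then show ?case by simp
next
  case (Cond b c d)
  show ?case
  proof (cases "bv s b")
    case True
    then obtain t s' where "exec W c s t s'" "t \<le> cost c" "Q s'"
      using Cond.IH(1)[of s Q] Cond.prems by (auto simp: runs_def)
    then show ?thesis using Cond.prems True unfolding runs_def
      by (intro exI[of _ "1 + t"] exI[of _ s'] conjI exec.CondTrue) (auto simp: bval_bv)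
  next
    case False
    then obtain t s' where "exec W d s t s'" "t \<le> cost d" "Q s'"
      using Cond.IH(2)[of s Q] Cond.prems by (auto simp: runs_def)
    then show ?thesis using Cond.prems False unfolding runs_def
      by (intro exI[of _ "1 + t"] exI[of _ s'] conjI exec.CondFalse) (auto simp: bval_bv)
  qed
qed simp

lemma wp_runs_le: "wp W c s Q \<Longrightarrow> cost c \<le> T \<Longrightarrow> runs W c s T Q"
  using wp_runs runs_weaken by blast

lemma runs_Seq_wp:
  assumes "wp W c s (\<lambda>x. x = s1)" "runs W d s1 T Q"
  shows "runs W (Seq c d) s (cost c + T) Q"
  using wp_runs[OF assms(1)] assms(2) by (auto intro: runs_Seq)

text \<open>Potential method: a round of time \<open>T\<close>, together with its test, must lower
  \<open>\<Phi>\<close> by at least \<open>T + 1\<close>. \<open>T\<close> may depend on the state,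
  as a round of a search costs in proportion to the degree of the vertex it processes.\<close>

lemma runs_While:
  assumes "I s" "\<And>s. I s \<Longrightarrow> bok W s b"
    and step: "\<And>s. I s \<Longrightarrow> bv s b \<Longrightarrow> \<exists>T. runs W c s T (\<lambda>s'. I s' \<and> \<Phi> s' + T + 1 \<le> \<Phi> s)"
    and "\<And>s. I s \<Longrightarrow> \<not> bv s b \<Longrightarrow> Q s"
  shows "runs W (While b c) s (\<Phi> s + 1) Q"
  using assms(1)
proof (induction "\<Phi> s" arbitrary: s rule: less_induct)
  case less
  show ?case
  proof (cases "bv s b")
    case True
    from step[OF less.prems True] obtain T t s' where
      s': "exec W c s t s'" "t \<le> T" "I s'" "\<Phi> s' + T + 1 \<le> \<Phi> s" unfolding runs_def by blast
    then obtain t' s'' where s'': "exec W (While b c) s' t' s''" "t' \<le> \<Phi> s' + 1" "Q s''"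
      using less.hyps[of s'] unfolding runs_def by auto
    have "exec W (While b c) s (1 + t + t') s''"
      using s' s'' True assms(2)[OF less.prems] by (intro exec.WhileTrue) (auto simp: bval_bv)
    moreover have "1 + t + t' \<le> \<Phi> s + 1" using s' s'' by linarith
    ultimately show ?thesis using s'' unfolding runs_def by blast
  next
    case False
    then have "bval W s b = Some False" "Q s" using assms(2,4) less.prems by (auto simp: bval_bv)
    moreover from this have "exec W (While b c) s 1 s" by (intro exec.WhileFalse)
    ultimately have "exec W (While b c) s 1 s" "Q s" by blast+
    then show ?thesis unfolding runs_def by auto
  qed
qed

abbreviation Var :: "nat \<Rightarrow> aexp" where "Var x \<equiv> Cell x (Const 0)"
abbreviation Assign :: "nat \<Rightarrow> aexp \<Rightarrow> com" where "Assign x e \<equiv> Store x (Const 0) e"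

definition For :: "nat \<Rightarrow> aexp \<Rightarrow> aexp \<Rightarrow> com \<Rightarrow> com" where
  "For x e f c = Seq (Assign x e)
     (While (Less (Var x) f) (Seq c (Assign x (Add (Var x) (Const 1)))))"

text \<open>The bound \<open>f\<close> is evaluated at every test, so the invariant has to guarantee
  its value. Test and increment give the 2 per round, initialisation and failing test the final
  2.\<close>

lemma runs_For:
  assumes e: "aok W s e" "av s e = L" "L \<le> N" "N < W"
    and init: "I L (s(x := (s x)(0 := L)))"
    and f: "\<And>i s. I i s \<Longrightarrow> aok W s f \<and> av s f = N"
    and step: "\<And>i s. I i s \<Longrightarrow> s x 0 = i \<Longrightarrow> L \<le> i \<Longrightarrow> i < N \<Longrightarrow>
      runs W c s (T i) (\<lambda>s'. s' x 0 = i \<and> I (Suc i) (s'(x := (s' x)(0 := Suc i))))"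
  shows "runs W (For x e f c) s ((\<Sum>i=L..<N. T i + 2) + 2) (I N)"
proof -
  let ?s = "s(x := (s x)(0 := L))"
  let ?J = "\<lambda>s. I (s x 0) s \<and> L \<le> s x 0 \<and> s x 0 \<le> N"
  let ?\<Phi> = "\<lambda>s. \<Sum>i=s x 0..<N. T i + 2"
  have W: "1 < W" if "i < N" for i :: nat using that e(4) by linarith
  have "runs W (While (Less (Var x) f) (Seq c (Assign x (Add (Var x) (Const 1))))) ?s (?\<Phi> ?s + 1) (I N)"
  proof (rule runs_While[where I = ?J and \<Phi> = ?\<Phi>])
    show "?J ?s" using init e by simp
    show "bok W s (Less (Var x) f)" if "?J s" for s
      using that f[of "s x 0" s] e(4) by auto
    show "I N s" if "?J s" "\<not> bv s (Less (Var x) f)" for s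
      using that f[of "s x 0" s] by (auto simp: not_less dest: antisym)
    show "\<exists>T'. runs W (Seq c (Assign x (Add (Var x) (Const 1)))) s T' (\<lambda>s'. ?J s' \<and> ?\<Phi> s' + T' + 1 \<le> ?\<Phi> s)"
      if "?J s" "bv s (Less (Var x) f)" for s
    proof -
      define i where "i = s x 0"
      have i: "I i s" "s x 0 = i" "L \<le> i" "i < N" using that f[of "s x 0" s] by (auto simp: i_def)
      have "?\<Phi> s = T i + 2 + (\<Sum>i=Suc i..<N. T i + 2)" using i by (simp add: sum.atLeast_Suc_lessThan)
      then have "runs W (Seq c (Assign x (Add (Var x) (Const 1)))) s (T i + 1) (\<lambda>s'. ?J s' \<and> ?\<Phi> s' + (T i + 1) + 1 \<le> ?\<Phi> s)"
        using i e(4) W[OF i(4)] by (intro runs_Seq[OF step[OF i]] wp_runs_le) auto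
      then show ?thesis by blast
    qed
  qed
  moreover have "runs W (Assign x e) s 1 (\<lambda>s'. s' = ?s)"
    using e by (intro wp_runs_le) auto
  ultimately have "runs W (For x e f c) s (1 + (?\<Phi> ?s + 1)) (I N)"
    unfolding For_def by (intro runs_Seq[where R = "\<lambda>s'. s' = ?s"]) auto
  then show ?thesis by (simp add: add.commute)
qed

lemma runs_For_const:
  assumes "aok W s e" "av s e = L" "L \<le> N" "N < W"
    and "I L (s(x := (s x)(0 := L)))"
    and "\<And>i s. I i s \<Longrightarrow> aok W s f \<and> av s f = N"
    and "\<And>i s. I i s \<Longrightarrow> s x 0 = i \<Longrightarrow> L \<le> i \<Longrightarrow> i < N \<Longrightarrow>
      runs W c s T (\<lambda>s'. s' x 0 = i \<and> I (Suc i) (s'(x := (s' x)(0 := Suc i))))"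
  shows "runs W (For x e f c) s ((N - L) * (T + 2) + 2) (I N)"
  using runs_For[where T = "\<lambda>_. T" and I = I, OF assms] by simp

section \<open>Breadth-first search\<close>

text \<open>Distances are stored incremented by one, so that 0 means that there is no path.\<close>
definition bfs_val :: "'a rel \<Rightarrow> 'a \<Rightarrow> 'a \<Rightarrow> nat" where
  "bfs_val E u v = (if (u, v) \<in> E\<^sup>* then Suc (rdist E u v) else 0)"

text \<open>\<open>D\<close> are the tentative values and \<open>q\<close> the queue, of which the cells from \<open>h\<close> to \<open>t - 1\<close> are
  pending; \<open>A\<close> are the neighbours of \<open>q h\<close> scanned so far.\<close>
definition bfs_inv :: "nat rel \<Rightarrow> nat \<Rightarrow> (nat \<Rightarrow> nat) \<Rightarrow> (nat \<Rightarrow> nat) \<Rightarrow> nat \<Rightarrow> nat \<Rightarrow> nat set \<Rightarrow> bool" where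
  "bfs_inv E r D q h t A \<longleftrightarrow>
     h \<le> t \<and> inj_on q {..<t} \<and> q ` {..<t} = {w. D w \<noteq> 0} \<and> D r = 1 \<and>
     (\<forall>w. D w \<noteq> 0 \<longrightarrow> (r, w) \<in> E ^^ (D w - 1)) \<and>
     (\<forall>i j. i \<le> j \<longrightarrow> j < t \<longrightarrow> D (q i) \<le> D (q j)) \<and>
     (\<forall>j<t. h < t \<longrightarrow> D (q j) \<le> Suc (D (q h))) \<and>
     (\<forall>j<t. D (q j) \<le> Suc j) \<and>
     (\<forall>i<h. \<forall>w. (q i, w) \<in> E \<longrightarrow> D w \<noteq> 0 \<and> D w \<le> Suc (D (q i))) \<and>
     (\<forall>w\<in>A. (q h, w) \<in> E \<longrightarrow> D w \<noteq> 0 \<and> D w \<le> Suc (D (q h)))"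

lemma bfs_inv_init: "bfs_inv E r ((\<lambda>_. 0)(r := 1)) (q(0 := r)) 0 1 {}"
  by (auto simp: bfs_inv_def lessThan_Suc)

text \<open>A neighbour that already has a value is in the queue, where no value exceeds that of the
  head by more than one.\<close>

lemma bfs_inv_skip:
  assumes inv: "bfs_inv E r D q h t A" and "h < t" and "(q h, w) \<in> E \<Longrightarrow> D w \<noteq> 0"
  shows "bfs_inv E r D q h t (insert w A)"
proof -
  have "D w \<le> Suc (D (q h))" if "(q h, w) \<in> E"
  proof -
    have "q ` {..<t} = {w. D w \<noteq> 0}" using inv unfolding bfs_inv_def by blast
    then have "w \<in> q ` {..<t}" using assms(3)[OF that] by blast
    then obtain j where "j < t" "w = q j" by blast
    then show ?thesis using inv \<open>h < t\<close> unfolding bfs_inv_def by blast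
  qed
  then show ?thesis using inv assms(3) by (auto simp: bfs_inv_def)
qed

lemma bfs_inv_discover:
  assumes inv: "bfs_inv E r D q h t A" and "h < t" and w: "(q h, w) \<in> E" "D w = 0"
  shows "bfs_inv E r (D(w := Suc (D (q h)))) (q(t := w)) h (Suc t) (insert w A)"
proof -
  let ?D = "D(w := Suc (D (q h)))" and ?q = "q(t := w)"
  from inv have
    1: "h \<le> t" "inj_on q {..<t}" "q ` {..<t} = {w. D w \<noteq> 0}" "D r = 1" and
    2: "\<And>w. D w \<noteq> 0 \<Longrightarrow> (r, w) \<in> E ^^ (D w - 1)" and
    3: "\<And>i j. i \<le> j \<Longrightarrow> j < t \<Longrightarrow> D (q i) \<le> D (q j)" and
    4: "\<And>j. j < t \<Longrightarrow> D (q j) \<le> Suc (D (q h))" and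
    5: "\<And>j. j < t \<Longrightarrow> D (q j) \<le> Suc j" and
    6: "\<And>i w. i < h \<Longrightarrow> (q i, w) \<in> E \<Longrightarrow> D w \<noteq> 0 \<and> D w \<le> Suc (D (q i))" and
    7: "\<And>w. w \<in> A \<Longrightarrow> (q h, w) \<in> E \<Longrightarrow> D w \<noteq> 0 \<and> D w \<le> Suc (D (q h))"
    using \<open>h < t\<close> by (simp_all add: bfs_inv_def)
  have nq: "q j \<noteq> w" "D (q j) \<noteq> 0" if "j < t" for j
  proof -
    have "q j \<in> q ` {..<t}" using that by blast
    then show "D (q j) \<noteq> 0" unfolding 1(3) by simp
    then show "q j \<noteq> w" using w(2) by auto
  qed
  have q: "?q j = q j" "?D (?q j) = D (q j)" if "j < t" for j using that nq[OF that] by auto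
  have qt: "?q t = w" "?D (?q t) = Suc (D (q h))" by auto
  have "w \<notin> q ` {..<t}" using nq by auto
  have c1: "inj_on ?q {..<Suc t}"
    using 1(2) \<open>w \<notin> q ` {..<t}\<close> by (auto simp: lessThan_Suc inj_on_def)
  have c2: "?q ` {..<Suc t} = {w. ?D w \<noteq> 0}"
    using 1(3) by (auto simp: lessThan_Suc)
  have c3: "?D r = 1" using 1(4) w(2) by auto
  have c4: "(r, x) \<in> E ^^ (?D x - 1)" if "?D x \<noteq> 0" for x
  proof (cases "x = w")
    case True
    have "(r, q h) \<in> E ^^ (D (q h) - 1)" using 2 nq \<open>h < t\<close> by blast
    then have "(r, w) \<in> E ^^ Suc (D (q h) - 1)" using w(1) by auto
    then show ?thesis using True nq(2)[OF \<open>h < t\<close>] by simp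
  next
    case False
    then show ?thesis using 2[of x] that by simp
  qed
  have c5: "?D (?q i) \<le> ?D (?q j)" if "i \<le> j" "j < Suc t" for i j
  proof (cases "j = t")
    case True
    then show ?thesis using 4 q[of i] qt that by (cases "i = t") auto
  next
    case False
    then show ?thesis using 3[of i j] q[of i] q[of j] that by auto
  qed
  have c6: "?D (?q j) \<le> Suc (?D (?q h))" and c7: "?D (?q j) \<le> Suc j" if "j < Suc t" for j
    using that 4[of j] 5[of j] 5[of h] q[of j] q[of h] qt \<open>h < t\<close> by (cases "j = t"; simp)+
  have c8: "?D x \<noteq> 0 \<and> ?D x \<le> Suc (?D (?q i))" if "i < h" "(?q i, x) \<in> E" for i x
    using 6[of i x] q[of i] that w(2) \<open>h < t\<close> by (cases "x = w") auto
  have c9: "?D x \<noteq> 0 \<and> ?D x \<le> Suc (?D (?q h))" if "x \<in> insert w A" "(?q h, x) \<in> E" for x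
    using 7[of x] q[of h] that \<open>h < t\<close> by (cases "x = w") auto
  have c0: "h \<le> Suc t" using \<open>h < t\<close> by simp
  show ?thesis unfolding bfs_inv_def
    by (intro conjI allI impI ballI)
      (rule c0 c1 c2 c3 | (rule c4 c5 c6 c7 c8[THEN conjunct1] c8[THEN conjunct2]
        c9[THEN conjunct1] c9[THEN conjunct2]; assumption))+
qed

lemma bfs_inv_next:
  assumes inv: "bfs_inv E r D q h t A" and "h < t" and A: "\<And>w. (q h, w) \<in> E \<Longrightarrow> w \<in> A"
  shows "bfs_inv E r D q (Suc h) t {}"
proof -
  have "D (q j) \<le> Suc (D (q (Suc h)))" if "j < t" "Suc h < t" for j
  proof -
    have "D (q j) \<le> Suc (D (q h))" "D (q h) \<le> D (q (Suc h))" 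
      using inv that by (auto simp: bfs_inv_def)
    then show ?thesis by simp
  qed
  then show ?thesis using inv \<open>h < t\<close> A unfolding bfs_inv_def by (auto simp: less_Suc_eq)
qed

text \<open>Every value comes from a walk, hence is at least the distance plus one. With the queue
  exhausted all edges leaving discovered vertices have been scanned, so values grow by at most one
  along an edge, which gives the converse.\<close>

lemma bfs_inv_done:
  assumes inv: "bfs_inv E r D q h t {}" and "\<not> h < t"
  shows "D w = bfs_val E r w"
proof -
  have ht: "h = t" using inv \<open>\<not> h < t\<close> by (auto simp: bfs_inv_def)
  have edge: "D y \<noteq> 0 \<and> D y \<le> Suc (D x)" if "D x \<noteq> 0" "(x, y) \<in> E" for x y
  proof -
    have "x \<in> q ` {..<t}" using inv that by (auto simp: bfs_inv_def)
    then obtain i where "i < h" "x = q i" using ht by auto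
    then show ?thesis using inv that unfolding bfs_inv_def by blast
  qed
  have upper: "D y \<noteq> 0 \<and> D y \<le> Suc k" if "(r, y) \<in> E ^^ k" for k y
    using that
  proof (induction k arbitrary: y)
    case 0
    then show ?case using inv by (auto simp: bfs_inv_def)
  next
    case (Suc k)
    then obtain x where x: "(r, x) \<in> E ^^ k" "(x, y) \<in> E" by auto
    then show ?case using Suc.IH[OF x(1)] edge[OF _ x(2)] by auto
  qed
  show ?thesis
  proof (cases "(r, w) \<in> E\<^sup>*")
    case True
    then have "(r, w) \<in> E ^^ rdist E r w" 
      unfolding rdist_def rtrancl_power by (rule LeastI_ex)
    from upper[OF this] have D: "D w \<noteq> 0" "D w \<le> Suc (rdist E r w)" by auto
    then have "(r, w) \<in> E ^^ (D w - 1)" using inv by (auto simp: bfs_inv_def)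
    then have "rdist E r w \<le> D w - 1" unfolding rdist_def by (rule Least_le)
    then show ?thesis using True D by (simp add: bfs_val_def)
  next
    case False
    then have "D w = 0" using inv relpow_imp_rtrancl unfolding bfs_inv_def by blast
    then show ?thesis using False by (simp add: bfs_val_def)
  qed
qed

text \<open>Memory layout: array 6 holds the distance matrix, array 7 the distances within the layers not
  closer to the root than the source, 8 the queue, 9 the leaders, 10 the far witnesses, 11 the
  representatives, 12 the adjacency matrix of the output, 20 the levels.  Arrays 13 to 19 are
  scalars; 13 and 19 are the source and the least admitted level of a search, 14 and 15 head and tail
  of the queue.  Distances, levels, leaders and witnesses are incremented by one.\<close>

definition index :: "aexp \<Rightarrow> aexp \<Rightarrow> aexp" where
  "index e f = Add (Mul e (Var 0)) f"

definition bfs :: "nat \<Rightarrow> com" where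
  "bfs a =
    Seq (Store a (index (Var 13) (Var 13)) (Const 1))
   (Seq (Store 8 (Const 0) (Var 13))
   (Seq (Assign 14 (Const 0))
   (Seq (Assign 15 (Const 1))
   (While (Less (Var 14) (Var 15))
     (Seq (Assign 16 (Cell 8 (Var 14)))
     (Seq (For 17 (Cell 1 (Var 16)) (Cell 1 (Add (Var 16) (Const 1)))
       (Seq (Assign 18 (Cell 2 (Var 17)))
         (Cond (Conj (Equal (Cell a (index (Var 13) (Var 18))) (Const 0)) (Neg (Less (Cell 20 (Var 18)) (Var 19))))
           (Seq (Store a (index (Var 13) (Var 18)) (Add (Cell a (index (Var 13) (Var 16))) (Const 1)))
           (Seq (Store 8 (Var 15) (Var 18))
             (Assign 15 (Add (Var 15) (Const 1)))))
           Skip)))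
     (Assign 14 (Add (Var 14) (Const 1)))))))))"

text \<open>\<open>off\<close> and \<open>adj\<close> are arrays 1 and 2. The bound on
  \<open>W\<close> leaves room for indices into the matrices, for counters, and by its summand 20
  for the constants in the program, of which 15 is the largest.\<close>

locale memory =
  fixes W n :: nat and off adj :: "nat \<Rightarrow> nat" and E :: "nat rel"
  assumes n0: "0 < n" and EV: "E \<subseteq> {..<n} \<times> {..<n}" and off0: "off 0 = 0"
    and off_Suc: "v < n \<Longrightarrow> off v \<le> off (Suc v)"
    and adj: "v < n \<Longrightarrow> bij_betw adj {off v..<off (Suc v)} {w. (v, w) \<in> E}"
    and off_n: "off n \<le> n * n"
    and W: "n * n + 2 * n + 20 < W"
begin

lemma idx: "u < n \<Longrightarrow> v < n \<Longrightarrow> u * n + v < n * n"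
  using mult_le_mono1[of "Suc u" n n] by simp

lemma idx_eq: "v < n \<Longrightarrow> v' < n \<Longrightarrow> u * n + v = u' * n + v' \<longleftrightarrow> u = u' \<and> v = v'"
proof
  assume v: "v < n" "v' < n" and eq: "u * n + v = u' * n + v'"
  have "(u * n + v) div n = u" "(u' * n + v') div n = u'" using v by simp_all
  then show "u = u' \<and> v = v'" using eq by auto
qed simp

lemma off_mono: "u \<le> v \<Longrightarrow> v \<le> n \<Longrightarrow> off u \<le> off v"
proof (induction v)
  case (Suc v)
  then show ?case using off_Suc[of v] by (cases "u = Suc v") auto
qed simp

lemma off_le: "v \<le> n \<Longrightarrow> off v \<le> n * n"
  using off_mono[of v n] off_n by simp

lemma sum_deg: "v \<le> n \<Longrightarrow> (\<Sum>u<v. off (Suc u) - off u) = off v"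
proof (induction v)
  case (Suc v)
  then show ?case using off_Suc[of v] by simp
qed (simp add: off0)

lemma adj_E: "v < n \<Longrightarrow> off v \<le> i \<Longrightarrow> i < off (Suc v) \<Longrightarrow> (v, adj i) \<in> E"
  using adj[of v] by (auto simp: bij_betw_def)

lemma E_adj:
  assumes "(v, w) \<in> E"
  shows "w \<in> adj ` {off v..<off (Suc v)}"
proof -
  have "v < n" using assms EV by auto
  then have "adj ` {off v..<off (Suc v)} = {w. (v, w) \<in> E}" using adj by (simp add: bij_betw_def)
  then show ?thesis using assms by simp
qed

definition input where
  "input s \<longleftrightarrow> s 0 0 = n \<and> s 1 = off \<and> s 2 = adj"

definition row where
  "row f u = (\<lambda>v. if v < n then f (u * n + v) else 0)" for f :: "nat \<Rightarrow> nat"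

lemma row_upd: "v < n \<Longrightarrow> row (f(u * n + v := x)) u = (row f u)(v := x)"
  by (auto simp: row_def fun_eq_iff)

lemma bfs_correct:
  assumes a: "a \<notin> {0, 1, 2, 8, 13, 14, 15, 16, 17, 18, 19, 20}" and s: "input s" "s 13 0 = r" "r < n" "s 19 0 < W" "\<And>v. v < n \<Longrightarrow> s 20 v < W"
    and clear: "row (s a) r = (\<lambda>_. 0)"
  shows "runs W (bfs a) s (7 * off n + 5 * n + 5)
    (\<lambda>s'. (\<forall>b. b \<notin> {a, 8, 14, 15, 16, 17, 18} \<longrightarrow> s' b = s b) \<and>
      row (s' a) r = bfs_val {(x, y) \<in> E. s 19 0 \<le> s 20 y} r \<and>
      (\<forall>x. x \<notin> {r * n..<r * n + n} \<longrightarrow> s' a x = s a x) \<and> (\<forall>v<n. s' a (r * n + v) \<le> n))"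
proof -
  have a: "a \<noteq> 0" "a \<noteq> 1" "a \<noteq> Suc 0" "a \<noteq> 2" "a \<noteq> 8" "a \<noteq> 13" "a \<noteq> 14" "a \<noteq> 15" "a \<noteq> 16" "a \<noteq> 17" "a \<noteq> 18"
    "a \<noteq> 19" "a \<noteq> 20"
    using a by auto
  define E' where "E' = {(x, y) \<in> E. s 19 0 \<le> s 20 y}"
  have "E' \<subseteq> {..<n} \<times> {..<n}" using EV by (auto simp: E'_def)
  define inv where "inv A s' \<longleftrightarrow> (\<forall>b. b \<notin> {a, 8, 14, 15, 16, 17, 18} \<longrightarrow> s' b = s b) \<and>
     (\<forall>x. x \<notin> {r * n..<r * n + n} \<longrightarrow> s' a x = s a x) \<and>
     bfs_inv E' r (row (s' a) r) (s' 8) (s' 14 0) (s' 15 0) A" for A s'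
  have in_s: "s 0 0 = n" "s 1 = off" "s 2 = adj" using s(1) by (auto simp: input_def)
  have inv_q: "s' 8 j < n" "row (s' a) r (s' 8 j) = s' a (r * n + s' 8 j)" "s' a (r * n + s' 8 j) \<le> n"
    if "inv A s'" "j < s' 15 0" for A s' j
  proof -
    have "row (s' a) r (s' 8 j) \<noteq> 0" using that by (auto simp: inv_def bfs_inv_def)
    then show *: "s' 8 j < n" "row (s' a) r (s' 8 j) = s' a (r * n + s' 8 j)"
      by (auto simp: row_def split: if_splits)
    \<comment> \<open>The queue position bounds the value, and the queue has at most
      \<open>n\<close> entries because it is injective; so stored distances fit into a word.\<close>
    have "row (s' a) r (s' 8 j) \<le> Suc j" using that by (auto simp: inv_def bfs_inv_def)
    moreover have "s' 15 0 \<le> n"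
    proof -
      have "s' 8 ` {..<s' 15 0} \<subseteq> {..<n}" "inj_on (s' 8) {..<s' 15 0}"
        using that by (auto simp: inv_def bfs_inv_def row_def split: if_splits)
      then have "card {..<s' 15 0} \<le> card {..<n}" by (intro card_inj_on_le) auto
      then show ?thesis by simp
    qed
    ultimately show "s' a (r * n + s' 8 j) \<le> n" using * that by simp
  qed
  have inv_t: "s' 15 0 \<le> n" if "inv A s'" for A s'
  proof -
    have "s' 8 ` {..<s' 15 0} \<subseteq> {..<n}" "inj_on (s' 8) {..<s' 15 0}"
      using that by (auto simp: inv_def bfs_inv_def row_def split: if_splits)
    then have "card {..<s' 15 0} \<le> card {..<n}" by (intro card_inj_on_le) auto
    then show ?thesis by simp
  qed
  have val: "s' a (r * n + v) \<le> n" if "inv A s'" "v < n" for A s' v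
  proof (cases "s' a (r * n + v) = 0")
    case False
    then have "row (s' a) r v \<noteq> 0" using that by (simp add: row_def)
    then have "v \<in> s' 8 ` {..<s' 15 0}" using that by (auto simp: inv_def bfs_inv_def)
    then show ?thesis using inv_q(3)[OF that(1)] by auto
  qed simp
  \<comment> \<open>A vertex that has not been dequeued is charged 7 for each arc leaving it, 5 for
    the scan and 2 for the loop, and 5 for its own round. No vertex is dequeued twice.\<close>
  define \<Phi> where "\<Phi> s' = (\<Sum>u\<in>{..<n} - s' 8 ` {..<s' 14 0}. 7 * (off (Suc u) - off u) + 5)" for s' :: state
  let ?b = "Less (Var 14) (Var 15)"
  let ?inner = "Seq (Assign 18 (Cell 2 (Var 17)))
         (Cond (Conj (Equal (Cell a (index (Var 13) (Var 18))) (Const 0)) (Neg (Less (Cell 20 (Var 18)) (Var 19))))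
           (Seq (Store a (index (Var 13) (Var 18)) (Add (Cell a (index (Var 13) (Var 16))) (Const 1)))
           (Seq (Store 8 (Var 15) (Var 18))
             (Assign 15 (Add (Var 15) (Const 1)))))
           Skip)"
  let ?for = "For 17 (Cell 1 (Var 16)) (Cell 1 (Add (Var 16) (Const 1))) ?inner"
  let ?body = "Seq (Assign 16 (Cell 8 (Var 14))) (Seq ?for (Assign 14 (Add (Var 14) (Const 1))))"
  have body: "\<exists>T. runs W ?body s' T (\<lambda>s''. inv {} s'' \<and> \<Phi> s'' + T + 1 \<le> \<Phi> s')"
    if I: "inv {} s'" and b: "bv s' ?b" for s'
  proof -
    define h where "h = s' 14 0"
    define u where "u = s' 8 h"
    have h: "h < s' 15 0" using b by (simp add: h_def)
    have u: "u < n" using inv_q(1)[OF I h] by (simp add: u_def)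
    let ?deg = "off (Suc u) - off u"
    define J where "J i s'' \<longleftrightarrow> inv (adj ` {off u..<i}) s'' \<and> s'' 14 0 = h \<and> s'' 16 0 = u \<and> s'' 8 h = u \<and>
      h < s'' 15 0 \<and> (\<forall>j\<le>h. s'' 8 j = s' 8 j)" for i s''
    have step: "runs W ?inner s'' 5 (\<lambda>s'''. s''' 17 0 = i \<and> J (Suc i) (s'''(17 := (s''' 17)(0 := Suc i))))"
      if J: "J i s''" "s'' 17 0 = i" "off u \<le> i" "i < off (Suc u)" for i s''
    proof -
      define w where "w = adj i"
      have E: "(u, w) \<in> E" using adj_E[OF u J(3,4)] by (simp add: w_def)
      then have w: "w < n" using EV by auto
      have A: "adj ` {off u..<Suc i} = insert w (adj ` {off u..<i})"
        using J(3) by (auto simp: w_def atLeastLessThanSuc)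
      have I': "inv (adj ` {off u..<i}) s''" and c: "s'' 14 0 = h" "s'' 16 0 = u" "s'' 8 h = u" "h < s'' 15 0"
         "\<And>j. j \<le> h \<Longrightarrow> s'' 8 j = s' 8 j"
        using J(1) by (auto simp: J_def)
      have fr: "s'' 0 0 = n" "s'' 2 = adj" "s'' 13 0 = r" "s'' 19 0 = s 19 0" "s'' 20 = s 20"
        using I' a in_s s(2) by (auto simp: inv_def)
      have le: "i < W" "w < W" "r * n + w < W" "r * n < W" "r < W" "n < W" "1 < W"
          "r * n + u < W" "u < W" "s'' 15 0 < W" "Suc (s'' 15 0) < W"
          "s'' a (r * n + w) < W" "s'' a (r * n + u) < W" "Suc (s'' a (r * n + u)) < W" "s 20 w < W" "s 19 0 < W"
        using W n0 idx[OF s(3) w] idx[OF s(3) u] off_le[of "Suc u"] J(4) u w s(3,4,5) inv_t[OF I']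
          val[OF I' w] val[OF I' u] by auto
      have binv: "bfs_inv E' r (row (s'' a) r) (s'' 8) h (s'' 15 0) (adj ` {off u..<i})"
        using I' c by (simp add: inv_def)
      have rw: "row (s'' a) r w = s'' a (r * n + w)" "row (s'' a) r u = s'' a (r * n + u)"
        using w u by (simp_all add: row_def)
      show ?thesis
      proof (cases "s'' a (r * n + w) = 0 \<and> s 19 0 \<le> s 20 w")
        case True
        then have "(s'' 8 h, w) \<in> E'" using E c by (simp add: E'_def)
        from bfs_inv_discover[OF binv c(4) this] True rw c
        have new: "bfs_inv E' r ((row (s'' a) r)(w := Suc (s'' a (r * n + u)))) ((s'' 8)(s'' 15 0 := w)) h
           (Suc (s'' 15 0)) (adj ` {off u..<Suc i})" by (simp add: A)
        have "J (Suc i) (s''(18 := (s'' 18)(0 := w), a := (s'' a)(r * n + w := Suc (s'' a (r * n + u))),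
          8 := (s'' 8)(s'' 15 0 := w), 15 := (s'' 15)(0 := Suc (s'' 15 0)), 17 := (s'' 17)(0 := Suc i)))"
          using I' new c a w unfolding J_def inv_def by (simp add: row_upd)
        then have "wp W ?inner s'' (\<lambda>s'''. s''' 17 0 = i \<and> J (Suc i) (s'''(17 := (s''' 17)(0 := Suc i))))"
          using True le fr a c J(2) by (simp add: index_def w_def[symmetric])
        then show ?thesis by (rule wp_runs_le) simp
      next
        case False
        have "bfs_inv E' r (row (s'' a) r) (s'' 8) h (s'' 15 0) (adj ` {off u..<Suc i})"
          unfolding A using False rw(1) c by (intro bfs_inv_skip[OF binv c(4)]) (auto simp: E'_def)
        then have "J (Suc i) (s''(18 := (s'' 18)(0 := w), 17 := (s'' 17)(0 := Suc i)))"
          using I' c a unfolding J_def inv_def by simp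
        then have "wp W ?inner s'' (\<lambda>s'''. s''' 17 0 = i \<and> J (Suc i) (s'''(17 := (s''' 17)(0 := Suc i))))"
          using False le fr a c J(2) by (auto simp: index_def w_def[symmetric])
        then show ?thesis by (rule wp_runs_le) simp
      qed
    qed
    let ?s1 = "s'(16 := (s' 16)(0 := u))"
    have fr: "s' 1 = off" using I a in_s by (auto simp: inv_def)
    have le: "u < W" "Suc u < W" "off u < W" "off (Suc u) < W" "1 < W" "h < W" "Suc h < W"
      using W n0 u off_le[of u] off_le[of "Suc u"] h inv_t[OF I] by auto
    have "runs W ?for ?s1 (?deg * (5 + 2) + 2) (J (off (Suc u)))"
    proof (rule runs_For_const)
      show "aok W ?s1 (Cell 1 (Var 16))" "av ?s1 (Cell 1 (Var 16)) = off u" using le fr by auto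
      show "off u \<le> off (Suc u)" "off (Suc u) < W" using off_Suc u le by auto
      show "J (off u) (?s1(17 := (?s1 17)(0 := off u)))"
        using I a h unfolding J_def inv_def by (auto simp: h_def u_def)
      show "aok W s'' (Cell 1 (Add (Var 16) (Const 1))) \<and> av s'' (Cell 1 (Add (Var 16) (Const 1))) = off (Suc u)"
        if "J i s''" for i s''
      proof -
        have "s'' 1 = off" "s'' 16 0 = u" using that a in_s by (auto simp: J_def inv_def)
        then show ?thesis using le by simp
      qed
    qed (rule step)
    moreover have "runs W (Assign 14 (Add (Var 14) (Const 1))) s'' 1
        (\<lambda>s'''. inv {} s''' \<and> \<Phi> s''' + (1 + ((?deg * (5 + 2) + 2) + 1)) + 1 \<le> \<Phi> s')"
      if J: "J (off (Suc u)) s''" for s''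
    proof -
      have I'': "inv (adj ` {off u..<off (Suc u)}) s''" and c: "s'' 14 0 = h" "s'' 8 h = u" "h < s'' 15 0"
        "\<And>j. j \<le> h \<Longrightarrow> s'' 8 j = s' 8 j" using J by (auto simp: J_def)
      have nb: "w \<in> adj ` {off u..<off (Suc u)}" if "(u, w) \<in> E'" for w
        using that E_adj[of u w] by (auto simp: E'_def)
      have "bfs_inv E' r (row (s'' a) r) (s'' 8) (Suc h) (s'' 15 0) {}"
        using I'' c nb by (intro bfs_inv_next) (auto simp: inv_def)
      then have "inv {} (s''(14 := (s'' 14)(0 := Suc h)))"
        using I'' a unfolding inv_def by auto
      moreover have "\<Phi> (s''(14 := (s'' 14)(0 := Suc h))) + (7 * ?deg + 5) \<le> \<Phi> s'"
      proof -
        have img: "s'' 8 ` {..<Suc h} = insert u (s' 8 ` {..<h})"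
        proof -
          have "s'' 8 ` {..<h} = s' 8 ` {..<h}" using c(4) by (intro image_cong) auto
          then show ?thesis using c(2) by (simp add: lessThan_Suc)
        qed
        have inj: "inj_on (s' 8) {..<s' 15 0}" using I by (simp add: inv_def bfs_inv_def)
        have "u \<noteq> s' 8 x" if "x < h" for x
          using inj_onD[OF inj, of h x] that h by (auto simp: u_def)
        then have "u \<notin> s' 8 ` {..<h}" by blast
        then have "u \<in> {..<n} - s' 8 ` {..<h}" using u by simp
        then have "\<Phi> s' = 7 * ?deg + 5 + (\<Sum>u\<in>{..<n} - s' 8 ` {..<h} - {u}. 7 * (off (Suc u) - off u) + 5)"
          unfolding \<Phi>_def h_def[symmetric] by (intro sum.remove) auto
        moreover have "{..<n} - s' 8 ` {..<h} - {u} = {..<n} - insert u (s' 8 ` {..<h})" by blast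
        ultimately show ?thesis by (simp add: \<Phi>_def img)
      qed
      ultimately show ?thesis using c le by (intro wp_runs_le) (auto simp: algebra_simps)
    qed
    ultimately have "runs W (Seq ?for (Assign 14 (Add (Var 14) (Const 1)))) ?s1 ((?deg * (5 + 2) + 2) + 1)
        (\<lambda>s'''. inv {} s''' \<and> \<Phi> s''' + (1 + ((?deg * (5 + 2) + 2) + 1)) + 1 \<le> \<Phi> s')"
      by (rule runs_Seq)
    moreover have "wp W (Assign 16 (Cell 8 (Var 14))) s' (\<lambda>x. x = ?s1)"
      using le by (simp add: h_def u_def)
    ultimately have "runs W ?body s' (cost (Assign 16 (Cell 8 (Var 14))) + ((?deg * (5 + 2) + 2) + 1))
        (\<lambda>s'''. inv {} s''' \<and> \<Phi> s''' + (1 + ((?deg * (5 + 2) + 2) + 1)) + 1 \<le> \<Phi> s')"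
      by (rule runs_Seq_wp[rotated])
    then show ?thesis unfolding cost.simps by blast
  qed
  let ?s0 = "s(a := (s a)(r * n + r := 1), 8 := (s 8)(0 := r), 14 := (s 14)(0 := 0), 15 := (s 15)(0 := 1))"
  have inv0: "inv {} ?s0"
    using a s(3) bfs_inv_init[of E' r "s 8"] clear unfolding inv_def by (auto simp: row_upd)
  have \<Phi>0: "\<Phi> ?s0 = 7 * off n + 5 * n"
    by (simp add: \<Phi>_def sum.distrib sum_distrib_left[symmetric] sum_deg)
  let ?Q = "\<lambda>s'. (\<forall>b. b \<notin> {a, 8, 14, 15, 16, 17, 18} \<longrightarrow> s' b = s b) \<and>
      row (s' a) r = bfs_val E' r \<and> (\<forall>x. x \<notin> {r * n..<r * n + n} \<longrightarrow> s' a x = s a x) \<and> (\<forall>v<n. s' a (r * n + v) \<le> n)"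
  have "runs W (While ?b ?body) ?s0 (\<Phi> ?s0 + 1) ?Q"
  proof (rule runs_While[where I = "inv {}" and \<Phi> = \<Phi>])
    show "inv {} ?s0" by (rule inv0)
    show "bok W s' ?b" if "inv {} s'" for s'
      using inv_t[OF that] that W by (auto simp: inv_def bfs_inv_def)
    show "\<exists>T. runs W ?body s' T (\<lambda>s''. inv {} s'' \<and> \<Phi> s'' + T + 1 \<le> \<Phi> s')"
      if "inv {} s'" "bv s' ?b" for s' by (rule body[OF that])
    show "(\<forall>b. b \<notin> {a, 8, 14, 15, 16, 17, 18} \<longrightarrow> s' b = s b) \<and>
      row (s' a) r = bfs_val E' r \<and> (\<forall>x. x \<notin> {r * n..<r * n + n} \<longrightarrow> s' a x = s a x) \<and> (\<forall>v<n. s' a (r * n + v) \<le> n)"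
      if "inv {} s'" "\<not> bv s' ?b" for s'
      using that bfs_inv_done[of E' r "row (s' a) r"] val[OF that(1)] by (auto simp: inv_def fun_eq_iff)
  qed
  then have "runs W (Seq (Assign 15 (Const 1)) (While ?b ?body))
    (s(a := (s a)(r * n + r := 1), 8 := (s 8)(0 := r), 14 := (s 14)(0 := 0)))
    (cost (Assign 15 (Const 1)) + (\<Phi> ?s0 + 1)) ?Q"
    by (rule runs_Seq_wp[rotated]) (use a W in simp)
  then have "runs W (Seq (Assign 14 (Const 0)) (Seq (Assign 15 (Const 1)) (While ?b ?body)))
    (s(a := (s a)(r * n + r := 1), 8 := (s 8)(0 := r)))
    (cost (Assign 14 (Const 0)) + (cost (Assign 15 (Const 1)) + (\<Phi> ?s0 + 1))) ?Q"
    by (rule runs_Seq_wp[rotated]) (use a W in simp)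
  then have "runs W (Seq (Store 8 (Const 0) (Var 13)) (Seq (Assign 14 (Const 0)) (Seq (Assign 15 (Const 1)) (While ?b ?body))))
    (s(a := (s a)(r * n + r := 1)))
    (cost (Store 8 (Const 0) (Var 13)) + (cost (Assign 14 (Const 0)) + (cost (Assign 15 (Const 1)) + (\<Phi> ?s0 + 1)))) ?Q"
    by (rule runs_Seq_wp[rotated]) (use W s n0 a in simp)
  then have "runs W (bfs a) s (cost (Store a (index (Var 13) (Var 13)) (Const 1)) + (cost (Store 8 (Const 0) (Var 13)) +
    (cost (Assign 14 (Const 0)) + (cost (Assign 15 (Const 1)) + (\<Phi> ?s0 + 1))))) ?Q"
    unfolding bfs_def
    by (rule runs_Seq_wp[rotated]) (use a W idx[OF s(3) s(3)] s in_s in \<open>simp add: index_def\<close>)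
  then show ?thesis unfolding E'_def[symmetric] \<Phi>0 by (rule runs_weaken) simp_all
qed

end

section \<open>The passes of the algorithm\<close>

text \<open>One plus the last index below the bound that satisfies the predicate, and 0 if there is none.\<close>
primrec last1 :: "(nat \<Rightarrow> bool) \<Rightarrow> nat \<Rightarrow> nat" where
  "last1 P 0 = 0"
| "last1 P (Suc i) = (if P i then Suc i else last1 P i)"

lemma last1_le: "last1 P i \<le> i"
  by (induction i) auto

lemma last1_SucD: "last1 P i = Suc j \<Longrightarrow> P j \<and> j < i"
  by (induction i) (auto split: if_splits)

lemma last1_0D: "last1 P i = 0 \<Longrightarrow> j < i \<Longrightarrow> \<not> P j"
  by (induction i) (auto split: if_splits simp: less_Suc_eq)

definition bfs_all :: "nat \<Rightarrow> aexp \<Rightarrow> com" where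
  "bfs_all a K = For 13 (Const 0) (Var 0) (Seq (Assign 19 K) (bfs a))"

text \<open>The root is vertex 0, so row 0 of the distance matrix holds the levels.\<close>

definition copy_levels :: com where
  "copy_levels = For 16 (Const 0) (Var 0) (Store 20 (Var 16) (Cell 6 (Var 16)))"

text \<open>A hit overwrites its predecessor, so the last member of the cluster remains; this makes
  the leader the same for all members.\<close>

definition find_leaders :: com where
  "find_leaders = For 13 (Const 0) (Var 0) (For 16 (Const 0) (Var 0)
     (Cond (Conj (Equal (Cell 20 (Var 13)) (Cell 20 (Var 16)))
         (Neg (Equal (Cell 7 (index (Var 13) (Var 16))) (Const 0))))
       (Store 9 (Var 13) (Add (Var 16) (Const 1))) Skip))"

text \<open>Stored distances are one too large: exceeding 15 here means a distance of at least 15,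
  and exceeding 4 in \<open>find_reps\<close> a distance above 3.\<close>

definition find_far :: com where
  "find_far = For 13 (Const 0) (Var 0) (Seq (Assign 16 (Sub (Cell 9 (Var 13)) (Const 1)))
     (Cond (Less (Const 15) (Cell 6 (index (Var 16) (Var 13))))
       (Store 10 (Var 16) (Add (Var 13) (Const 1))) Skip))"

definition find_reps :: com where
  "find_reps = For 13 (Const 0) (Var 0) (Seq (Assign 16 (Sub (Cell 9 (Var 13)) (Const 1)))
     (Cond (Conj (Less (Const 0) (Cell 10 (Var 16))) (Less (Const 4) (Cell 6 (index (Var 16) (Var 13)))))
       (Store 11 (Var 13) (Sub (Cell 10 (Var 16)) (Const 1))) (Store 11 (Var 13) (Var 16))))"

text \<open>Many edges of \<open>G\<close> may yield the same edge of \<open>Q\<close>, whereas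
  adjacency lists name each neighbour once; the matrix absorbs the repetitions.\<close>

definition fill_matrix :: com where
  "fill_matrix = For 13 (Const 0) (Var 0) (Seq
     (Cond (Equal (Cell 11 (Var 13)) (Var 13)) Skip
       (Seq (Store 12 (index (Var 13) (Cell 11 (Var 13))) (Const 1))
         (Store 12 (index (Cell 11 (Var 13)) (Var 13)) (Const 1))))
     (For 17 (Cell 1 (Var 13)) (Cell 1 (Add (Var 13) (Const 1)))
       (Seq (Assign 18 (Cell 2 (Var 17)))
         (Cond (Equal (Cell 11 (Var 13)) (Cell 11 (Var 18))) Skip
           (Store 12 (index (Cell 11 (Var 13)) (Cell 11 (Var 18))) (Const 1))))))"

definition write_output :: com where
  "write_output = Seq (Assign 3 (Var 0)) (Seq (Assign 14 (Const 0)) (For 13 (Const 0) (Var 0) (Seq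
     (For 16 (Const 0) (Var 0) (Cond (Equal (Cell 12 (index (Var 13) (Var 16))) (Const 0)) Skip
       (Seq (Store 5 (Var 14) (Var 16)) (Assign 14 (Add (Var 14) (Const 1))))))
     (Store 4 (Add (Var 13) (Const 1)) (Var 14)))))"

context memory
begin

lemma W_bounds: "n < W" "0 < W" "1 < W" "Suc 0 < W" "4 < W" "15 < W" "n * n < W"
  using W n0 by auto

lemma bound_W: "x \<le> n \<Longrightarrow> x < W" "x \<le> n \<Longrightarrow> Suc x < W" "x \<le> n * n \<Longrightarrow> x < W" "x \<le> n * n \<Longrightarrow> Suc x < W"
  using W n0 by auto

lemma idx_W:
  assumes "u < n" "v < n"
  shows "u * n + v < W" "u * n < W"
  using idx[OF assms] W by auto

lemma input_frame: "input s \<Longrightarrow> (\<forall>b. b \<notin> X \<longrightarrow> s' b = s b) \<Longrightarrow> X \<inter> {0, 1, 2} = {} \<Longrightarrow> input s'"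
  unfolding input_def by auto

lemma bfs_all_correct:
  assumes a: "a \<notin> {0, 1, 2, 8, 13, 14, 15, 16, 17, 18, 19, 20}"
    and s: "input s" "\<And>v. v < n \<Longrightarrow> s 20 v < W" "\<And>x. s a x = 0"
    and K: "\<And>s' i. (\<forall>b. b \<notin> {a, 8, 13, 14, 15, 16, 17, 18, 19} \<longrightarrow> s' b = s b) \<Longrightarrow> s' 13 0 = i \<Longrightarrow> i < n \<Longrightarrow>
      aok W s' K \<and> av s' K = k i" "\<And>i. i < n \<Longrightarrow> k i < W"
  shows "runs W (bfs_all a K) s (n * (7 * off n + 5 * n + 8) + 2)
    (\<lambda>s'. (\<forall>b. b \<notin> {a, 8, 13, 14, 15, 16, 17, 18, 19} \<longrightarrow> s' b = s b) \<and>
      (\<forall>u<n. row (s' a) u = bfs_val {(x, y) \<in> E. k u \<le> s 20 y} u) \<and>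
      (\<forall>u<n. \<forall>v<n. s' a (u * n + v) \<le> n))"
proof -
  have a': "a \<noteq> 0" "a \<noteq> 13" "a \<noteq> 19" "a \<noteq> 20" using a by auto
  \<comment> \<open>The zeros from \<open>i * n\<close> on guarantee that the row of the next source
    is still empty, as \<open>bfs\<close> presupposes.\<close>
  define I where "I i s' \<longleftrightarrow> (\<forall>b. b \<notin> {a, 8, 13, 14, 15, 16, 17, 18, 19} \<longrightarrow> s' b = s b) \<and>
      (\<forall>u<i. row (s' a) u = bfs_val {(x, y) \<in> E. k u \<le> s 20 y} u) \<and>
      (\<forall>u<i. \<forall>v<n. s' a (u * n + v) \<le> n) \<and> (\<forall>x\<ge>i * n. s' a x = 0)" for i s'
  have in_s: "s 0 0 = n" using s(1) by (simp add: input_def)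
  have "runs W (bfs_all a K) s ((n - 0) * ((1 + (7 * off n + 5 * n + 5)) + 2) + 2) (I n)"
    unfolding bfs_all_def
  proof (rule runs_For_const)
    show "aok W s (Const 0)" "av s (Const 0) = 0" "0 \<le> n" "n < W" using W_bounds by auto
    show "I 0 (s(13 := (s 13)(0 := 0)))" using s(3) a' by (auto simp: I_def)
    show "aok W s' (Var 0) \<and> av s' (Var 0) = n" if "I i s'" for i s'
    proof -
      have "s' 0 = s 0" using that a' by (simp add: I_def)
      then show ?thesis using in_s W_bounds by simp
    qed
    show "runs W (Seq (Assign 19 K) (bfs a)) s' (1 + (7 * off n + 5 * n + 5))
      (\<lambda>s''. s'' 13 0 = i \<and> I (Suc i) (s''(13 := (s'' 13)(0 := Suc i))))"
      if I: "I i s'" and i: "s' 13 0 = i" "i < n" for i s'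
    proof -
      have fr: "\<forall>b. b \<notin> {a, 8, 13, 14, 15, 16, 17, 18, 19} \<longrightarrow> s' b = s b"
        and rows: "\<forall>u<i. row (s' a) u = bfs_val {(x, y) \<in> E. k u \<le> s 20 y} u"
          "\<forall>u<i. \<forall>v<n. s' a (u * n + v) \<le> n" and z: "\<forall>x\<ge>i * n. s' a x = 0"
        using I by (auto simp: I_def)
      let ?s = "s'(19 := (s' 19)(0 := k i))"
      have "wp W (Assign 19 K) s' (\<lambda>x. x = ?s)" using K(1)[OF fr i] W_bounds by simp
      moreover have "runs W (bfs a) ?s (7 * off n + 5 * n + 5)
        (\<lambda>s''. s'' 13 0 = i \<and> I (Suc i) (s''(13 := (s'' 13)(0 := Suc i))))"
      proof (rule runs_weaken[OF bfs_correct[OF a]])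
        show "input ?s" using fr a by (intro input_frame[OF s(1), of "{a, 8, 13, 14, 15, 16, 17, 18, 19}"]) auto
        show "?s 13 0 = i" "i < n" "?s 19 0 < W" using i K(2) by auto
        show "?s 20 v < W" if "v < n" for v using s(2)[OF that] fr a' by simp
        show "row (?s a) i = (\<lambda>_. 0)" using z a' by (auto simp: row_def fun_eq_iff)
        fix s'' assume s'': "(\<forall>b. b \<notin> {a, 8, 14, 15, 16, 17, 18} \<longrightarrow> s'' b = ?s b) \<and>
          row (s'' a) i = bfs_val {(x, y) \<in> E. ?s 19 0 \<le> ?s 20 y} i \<and>
          (\<forall>x. x \<notin> {i * n..<i * n + n} \<longrightarrow> s'' a x = ?s a x) \<and> (\<forall>v<n. s'' a (i * n + v) \<le> n)"
        have "?s 20 = s 20" using fr a' by simp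
        then have new: "row (s'' a) i = bfs_val {(x, y) \<in> E. k i \<le> s 20 y} i" using s'' by simp
        have old: "s'' a (u * n + v) = s' a (u * n + v)" if "u < i" "v < n" for u v
        proof -
          have "Suc u * n \<le> i * n" using that(1) by (intro mult_le_mono1) simp
          then have "u * n + v \<notin> {i * n..<i * n + n}" using that(2) by simp
          then show ?thesis using s'' a' by simp
        qed
        have oldrow: "row (s'' a) u = row (s' a) u" if "u < i" for u
          using old[OF that] by (auto simp: row_def)
        have "\<forall>x\<ge>Suc i * n. s'' a x = 0" using s'' z a' by auto
        moreover have "\<forall>b. b \<notin> {a, 8, 13, 14, 15, 16, 17, 18, 19} \<longrightarrow> s'' b = s b" using s'' fr by auto
        ultimately show "s'' 13 0 = i \<and> I (Suc i) (s''(13 := (s'' 13)(0 := Suc i)))"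
          using s'' new old oldrow rows a' i a by (auto simp: I_def less_Suc_eq)
      qed simp
      ultimately show ?thesis using runs_Seq_wp[of W "Assign 19 K" s' ?s] by fastforce
    qed
  qed
  then show ?thesis by (rule runs_weaken) (auto simp: I_def)
qed

lemma copy_levels_correct:
  assumes s: "input s" "\<And>v. v < n \<Longrightarrow> s 6 v \<le> n"
  shows "runs W copy_levels s (n * 3 + 2)
    (\<lambda>s'. (\<forall>b. b \<notin> {16, 20} \<longrightarrow> s' b = s b) \<and> (\<forall>v<n. s' 20 v = s 6 v))"
proof -
  have in_s: "s 0 0 = n" using s(1) by (simp add: input_def)
  define I where "I i s' \<longleftrightarrow> (\<forall>b. b \<notin> {16, 20} \<longrightarrow> s' b = s b) \<and> (\<forall>v<i. s' 20 v = s 6 v)" for i :: nat and s'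
  have "runs W copy_levels s ((n - 0) * (1 + 2) + 2) (I n)"
    unfolding copy_levels_def
  proof (rule runs_For_const)
    show "aok W s (Const 0)" "av s (Const 0) = 0" "0 \<le> n" "n < W" using W_bounds by auto
    show "I 0 (s(16 := (s 16)(0 := 0)))" by (simp add: I_def)
    show "aok W s' (Var 0) \<and> av s' (Var 0) = n" if "I i s'" for i s'
      using that in_s W_bounds by (simp add: I_def)
    show "runs W (Store 20 (Var 16) (Cell 6 (Var 16))) s' 1
      (\<lambda>s''. s'' 16 0 = i \<and> I (Suc i) (s''(16 := (s'' 16)(0 := Suc i))))"
      if "I i s'" "s' 16 0 = i" "i < n" for i s'
      using that s(2)[of i] W_bounds bound_W(1)[of i] bound_W(1)[of "s 6 i"]
      by (intro wp_runs_le) (auto simp: I_def less_Suc_eq)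
  qed
  then show ?thesis by (rule runs_weaken) (auto simp: I_def)
qed

lemma find_leaders_correct:
  assumes s: "input s" "\<And>v. v < n \<Longrightarrow> s 20 v \<le> n" "\<And>u v. u < n \<Longrightarrow> v < n \<Longrightarrow> s 7 (u * n + v) \<le> n"
    "\<And>v. s 9 v = 0"
  shows "runs W find_leaders s (n * (n * 4 + 4) + 2)
    (\<lambda>s'. (\<forall>b. b \<notin> {9, 13, 16} \<longrightarrow> s' b = s b) \<and>
      (\<forall>v<n. s' 9 v = last1 (\<lambda>u. s 20 v = s 20 u \<and> s 7 (v * n + u) \<noteq> 0) n))"
proof -
  have in_s: "s 0 0 = n" using s(1) by (simp add: input_def)
  let ?P = "\<lambda>v u. s 20 v = s 20 u \<and> s 7 (v * n + u) \<noteq> 0"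
  \<comment> \<open>One invariant for both loops: rows before \<open>v\<close> are complete and row
    \<open>v\<close> is scanned up to \<open>i\<close>, so \<open>J v n\<close> passes into
    \<open>J (Suc v) 0\<close>.\<close>
  define J where "J v i s' \<longleftrightarrow> (\<forall>b. b \<notin> {9, 13, 16} \<longrightarrow> s' b = s b) \<and>
    (\<forall>w. s' 9 w = (if w < v then last1 (?P w) n else if w = v then last1 (?P v) i else 0))" for v i :: nat and s'
  have "runs W find_leaders s ((n - 0) * (((n - 0) * (2 + 2) + 2) + 2) + 2) (\<lambda>s'. J n 0 s')"
    unfolding find_leaders_def
  proof (rule runs_For_const[where I = "\<lambda>v. J v 0"])
    show "aok W s (Const 0)" "av s (Const 0) = 0" "0 \<le> n" "n < W" using W_bounds by auto
    show "J 0 0 (s(13 := (s 13)(0 := 0)))" using s(4) by (simp add: J_def)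
    show "aok W s' (Var 0) \<and> av s' (Var 0) = n" if "J i 0 s'" for i s'
      using that in_s W_bounds by (simp add: J_def)
    fix v s' assume v: "J v 0 s'" "s' 13 0 = v" "v < n"
    show "runs W (For 16 (Const 0) (Var 0)
     (Cond (Conj (Equal (Cell 20 (Var 13)) (Cell 20 (Var 16)))
         (Neg (Equal (Cell 7 (index (Var 13) (Var 16))) (Const 0))))
       (Store 9 (Var 13) (Add (Var 16) (Const 1))) Skip)) s' ((n - 0) * (2 + 2) + 2)
       (\<lambda>s''. s'' 13 0 = v \<and> J (Suc v) 0 (s''(13 := (s'' 13)(0 := Suc v))))"
    proof (rule runs_weaken[OF runs_For_const[where I = "\<lambda>i s''. J v i s'' \<and> s'' 13 0 = v" and L = 0 and N = n and T = 2]])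
      show "aok W s' (Const 0)" "av s' (Const 0) = 0" "0 \<le> n" "n < W" using W_bounds by auto
      show "J v 0 (s'(16 := (s' 16)(0 := 0))) \<and> (s'(16 := (s' 16)(0 := 0))) 13 0 = v"
        using v by (simp add: J_def)
      show "aok W s'' (Var 0) \<and> av s'' (Var 0) = n" if "J v i s'' \<and> s'' 13 0 = v" for i s''
        using that in_s W_bounds by (simp add: J_def)
      show "s'' 13 0 = v \<and> J (Suc v) 0 (s''(13 := (s'' 13)(0 := Suc v)))" if "J v n s'' \<and> s'' 13 0 = v" for s''
        using that by (auto simp: J_def less_Suc_eq)
      fix u s'' assume J: "J v u s'' \<and> s'' 13 0 = v" and u: "s'' 16 0 = u" "u < n"
      then have c: "s'' 20 = s 20" "s'' 7 = s 7" "s'' 0 0 = n" "s'' 13 0 = v" using in_s by (auto simp: J_def)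
      have le: "s 20 v < W" "s 20 u < W" "s 7 (v * n + u) < W" "v < W" "u < W" "Suc u < W" "v * n + u < W" "v * n < W"
        using s(2)[of v] s(2)[of u] s(3)[of v u] u v idx_W[of v u] bound_W by auto
      have "J v (Suc u) (if ?P v u then s''(9 := (s'' 9)(v := Suc u), 16 := (s'' 16)(0 := Suc u))
          else s''(16 := (s'' 16)(0 := Suc u)))"
        using J by (auto simp: J_def)
      then have "wp W (Cond (Conj (Equal (Cell 20 (Var 13)) (Cell 20 (Var 16)))
         (Neg (Equal (Cell 7 (index (Var 13) (Var 16))) (Const 0))))
       (Store 9 (Var 13) (Add (Var 16) (Const 1))) Skip) s''
       (\<lambda>s'''. s''' 16 0 = u \<and> (J v (Suc u) (s'''(16 := (s''' 16)(0 := Suc u))) \<and> (s'''(16 := (s''' 16)(0 := Suc u))) 13 0 = v))"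
        using c u le W_bounds by (auto simp: index_def)
      then show "runs W (Cond (Conj (Equal (Cell 20 (Var 13)) (Cell 20 (Var 16)))
         (Neg (Equal (Cell 7 (index (Var 13) (Var 16))) (Const 0))))
       (Store 9 (Var 13) (Add (Var 16) (Const 1))) Skip) s'' 2
       (\<lambda>s'''. s''' 16 0 = u \<and> (J v (Suc u) (s'''(16 := (s''' 16)(0 := Suc u))) \<and> (s'''(16 := (s''' 16)(0 := Suc u))) 13 0 = v))"
        by (rule wp_runs_le) simp
    qed simp
  qed
  then show ?thesis by (rule runs_weaken) (auto simp: J_def algebra_simps)
qed

lemma find_far_correct:
  assumes s: "input s" "\<And>u v. u < n \<Longrightarrow> v < n \<Longrightarrow> s 6 (u * n + v) \<le> n" "\<And>v. v < n \<Longrightarrow> s 9 v \<le> n"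
    "\<And>v. s 10 v = 0"
  shows "runs W find_far s (n * 5 + 2)
    (\<lambda>s'. (\<forall>b. b \<notin> {10, 13, 16} \<longrightarrow> s' b = s b) \<and>
      (\<forall>x. s' 10 x = last1 (\<lambda>v. s 9 v - 1 = x \<and> 15 < s 6 (x * n + v)) n))"
proof -
  have in_s: "s 0 0 = n" using s(1) by (simp add: input_def)
  define I where "I i s' \<longleftrightarrow> (\<forall>b. b \<notin> {10, 13, 16} \<longrightarrow> s' b = s b) \<and>
    (\<forall>x. s' 10 x = last1 (\<lambda>v. s 9 v - 1 = x \<and> 15 < s 6 (x * n + v)) i)" for i :: nat and s'
  have "runs W find_far s ((n - 0) * (3 + 2) + 2) (I n)"
    unfolding find_far_def
  proof (rule runs_For_const)
    show "aok W s (Const 0)" "av s (Const 0) = 0" "0 \<le> n" "n < W" using W_bounds by auto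
    show "I 0 (s(13 := (s 13)(0 := 0)))" using s(4) by (simp add: I_def)
    show "aok W s' (Var 0) \<and> av s' (Var 0) = n" if "I i s'" for i s'
      using that in_s W_bounds by (simp add: I_def)
    fix v s' assume v: "I v s'" "s' 13 0 = v" "v < n"
    define x where "x = s 9 v - 1"
    have x: "x < n" using s(3)[OF v(3)] n0 by (simp add: x_def)
    have c: "s' 9 = s 9" "s' 6 = s 6" "s' 0 0 = n" using in_s v by (auto simp: I_def)
    have le: "s 9 v < W" "v < W" "x < W" "Suc v < W" "x * n + v < W" "x * n < W" "s 6 (x * n + v) < W"
      using s(2)[OF x v(3)] s(3)[OF v(3)] v x idx_W[of x v] bound_W by auto
    have "I (Suc v) (if 15 < s 6 (x * n + v) then s'(16 := (s' 16)(0 := x), 10 := (s' 10)(x := Suc v), 13 := (s' 13)(0 := Suc v))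
       else s'(16 := (s' 16)(0 := x), 13 := (s' 13)(0 := Suc v)))"
      using v by (auto simp: I_def x_def)
    then have "wp W (Seq (Assign 16 (Sub (Cell 9 (Var 13)) (Const 1)))
     (Cond (Less (Const 15) (Cell 6 (index (Var 16) (Var 13))))
       (Store 10 (Var 16) (Add (Var 13) (Const 1))) Skip)) s'
       (\<lambda>s''. s'' 13 0 = v \<and> I (Suc v) (s''(13 := (s'' 13)(0 := Suc v))))"
      using c v le W_bounds by (auto simp: index_def x_def)
    then show "runs W (Seq (Assign 16 (Sub (Cell 9 (Var 13)) (Const 1)))
     (Cond (Less (Const 15) (Cell 6 (index (Var 16) (Var 13))))
       (Store 10 (Var 16) (Add (Var 13) (Const 1))) Skip)) s' 3
       (\<lambda>s''. s'' 13 0 = v \<and> I (Suc v) (s''(13 := (s'' 13)(0 := Suc v))))"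
      by (rule wp_runs_le) simp
  qed
  then show ?thesis by (rule runs_weaken) (auto simp: I_def)
qed

lemma find_reps_correct:
  assumes s: "input s" "\<And>u v. u < n \<Longrightarrow> v < n \<Longrightarrow> s 6 (u * n + v) \<le> n" "\<And>v. v < n \<Longrightarrow> s 9 v \<le> n"
    "\<And>v. s 10 v \<le> n"
  shows "runs W find_reps s (n * 5 + 2)
    (\<lambda>s'. (\<forall>b. b \<notin> {11, 13, 16} \<longrightarrow> s' b = s b) \<and>
      (\<forall>v<n. s' 11 v = (if 0 < s 10 (s 9 v - 1) \<and> 4 < s 6 ((s 9 v - 1) * n + v)
        then s 10 (s 9 v - 1) - 1 else s 9 v - 1)))"
proof -
  have in_s: "s 0 0 = n" using s(1) by (simp add: input_def)
  define I where "I i s' \<longleftrightarrow> (\<forall>b. b \<notin> {11, 13, 16} \<longrightarrow> s' b = s b) \<and>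
    (\<forall>v<i. s' 11 v = (if 0 < s 10 (s 9 v - 1) \<and> 4 < s 6 ((s 9 v - 1) * n + v)
        then s 10 (s 9 v - 1) - 1 else s 9 v - 1))" for i :: nat and s'
  have "runs W find_reps s ((n - 0) * (3 + 2) + 2) (I n)"
    unfolding find_reps_def
  proof (rule runs_For_const)
    show "aok W s (Const 0)" "av s (Const 0) = 0" "0 \<le> n" "n < W" using W_bounds by auto
    show "I 0 (s(13 := (s 13)(0 := 0)))" by (simp add: I_def)
    show "aok W s' (Var 0) \<and> av s' (Var 0) = n" if "I i s'" for i s'
      using that in_s W_bounds by (simp add: I_def)
    fix v s' assume v: "I v s'" "s' 13 0 = v" "v < n"
    define x where "x = s 9 v - 1"
    have x: "x < n" using s(3)[OF v(3)] n0 by (simp add: x_def)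
    have c: "s' 9 = s 9" "s' 6 = s 6" "s' 0 0 = n" "s' 10 = s 10" using in_s v by (auto simp: I_def)
    have le: "s 9 v < W" "v < W" "x < W" "x * n + v < W" "x * n < W" "s 6 (x * n + v) < W" "s 10 x < W"
      using s(2)[OF x v(3)] s(3)[OF v(3)] s(4)[of x] v x idx_W[of x v] bound_W by auto
    have "I (Suc v) (if 0 < s 10 x \<and> 4 < s 6 (x * n + v)
       then s'(16 := (s' 16)(0 := x), 11 := (s' 11)(v := s 10 x - 1), 13 := (s' 13)(0 := Suc v))
       else s'(16 := (s' 16)(0 := x), 11 := (s' 11)(v := x), 13 := (s' 13)(0 := Suc v)))"
      using v by (auto simp: I_def x_def less_Suc_eq)
    then have "wp W (Seq (Assign 16 (Sub (Cell 9 (Var 13)) (Const 1)))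
     (Cond (Conj (Less (Const 0) (Cell 10 (Var 16))) (Less (Const 4) (Cell 6 (index (Var 16) (Var 13)))))
       (Store 11 (Var 13) (Sub (Cell 10 (Var 16)) (Const 1))) (Store 11 (Var 13) (Var 16)))) s'
       (\<lambda>s''. s'' 13 0 = v \<and> I (Suc v) (s''(13 := (s'' 13)(0 := Suc v))))"
      using c v le W_bounds by (auto simp: index_def x_def)
    then show "runs W (Seq (Assign 16 (Sub (Cell 9 (Var 13)) (Const 1)))
     (Cond (Conj (Less (Const 0) (Cell 10 (Var 16))) (Less (Const 4) (Cell 6 (index (Var 16) (Var 13)))))
       (Store 11 (Var 13) (Sub (Cell 10 (Var 16)) (Const 1))) (Store 11 (Var 13) (Var 16)))) s' 3
       (\<lambda>s''. s'' 13 0 = v \<and> I (Suc v) (s''(13 := (s'' 13)(0 := Suc v))))"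
      by (rule wp_runs_le) simp
  qed
  then show ?thesis by (rule runs_weaken) (auto simp: I_def)
qed

definition mat where
  "mat f = {(x, y). x < n \<and> y < n \<and> f (x * n + y) \<noteq> 0}" for f :: "nat \<Rightarrow> nat"

lemma mat_upd: "x < n \<Longrightarrow> y < n \<Longrightarrow> mat (f(x * n + y := Suc 0)) = insert (x, y) (mat f)"
  by (auto simp: mat_def idx_eq)

lemma fill_matrix_correct:
  assumes s: "input s" "\<And>v. v < n \<Longrightarrow> s 11 v < n" "\<And>x. s 12 x = 0"
  shows "runs W fill_matrix s (5 * off n + 7 * n + 2)
    (\<lambda>s'. (\<forall>b. b \<notin> {12, 13, 17, 18} \<longrightarrow> s' b = s b) \<and> (\<forall>x. s' 12 x \<le> 1) \<and>
      mat (s' 12) = {(s 11 a, s 11 b) | a b. (a, b) \<in> E \<and> s 11 a \<noteq> s 11 b} \<union>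
        {(a, s 11 a) | a. a < n \<and> s 11 a \<noteq> a} \<union> {(s 11 a, a) | a. a < n \<and> s 11 a \<noteq> a})"
proof -
  have in_s: "s 0 0 = n" "s 1 = off" "s 2 = adj" using s(1) by (auto simp: input_def)
  define R where "R v = (\<Union>a<v. {(s 11 a, s 11 b) | b. (a, b) \<in> E \<and> s 11 a \<noteq> s 11 b} \<union>
        (if s 11 a = a then {} else {(a, s 11 a), (s 11 a, a)}))" for v
  define J where "J v i s' \<longleftrightarrow> (\<forall>b. b \<notin> {12, 13, 17, 18} \<longrightarrow> s' b = s b) \<and> (\<forall>x. s' 12 x \<le> 1) \<and> s' 13 0 = v \<and>
    mat (s' 12) = R v \<union> (if s 11 v = v then {} else {(v, s 11 v), (s 11 v, v)}) \<union>
      {(s 11 v, s 11 (adj j)) | j. off v \<le> j \<and> j < i \<and> s 11 v \<noteq> s 11 (adj j)}" for v i s'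
  define I where "I v s' \<longleftrightarrow> (\<forall>b. b \<notin> {12, 13, 17, 18} \<longrightarrow> s' b = s b) \<and> (\<forall>x. s' 12 x \<le> 1) \<and>
    mat (s' 12) = R v" for v s'
  \<comment> \<open>The rounds have different lengths, given by the degrees, which add up to
    \<open>off n\<close>.\<close>
  have run: "runs W fill_matrix s ((\<Sum>v=0..<n. (3 + ((off (Suc v) - off v) * (3 + 2) + 2)) + 2) + 2) (I n)"
    unfolding fill_matrix_def
  proof (rule runs_For)
    show "aok W s (Const 0)" "av s (Const 0) = 0" "0 \<le> n" "n < W" using W_bounds by auto
    show "I 0 (s(13 := (s 13)(0 := 0)))" using s(3) by (auto simp: I_def R_def mat_def)
    show "aok W s' (Var 0) \<and> av s' (Var 0) = n" if "I i s'" for i s'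
      using that in_s W_bounds by (simp add: I_def)
    fix v s' assume v: "I v s'" "s' 13 0 = v" "v < n"
    have c: "s' 0 0 = n" "s' 11 = s 11" "s' 1 = off" using v in_s by (auto simp: I_def)
    have le: "v < W" "s 11 v < n" "s 11 v < W" "v * n < W" "s 11 v * n < W" "v * n + s 11 v < W" "s 11 v * n + v < W"
      "off v < W" "Suc v < W" "off (Suc v) < W"
      using v(3) s(2)[OF v(3)] idx_W[of v "s 11 v"] idx_W[of "s 11 v" v] bound_W off_le[of v] off_le[of "Suc v"] by auto
    let ?pend = "Cond (Equal (Cell 11 (Var 13)) (Var 13)) Skip
       (Seq (Store 12 (index (Var 13) (Cell 11 (Var 13))) (Const 1))
         (Store 12 (index (Cell 11 (Var 13)) (Var 13)) (Const 1)))"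
    let ?inner = "Seq (Assign 18 (Cell 2 (Var 17)))
         (Cond (Equal (Cell 11 (Var 13)) (Cell 11 (Var 18))) Skip
           (Store 12 (index (Cell 11 (Var 13)) (Cell 11 (Var 18))) (Const 1)))"
    let ?for = "For 17 (Cell 1 (Var 13)) (Cell 1 (Add (Var 13) (Const 1))) ?inner"
    let ?s1 = "if s 11 v = v then s' else s'(12 := (s' 12)(v * n + s 11 v := Suc 0, s 11 v * n + v := Suc 0))"
    have J1: "J v (off v) ?s1"
      using v le c by (auto simp: I_def J_def mat_upd)
    have "wp W ?pend s' (\<lambda>x. x = ?s1)"
      using v c le W_bounds by (auto simp: index_def)
    then have "runs W ?pend s' 3 (\<lambda>x. x = ?s1)" by (rule wp_runs_le) simp
    then have pend: "runs W ?pend s' 3 (J v (off v))"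
      by (rule runs_weaken[OF _ order_refl]) (erule ssubst, rule J1)
    have for_loop: "runs W ?for s1 ((off (Suc v) - off v) * (3 + 2) + 2) (J v (off (Suc v)))" if s1: "J v (off v) s1" for s1
    proof (rule runs_For_const)
      have c: "s1 1 = off" "s1 13 0 = v" using s1 in_s by (auto simp: J_def)
      show "aok W s1 (Cell 1 (Var 13))" "av s1 (Cell 1 (Var 13)) = off v" using c le W_bounds by auto
      show "off v \<le> off (Suc v)" "off (Suc v) < W" using off_Suc v le by auto
      show "J v (off v) (s1(17 := (s1 17)(0 := off v)))" using s1 by (simp add: J_def)
      show "aok W s'' (Cell 1 (Add (Var 13) (Const 1))) \<and> av s'' (Cell 1 (Add (Var 13) (Const 1))) = off (Suc v)"
        if "J v i s''" for i s''
        using that in_s le W_bounds by (simp add: J_def)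
      fix i s'' assume J: "J v i s''" and i: "s'' 17 0 = i" "off v \<le> i" "i < off (Suc v)"
      define w where "w = adj i"
      have "(v, w) \<in> E" using adj_E v(3) i by (simp add: w_def)
      then have w: "w < n" "s 11 w < n" using EV s(2) by auto
      have c: "s'' 0 0 = n" "s'' 11 = s 11" "s'' 2 = adj" "s'' 13 0 = v" using J in_s by (auto simp: J_def)
      have le': "w < W" "s 11 w < W" "s 11 v * n + s 11 w < W" "i < W"
        using w le(2) idx_W[of "s 11 v" "s 11 w"] bound_W i(3) le(10) by auto
      have "J v (Suc i) (if s 11 v = s 11 w then s''(18 := (s'' 18)(0 := w), 17 := (s'' 17)(0 := Suc i))
        else s''(18 := (s'' 18)(0 := w), 12 := (s'' 12)(s 11 v * n + s 11 w := Suc 0), 17 := (s'' 17)(0 := Suc i)))"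
        using J w(2) le(2) i(2) unfolding J_def by (auto simp: mat_upd w_def less_Suc_eq)
      then have "wp W ?inner s'' (\<lambda>s'''. s''' 17 0 = i \<and> J v (Suc i) (s'''(17 := (s''' 17)(0 := Suc i))))"
        using c i le le' W_bounds by (auto simp: index_def w_def[symmetric])
      then show "runs W ?inner s'' 3 (\<lambda>s'''. s''' 17 0 = i \<and> J v (Suc i) (s'''(17 := (s''' 17)(0 := Suc i))))"
        by (rule wp_runs_le) simp
    qed
    show "runs W (Seq ?pend ?for) s' (3 + ((off (Suc v) - off v) * (3 + 2) + 2))
        (\<lambda>s''. s'' 13 0 = v \<and> I (Suc v) (s''(13 := (s'' 13)(0 := Suc v))))"
    proof (rule runs_weaken[OF runs_Seq[OF pend for_loop]])
      fix s'' assume J: "J v (off (Suc v)) s''"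
      have "{(s 11 v, s 11 (adj j)) | j. off v \<le> j \<and> j < off (Suc v) \<and> s 11 v \<noteq> s 11 (adj j)} =
        {(s 11 v, s 11 b) | b. (v, b) \<in> E \<and> s 11 v \<noteq> s 11 b}" (is "?L = ?R")
      proof
        show "?L \<subseteq> ?R" using adj_E[OF v(3)] by blast
        show "?R \<subseteq> ?L"
        proof
          fix e assume "e \<in> ?R"
          then obtain b where b: "e = (s 11 v, s 11 b)" "(v, b) \<in> E" "s 11 v \<noteq> s 11 b" by blast
          from E_adj[OF b(2)] obtain j where "off v \<le> j" "j < off (Suc v)" "b = adj j" by auto
          then show "e \<in> ?L" using b by blast
        qed
      qed
      then have "mat (s'' 12) = R (Suc v)"
        using J by (simp add: J_def R_def lessThan_Suc Un_ac)
      then show "s'' 13 0 = v \<and> I (Suc v) (s''(13 := (s'' 13)(0 := Suc v)))"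
        using J by (auto simp: J_def I_def)
    qed simp_all
  qed
  have time: "(\<Sum>v=0..<n. (3 + ((off (Suc v) - off v) * (3 + 2) + 2)) + 2) = 5 * off n + 7 * n"
    using sum_deg[of n] by (simp add: sum.distrib sum_distrib_right[symmetric] atLeast0LessThan)
  have Rn: "R n = {(s 11 a, s 11 b) | a b. (a, b) \<in> E \<and> s 11 a \<noteq> s 11 b} \<union>
        {(a, s 11 a) | a. a < n \<and> s 11 a \<noteq> a} \<union> {(s 11 a, a) | a. a < n \<and> s 11 a \<noteq> a}" (is "_ = ?R")
  proof
    show "R n \<subseteq> ?R" unfolding R_def by (auto split: if_splits)
    show "?R \<subseteq> R n"
    proof
      fix e assume "e \<in> ?R"
      then consider a b where "e = (s 11 a, s 11 b)" "(a, b) \<in> E" "s 11 a \<noteq> s 11 b"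
        | a where "e = (a, s 11 a) \<or> e = (s 11 a, a)" "a < n" "s 11 a \<noteq> a" by blast
      then show "e \<in> R n"
      proof cases
        case 1
        then have "a < n" using EV by auto
        then show ?thesis using 1 unfolding R_def by blast
      next
        case 2
        then show ?thesis unfolding R_def by auto
      qed
    qed
  qed
  show ?thesis
    by (rule runs_weaken[OF run[unfolded time]]) (simp_all add: I_def Rn)
qed

lemma bij_betw_insert_upd:
  "bij_betw f A B \<Longrightarrow> a \<notin> A \<Longrightarrow> b \<notin> B \<Longrightarrow> bij_betw (f(a := b)) (insert a A) (insert b B)"
  unfolding bij_betw_def by (auto simp: inj_on_def)

lemma bij_betw_upd: "bij_betw f A B \<Longrightarrow> a \<notin> A \<Longrightarrow> bij_betw (f(a := b)) A B"
  by (subst bij_betw_cong[of A "f(a := b)" f]) auto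

lemma write_output_correct:
  assumes s: "input s" "\<And>x. s 12 x \<le> 1" "s 4 0 = 0"
  shows "runs W write_output s (n * (n * 5 + 5) + 4)
    (\<lambda>s'. s' 3 0 = n \<and> s' 4 0 = 0 \<and> (\<forall>v<n. s' 4 v \<le> s' 4 (Suc v) \<and>
       bij_betw (s' 5) {s' 4 v..<s' 4 (Suc v)} {w. (v, w) \<in> mat (s 12)}))"
proof -
  have in_s: "s 0 0 = n" using s(1) by (auto simp: input_def)
  \<comment> \<open>Finished lists end at or before \<open>s' 4 v\<close>, the position of the next
    store, so later stores leave them intact. The bound \<open>v * n\<close> keeps the position
    within a word.\<close>
  define I where "I v s' \<longleftrightarrow> (\<forall>b. b \<notin> {3, 4, 5, 13, 14, 16} \<longrightarrow> s' b = s b) \<and> s' 3 0 = n \<and> s' 4 0 = 0 \<and>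
    s' 14 0 = s' 4 v \<and> s' 4 v \<le> v * n \<and> (\<forall>u<v. s' 4 (Suc u) \<le> s' 4 v \<and> s' 4 u \<le> s' 4 (Suc u) \<and>
       bij_betw (s' 5) {s' 4 u..<s' 4 (Suc u)} {w. (u, w) \<in> mat (s 12)})" for v s'
  define J where "J v i s' \<longleftrightarrow> (\<forall>b. b \<notin> {3, 4, 5, 13, 14, 16} \<longrightarrow> s' b = s b) \<and> s' 3 0 = n \<and> s' 4 0 = 0 \<and> s' 13 0 = v \<and>
    s' 4 v \<le> s' 14 0 \<and> s' 14 0 \<le> v * n + i \<and>
    bij_betw (s' 5) {s' 4 v..<s' 14 0} {w. (v, w) \<in> mat (s 12) \<and> w < i} \<and>
    (\<forall>u<v. s' 4 (Suc u) \<le> s' 4 v \<and> s' 4 u \<le> s' 4 (Suc u) \<and>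
       bij_betw (s' 5) {s' 4 u..<s' 4 (Suc u)} {w. (u, w) \<in> mat (s 12)})" for v i s'
  let ?inner = "Cond (Equal (Cell 12 (index (Var 13) (Var 16))) (Const 0)) Skip
       (Seq (Store 5 (Var 14) (Var 16)) (Assign 14 (Add (Var 14) (Const 1))))"
  let ?for = "For 16 (Const 0) (Var 0) ?inner"
  let ?body = "Seq ?for (Store 4 (Add (Var 13) (Const 1)) (Var 14))"
  let ?s0 = "s(3 := (s 3)(0 := n), 14 := (s 14)(0 := 0))"
  have "runs W (For 13 (Const 0) (Var 0) ?body) ?s0 ((n - 0) * ((((n - 0) * (3 + 2) + 2) + 1) + 2) + 2) (I n)"
  proof (rule runs_For_const)
    show "aok W ?s0 (Const 0)" "av ?s0 (Const 0) = 0" "0 \<le> n" "n < W" using W_bounds by auto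
    show "I 0 (?s0(13 := (?s0 13)(0 := 0)))" using s(3) by (simp add: I_def)
    show "aok W s' (Var 0) \<and> av s' (Var 0) = n" if "I i s'" for i s'
      using that in_s W_bounds by (simp add: I_def)
    fix v s' assume v: "I v s'" "s' 13 0 = v" "v < n"
    have "runs W ?for s' ((n - 0) * (3 + 2) + 2) (J v n)"
    proof (rule runs_For_const)
      show "aok W s' (Const 0)" "av s' (Const 0) = 0" "0 \<le> n" "n < W" using W_bounds by auto
      have "bij_betw (s' 5) {} {}" by (simp add: bij_betw_def)
      then show "J v 0 (s'(16 := (s' 16)(0 := 0)))" using v by (simp add: I_def J_def)
      show "aok W s'' (Var 0) \<and> av s'' (Var 0) = n" if "J v i s''" for i s''
        using that in_s W_bounds by (simp add: J_def)
      fix w s'' assume J: "J v w s''" and w: "s'' 16 0 = w" "w < n"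
      have c: "s'' 0 0 = n" "s'' 12 = s 12" "s'' 13 0 = v" using J in_s by (auto simp: J_def)
      have P: "s'' 14 0 < n * n" using J idx[OF v(3) w(2)] by (simp add: J_def)
      have le: "v < W" "w < W" "v * n < W" "v * n + w < W" "s'' 14 0 < W" "Suc (s'' 14 0) < W" "s 12 (v * n + w) < W"
        using v(3) w(2) idx_W[OF v(3) w(2)] bound_W P s(2)[of "v * n + w"] W_bounds by auto
      have M: "(v, w) \<in> mat (s 12) \<longleftrightarrow> s 12 (v * n + w) \<noteq> 0" using v(3) w(2) by (simp add: mat_def)
      have "J v (Suc w) (s''(5 := (s'' 5)(s'' 14 0 := w), 14 := (s'' 14)(0 := Suc (s'' 14 0)), 16 := (s'' 16)(0 := Suc w)))"
        if "s 12 (v * n + w) \<noteq> 0"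
      proof -
        have "bij_betw ((s'' 5)(s'' 14 0 := w)) (insert (s'' 14 0) {s'' 4 v..<s'' 14 0})
          (insert w {x. (v, x) \<in> mat (s 12) \<and> x < w})"
          using J by (intro bij_betw_insert_upd) (auto simp: J_def)
        moreover have "insert (s'' 14 0) {s'' 4 v..<s'' 14 0} = {s'' 4 v..<Suc (s'' 14 0)}"
          using J by (auto simp: J_def)
        moreover have "insert w {x. (v, x) \<in> mat (s 12) \<and> x < w} = {x. (v, x) \<in> mat (s 12) \<and> x < Suc w}"
          using M that by (auto simp: less_Suc_eq)
        moreover have "bij_betw ((s'' 5)(s'' 14 0 := w)) {s'' 4 u..<s'' 4 (Suc u)} {w. (u, w) \<in> mat (s 12)}" if "u < v" for u
          using J that by (intro bij_betw_upd) (auto simp: J_def)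
        ultimately show ?thesis using J unfolding J_def by simp
      qed
      moreover have "J v (Suc w) (s''(16 := (s'' 16)(0 := Suc w)))" if "s 12 (v * n + w) = 0"
      proof -
        have "{x. (v, x) \<in> mat (s 12) \<and> x < Suc w} = {x. (v, x) \<in> mat (s 12) \<and> x < w}"
          using M that by (auto simp: less_Suc_eq)
        then show ?thesis using J unfolding J_def by simp
      qed
      ultimately have "wp W ?inner s'' (\<lambda>s'''. s''' 16 0 = w \<and> J v (Suc w) (s'''(16 := (s''' 16)(0 := Suc w))))"
        using c w le W_bounds by (simp add: index_def)
      then show "runs W ?inner s'' 3 (\<lambda>s'''. s''' 16 0 = w \<and> J v (Suc w) (s'''(16 := (s''' 16)(0 := Suc w))))"
        by (rule wp_runs_le) simp
    qed
    moreover have "runs W (Store 4 (Add (Var 13) (Const 1)) (Var 14)) s'' 1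
      (\<lambda>s'''. s''' 13 0 = v \<and> I (Suc v) (s'''(13 := (s''' 13)(0 := Suc v))))" if J: "J v n s''" for s''
    proof -
      have "s'' 14 0 \<le> n * n" using J idx[OF v(3), of "n - 1"] n0 by (auto simp: J_def)
      then have le: "s'' 14 0 < W" "v < W" "Suc v < W" using bound_W v(3) by auto
      have M: "{w. (v, w) \<in> mat (s 12) \<and> w < n} = {w. (v, w) \<in> mat (s 12)}" by (auto simp: mat_def)
      let ?f = "(s'' 4)(Suc v := s'' 14 0)"
      have "?f (Suc u) \<le> ?f (Suc v) \<and> ?f u \<le> ?f (Suc u) \<and>
          bij_betw (s'' 5) {?f u..<?f (Suc u)} {w. (u, w) \<in> mat (s 12)}" if "u < Suc v" for u
      proof (cases "u = v")
        case True
        then show ?thesis using J M by (simp add: J_def)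
      next
        case False
        then have "u < v" using that by simp
        then have "s'' 4 (Suc u) \<le> s'' 4 v" "s'' 4 v \<le> s'' 14 0" "s'' 4 u \<le> s'' 4 (Suc u)"
          "bij_betw (s'' 5) {s'' 4 u..<s'' 4 (Suc u)} {w. (u, w) \<in> mat (s 12)}"
          using J by (simp_all add: J_def)
        then show ?thesis using \<open>u < v\<close> by simp
      qed
      then have "I (Suc v) (s''(4 := ?f, 13 := (s'' 13)(0 := Suc v)))"
        using J unfolding I_def J_def by simp
      then show ?thesis using le J W_bounds by (intro wp_runs_le) (auto simp: J_def)
    qed
    ultimately show "runs W ?body s' (((n - 0) * (3 + 2) + 2) + 1)
      (\<lambda>s'''. s''' 13 0 = v \<and> I (Suc v) (s'''(13 := (s''' 13)(0 := Suc v))))" by (rule runs_Seq)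
  qed
  then have "runs W (Seq (Assign 14 (Const 0)) (For 13 (Const 0) (Var 0) ?body)) (s(3 := (s 3)(0 := n)))
    (cost (Assign 14 (Const 0)) + ((n - 0) * ((((n - 0) * (3 + 2) + 2) + 1) + 2) + 2)) (I n)"
    by (rule runs_Seq_wp[rotated]) (use W_bounds in simp)
  then have "runs W write_output s (cost (Assign 3 (Var 0)) + (cost (Assign 14 (Const 0)) +
    ((n - 0) * ((((n - 0) * (3 + 2) + 2) + 1) + 2) + 2))) (I n)"
    unfolding write_output_def by (rule runs_Seq_wp[rotated]) (use W_bounds in_s in simp)
  then show ?thesis by (rule runs_weaken) (auto simp: I_def algebra_simps)
qed

end

section \<open>Correctness\<close>

lemma last1_cong: "(\<And>j. j < i \<Longrightarrow> P j = P' j) \<Longrightarrow> last1 P i = last1 P' i"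
  by (induction i) auto

definition program :: com where
  "program = Seq (bfs_all 6 (Const 0)) (Seq copy_levels (Seq (bfs_all 7 (Cell 20 (Var 13)))
     (Seq find_leaders (Seq find_far (Seq find_reps (Seq fill_matrix write_output))))))"

context layered
begin

text \<open>The search tests only the heads of arcs. That is enough, since the source lies at the
  threshold itself and every further vertex of a walk is a head.\<close>

lemma bfs_val_above:
  assumes "u \<in> V" "v \<in> V" "\<And>y. y \<in> V \<Longrightarrow> f y = Suc (lev y)"
  shows "f u = f v \<and> bfs_val {(x, y) \<in> E. Suc (lev u) \<le> f y} u v \<noteq> 0 \<longleftrightarrow> sc u v"
proof -
  let ?R = "{(x, y) \<in> E. Suc (lev u) \<le> f y}"
  have "(u, v) \<in> ?R\<^sup>* \<longleftrightarrow> (u, v) \<in> (above (lev u))\<^sup>*"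
  proof
    assume "(u, v) \<in> ?R\<^sup>*"
    then have "(u, v) \<in> (above (lev u))\<^sup>* \<and> lev u \<le> lev v"
    proof (induction rule: rtrancl_induct)
      case (step y z)
      then have "(y, z) \<in> above (lev u)" "lev u \<le> lev z"
        using assms(3)[of z] E_V by (auto simp: above_def)
      then show ?case using step.IH by (meson rtrancl.rtrancl_into_rtrancl)
    qed simp
    then show "(u, v) \<in> (above (lev u))\<^sup>*" by simp
  next
    assume "(u, v) \<in> (above (lev u))\<^sup>*"
    moreover have "above (lev u) \<subseteq> ?R" using assms(3) E_V by (auto simp: above_def)
    ultimately show "(u, v) \<in> ?R\<^sup>*" using rtrancl_mono by blast
  qed
  then show ?thesis using assms by (auto simp: bfs_val_def sc_def)
qed

end

section \<open>The selections of the program as a grouping\<close>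

locale chosen_groups = layered "{..<n}" E 0 for n :: nat and E +
  assumes free: "K23_induced_minor_free \<lparr> pverts = {..<n}, parcs = E \<rparr>"
begin

definition leader :: "nat \<Rightarrow> nat" where
  "leader v = last1 (sc v) n - 1"

definition far1 :: "nat \<Rightarrow> nat" where
  "far1 x = last1 (\<lambda>v. leader v = x \<and> 15 < Suc (d x v)) n"

definition group_rep :: "nat \<Rightarrow> nat" where
  "group_rep v = (if 0 < far1 (leader v) \<and> 4 < Suc (d (leader v) v) then far1 (leader v) - 1 else leader v)"

lemma leader_sc:
  assumes "v < n"
  shows "sc v (leader v)" "leader v < n"
proof -
  have "last1 (sc v) n \<noteq> 0" using last1_0D[of "sc v" n v] assms by auto
  then obtain j where "last1 (sc v) n = Suc j" using not0_implies_Suc by blast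
  then show "sc v (leader v)" "leader v < n" using last1_SucD by (auto simp: leader_def)
qed

sublocale grouping "{..<n}" E 0 leader "\<lambda>x. if far1 x = 0 then None else Some (far1 x - 1)" group_rep
proof
  show "d u v \<le> 3 \<or> d u w \<le> 3 \<or> d v w \<le> 3" if "u \<in> {..<n}" "sc u v" "sc u w" for u v w
    using cluster_triple[OF free that] .
  show "sc v (leader v)" if "v \<in> {..<n}" for v using leader_sc that by simp
  show "leader u = leader v" if "sc u v" for u v
  proof -
    \<comment> \<open>Members of one cluster define the same predicate, hence the same last
      index.\<close>
    have "sc u = sc v" using that sc_sym sc_trans by blast
    then show ?thesis by (simp add: leader_def)
  qed
  show "sc (leader v) y \<and> 15 \<le> d (leader v) y"
    if "v \<in> {..<n}" "(if far1 (leader v) = 0 then None else Some (far1 (leader v) - 1)) = Some y" for v y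
  proof -
    have "far1 (leader v) = Suc y" using that(2) by (auto split: if_splits)
    then have "leader y = leader v \<and> 15 < Suc (d (leader v) y) \<and> y < n"
      using last1_SucD unfolding far1_def by blast
    then show ?thesis using leader_sc(1)[of y] sc_sym by auto
  qed
  show "d (leader v) v < 15"
    if "v \<in> {..<n}" "(if far1 (leader v) = 0 then None else Some (far1 (leader v) - 1)) = None" for v
  proof -
    have "far1 (leader v) = 0" using that(2) by (auto split: if_splits)
    then have "last1 (\<lambda>w. leader w = leader v \<and> 15 < Suc (d (leader v) w)) n = 0"
      by (simp only: far1_def)
    then have "\<not> (leader v = leader v \<and> 15 < Suc (d (leader v) v))"
      by (rule last1_0D) (use that(1) in simp)
    then show ?thesis by simp
  qed
  show "group_rep v = (case if far1 (leader v) = 0 then None else Some (far1 (leader v) - 1) of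
      None \<Rightarrow> leader v | Some y \<Rightarrow> if 3 < d (leader v) v then y else leader v)" for v
    by (auto simp: group_rep_def)
qed

end

locale algorithm = memory W n off adj E + chosen_groups n E for W n off adj E
begin

lemma n_pos: "0 < n" using rV by simp

lemma program_correct:
  assumes s: "input s" "\<And>a x. a > 2 \<Longrightarrow> s a x = 0"
  shows "runs W program s (2 * (n * (7 * off n + 5 * n + 8) + 2) + (n * 3 + 2) + (n * (n * 4 + 4) + 2)
      + 2 * (n * 5 + 2) + (5 * off n + 7 * n + 2) + (n * (n * 5 + 5) + 4))
    (\<lambda>s'. s' 3 0 = n \<and> s' 4 0 = 0 \<and> (\<forall>v<n. s' 4 v \<le> s' 4 (Suc v) \<and>
       bij_betw (s' 5) {s' 4 v..<s' 4 (Suc v)} {w. (v, w) \<in> EH}))"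
    (is "runs W program s ?T ?Q")
proof -
  let ?V = "{..<n}"
  have bfs_val: "bfs_val E u v = Suc (d u v)" if "u < n" "v < n" for u v
    using conn that by (simp add: bfs_val_def)
  \<comment> \<open>Each of the following assertions retains the arrays that later passes read, or
    that they expect to be zero.\<close>
  define P1 where "P1 s' \<longleftrightarrow> input s' \<and> (\<forall>x. s' 4 x = 0 \<and> s' 7 x = 0 \<and> s' 9 x = 0 \<and> s' 10 x = 0 \<and> s' 12 x = 0) \<and>
    (\<forall>u<n. \<forall>v<n. s' 6 (u * n + v) = Suc (d u v) \<and> Suc (d u v) \<le> n)" for s' :: state
  define P2 where "P2 s' \<longleftrightarrow> P1 s' \<and> (\<forall>v<n. s' 20 v = Suc (lev v) \<and> Suc (lev v) \<le> n)" for s' :: state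
  define P3 where "P3 s' \<longleftrightarrow> input s' \<and> (\<forall>x. s' 4 x = 0 \<and> s' 9 x = 0 \<and> s' 10 x = 0 \<and> s' 12 x = 0) \<and>
    (\<forall>u<n. \<forall>v<n. s' 6 (u * n + v) = Suc (d u v) \<and> Suc (d u v) \<le> n) \<and> (\<forall>v<n. s' 20 v \<le> n) \<and>
    (\<forall>u<n. \<forall>v<n. s' 7 (u * n + v) \<le> n) \<and>
    (\<forall>u<n. \<forall>v<n. s' 20 u = s' 20 v \<and> s' 7 (u * n + v) \<noteq> 0 \<longleftrightarrow> sc u v)" for s' :: state
  define P4 where "P4 s' \<longleftrightarrow> input s' \<and> (\<forall>x. s' 4 x = 0 \<and> s' 10 x = 0 \<and> s' 12 x = 0) \<and>
    (\<forall>u<n. \<forall>v<n. s' 6 (u * n + v) = Suc (d u v) \<and> Suc (d u v) \<le> n) \<and>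
    (\<forall>v<n. s' 9 v - 1 = leader v \<and> s' 9 v \<le> n)" for s' :: state
  define P5 where "P5 s' \<longleftrightarrow> input s' \<and> (\<forall>x. s' 4 x = 0 \<and> s' 12 x = 0) \<and>
    (\<forall>u<n. \<forall>v<n. s' 6 (u * n + v) = Suc (d u v) \<and> Suc (d u v) \<le> n) \<and>
    (\<forall>v<n. s' 9 v - 1 = leader v \<and> s' 9 v \<le> n) \<and> (\<forall>x. s' 10 x \<le> n) \<and> (\<forall>x<n. s' 10 x = far1 x)" for s' :: state
  define P6 where "P6 s' \<longleftrightarrow> input s' \<and> (\<forall>x. s' 4 x = 0 \<and> s' 12 x = 0) \<and> (\<forall>v<n. s' 11 v = group_rep v)" for s' :: state
  define P7 where "P7 s' \<longleftrightarrow> input s' \<and> s' 4 0 = 0 \<and> (\<forall>x. s' 12 x \<le> 1) \<and> mat (s' 12) = EH" for s' :: state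
  have 1: "runs W (bfs_all 6 (Const 0)) s (n * (7 * off n + 5 * n + 8) + 2) P1"
  proof (rule runs_weaken[OF bfs_all_correct[where k = "\<lambda>_. 0"]])
    fix s' assume *: "(\<forall>b. b \<notin> {6, 8, 13, 14, 15, 16, 17, 18, 19} \<longrightarrow> s' b = s b) \<and>
      (\<forall>u<n. row (s' 6) u = bfs_val {(x, y) \<in> E. 0 \<le> s 20 y} u) \<and> (\<forall>u<n. \<forall>v<n. s' 6 (u * n + v) \<le> n)"
    have "input s'" by (rule input_frame[OF s(1) conjunct1[OF *]]) simp
    moreover have "s' 6 (u * n + v) = Suc (d u v)" "Suc (d u v) \<le> n" if "u < n" "v < n" for u v
    proof -
      have "s' 6 (u * n + v) = row (s' 6) u v" using that by (simp add: row_def)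
      then show 6: "s' 6 (u * n + v) = Suc (d u v)" using * that bfs_val by simp
      have "s' 6 (u * n + v) \<le> n" using * that by blast
      then show "Suc (d u v) \<le> n" unfolding 6 .
    qed
    ultimately show "P1 s'" using * s(2) by (simp add: P1_def)
  qed (use s W_bounds in auto)
  have 2: "runs W copy_levels s' (n * 3 + 2) P2" if P: "P1 s'" for s'
  proof (rule runs_weaken[OF copy_levels_correct])
    have row0: "s' 6 v = Suc (lev v)" "Suc (lev v) \<le> n" if "v < n" for v
    proof -
      have "s' 6 (0 * n + v) = Suc (lev v) \<and> Suc (lev v) \<le> n" using P that n_pos unfolding P1_def by blast
      then show "s' 6 v = Suc (lev v)" "Suc (lev v) \<le> n" by simp_all
    qed
    show "input s'" using P by (simp add: P1_def)
    show "s' 6 v \<le> n" if "v < n" for v using row0[OF that] by simp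
    fix s'' assume *: "(\<forall>b. b \<notin> {16, 20} \<longrightarrow> s'' b = s' b) \<and> (\<forall>v<n. s'' 20 v = s' 6 v)"
    have "input s''"
      by (rule input_frame[OF _ conjunct1[OF *]]) (use P in \<open>simp_all add: P1_def\<close>)
    then show "P2 s''" using * P row0 by (simp add: P1_def P2_def)
  qed simp
  have 3: "runs W (bfs_all 7 (Cell 20 (Var 13))) s' (n * (7 * off n + 5 * n + 8) + 2) P3" if P: "P2 s'" for s'
  proof (rule runs_weaken[OF bfs_all_correct[where k = "\<lambda>u. Suc (lev u)"]])
    have lv: "s' 20 v = Suc (lev v)" "s' 20 v \<le> n" "s' 20 v < W" if "v < n" for v
      using P that bound_W by (auto simp: P2_def)
    show "input s'" "\<And>x. s' 7 x = 0" using P by (auto simp: P1_def P2_def)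
    show "s' 20 v < W" if "v < n" for v using lv that by simp
    show "Suc (lev i) < W" if "i < n" for i using lv[OF that] by simp
    show "aok W s'' (Cell 20 (Var 13)) \<and> av s'' (Cell 20 (Var 13)) = Suc (lev i)"
      if "\<forall>b. b \<notin> {7, 8, 13, 14, 15, 16, 17, 18, 19} \<longrightarrow> s'' b = s' b" "s'' 13 0 = i" "i < n" for s'' i
      using that lv[OF that(3)] W_bounds by simp
    fix s'' assume *: "(\<forall>b. b \<notin> {7, 8, 13, 14, 15, 16, 17, 18, 19} \<longrightarrow> s'' b = s' b) \<and>
      (\<forall>u<n. row (s'' 7) u = bfs_val {(x, y) \<in> E. Suc (lev u) \<le> s' 20 y} u) \<and> (\<forall>u<n. \<forall>v<n. s'' 7 (u * n + v) \<le> n)"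
    have "input s''"
      by (rule input_frame[OF _ conjunct1[OF *]]) (use P in \<open>simp_all add: P1_def P2_def\<close>)
    moreover have "s'' 20 u = s'' 20 v \<and> s'' 7 (u * n + v) \<noteq> 0 \<longleftrightarrow> sc u v" if uv: "u < n" "v < n" for u v
    proof -
      have "s'' 7 (u * n + v) = row (s'' 7) u v" using uv by (simp add: row_def)
      moreover have "row (s'' 7) u = bfs_val {(x, y) \<in> E. Suc (lev u) \<le> s' 20 y} u" using * uv by blast
      moreover have "s'' 20 = s' 20" using * by simp
      ultimately show ?thesis using bfs_val_above[of u v "s' 20"] lv uv by simp
    qed
    ultimately show "P3 s''" using * P lv by (simp add: P1_def P2_def P3_def)
  qed simp_all
  have 4: "runs W find_leaders s' (n * (n * 4 + 4) + 2) P4" if P: "P3 s'" for s'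
  proof (rule runs_weaken[OF find_leaders_correct])
    show "input s'" "\<And>v. v < n \<Longrightarrow> s' 20 v \<le> n" "\<And>u v. u < n \<Longrightarrow> v < n \<Longrightarrow> s' 7 (u * n + v) \<le> n" "\<And>v. s' 9 v = 0"
      using P by (auto simp: P3_def)
    fix s'' assume *: "(\<forall>b. b \<notin> {9, 13, 16} \<longrightarrow> s'' b = s' b) \<and>
      (\<forall>v<n. s'' 9 v = last1 (\<lambda>u. s' 20 v = s' 20 u \<and> s' 7 (v * n + u) \<noteq> 0) n)"
    have "input s''"
      by (rule input_frame[OF _ conjunct1[OF *]]) (use P in \<open>simp_all add: P3_def\<close>)
    moreover have "s'' 9 v = last1 (sc v) n" if "v < n" for v
    proof -
      have "last1 (\<lambda>u. s' 20 v = s' 20 u \<and> s' 7 (v * n + u) \<noteq> 0) n = last1 (sc v) n"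
        using P that by (intro last1_cong) (simp add: P3_def)
      then show ?thesis using * that by simp
    qed
    ultimately show "P4 s''" using * P by (simp add: P3_def P4_def leader_def last1_le)
  qed simp
  have 5: "runs W find_far s' (n * 5 + 2) P5" if P: "P4 s'" for s'
  proof (rule runs_weaken[OF find_far_correct])
    show "input s'" "\<And>u v. u < n \<Longrightarrow> v < n \<Longrightarrow> s' 6 (u * n + v) \<le> n" "\<And>v. v < n \<Longrightarrow> s' 9 v \<le> n" "\<And>v. s' 10 v = 0"
      using P by (auto simp: P4_def)
    fix s'' assume *: "(\<forall>b. b \<notin> {10, 13, 16} \<longrightarrow> s'' b = s' b) \<and>
      (\<forall>x. s'' 10 x = last1 (\<lambda>v. s' 9 v - 1 = x \<and> 15 < s' 6 (x * n + v)) n)"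
    have "input s''"
      by (rule input_frame[OF _ conjunct1[OF *]]) (use P in \<open>simp_all add: P4_def\<close>)
    moreover have "s'' 10 x = far1 x" if "x < n" for x
    proof -
      have "last1 (\<lambda>v. s' 9 v - 1 = x \<and> 15 < s' 6 (x * n + v)) n = far1 x"
        using P that unfolding far1_def by (intro last1_cong) (simp add: P4_def)
      then show ?thesis using * by simp
    qed
    ultimately show "P5 s''" using * P by (simp add: P4_def P5_def last1_le)
  qed simp
  have 6: "runs W find_reps s' (n * 5 + 2) P6" if P: "P5 s'" for s'
  proof (rule runs_weaken[OF find_reps_correct])
    show "input s'" "\<And>u v. u < n \<Longrightarrow> v < n \<Longrightarrow> s' 6 (u * n + v) \<le> n" "\<And>v. v < n \<Longrightarrow> s' 9 v \<le> n" "\<And>v. s' 10 v \<le> n"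
      using P by (auto simp: P5_def)
    fix s'' assume *: "(\<forall>b. b \<notin> {11, 13, 16} \<longrightarrow> s'' b = s' b) \<and>
      (\<forall>v<n. s'' 11 v = (if 0 < s' 10 (s' 9 v - 1) \<and> 4 < s' 6 ((s' 9 v - 1) * n + v)
        then s' 10 (s' 9 v - 1) - 1 else s' 9 v - 1))"
    have "input s''"
      by (rule input_frame[OF _ conjunct1[OF *]]) (use P in \<open>simp_all add: P5_def\<close>)
    moreover have "s'' 11 v = group_rep v" if "v < n" for v
    proof -
      have "s' 9 v - 1 = leader v" "leader v < n" "s' 10 (leader v) = far1 (leader v)"
          "s' 6 (leader v * n + v) = Suc (d (leader v) v)"
        using P that leader_sc(2)[OF that] by (simp_all add: P5_def)
      then show ?thesis using * that unfolding group_rep_def by simp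
    qed
    ultimately show "P6 s''" using * P by (simp add: P5_def P6_def)
  qed simp
  have 7: "runs W fill_matrix s' (5 * off n + 7 * n + 2) P7" if P: "P6 s'" for s'
  proof (rule runs_weaken[OF fill_matrix_correct])
    have rp: "s' 11 v = group_rep v" "group_rep v < n" if "v < n" for v
      using P that rep_V[of v] by (auto simp: P6_def)
    show "input s'" "\<And>x. s' 12 x = 0" using P by (auto simp: P6_def)
    show "s' 11 v < n" if "v < n" for v using rp that by simp
    fix s'' assume *: "(\<forall>b. b \<notin> {12, 13, 17, 18} \<longrightarrow> s'' b = s' b) \<and> (\<forall>x. s'' 12 x \<le> 1) \<and>
      mat (s'' 12) = {(s' 11 a, s' 11 b) | a b. (a, b) \<in> E \<and> s' 11 a \<noteq> s' 11 b} \<union>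
        {(a, s' 11 a) | a. a < n \<and> s' 11 a \<noteq> a} \<union> {(s' 11 a, a) | a. a < n \<and> s' 11 a \<noteq> a}"
    have "input s''"
      by (rule input_frame[OF _ conjunct1[OF *]]) (use P in \<open>simp_all add: P6_def\<close>)
    moreover have "{(s' 11 a, s' 11 b) | a b. (a, b) \<in> E \<and> s' 11 a \<noteq> s' 11 b} = Q"
    proof -
      have "s' 11 a = group_rep a \<and> s' 11 b = group_rep b" if "(a, b) \<in> E" for a b
        using rp E_V[OF that] by simp
      then show ?thesis unfolding Q_def by (intro Collect_cong) metis
    qed
    moreover have "{(a, s' 11 a) | a. a < n \<and> s' 11 a \<noteq> a} = {(a, group_rep a) | a. a \<in> ?V \<and> group_rep a \<noteq> a}"
      "{(s' 11 a, a) | a. a < n \<and> s' 11 a \<noteq> a} = {(group_rep a, a) | a. a \<in> ?V \<and> group_rep a \<noteq> a}"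
      using rp(1) by (simp_all add: lessThan_iff) (intro Collect_cong, metis)+
    ultimately show "P7 s''" using * P by (simp add: P6_def P7_def EH_def)
  qed simp
  have 8: "runs W write_output s' (n * (n * 5 + 5) + 4) ?Q" if P: "P7 s'" for s'
    using write_output_correct[of s'] P by (simp add: P7_def)
  note chain = runs_Seq[OF 1 runs_Seq[OF 2 runs_Seq[OF 3 runs_Seq[OF 4 runs_Seq[OF 5
    runs_Seq[OF 6 runs_Seq[OF 7 8]]]]]]]
  show ?thesis unfolding program_def
    by (rule runs_weaken[OF chain]) simp_all
qed

end

section \<open>Number of arcs, running time and word size\<close>

lemma stores_graph_card:
  assumes "\<And>v. v < n \<Longrightarrow> f v \<le> f (Suc v) \<and> bij_betw g {f v..<f (Suc v)} {w. (v, w) \<in> E}"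
    and "E \<subseteq> {..<n} \<times> {..<n}" "f 0 = (0 :: nat)"
  shows "f n = card E"
proof -
  have "f m = (\<Sum>v<m. card {w. (v, w) \<in> E})" if "m \<le> n" for m
    using that
  proof (induction m)
    case (Suc m)
    have "card {w. (m, w) \<in> E} = f (Suc m) - f m" "f m \<le> f (Suc m)"
      using assms(1)[of m] Suc.prems bij_betw_same_card by fastforce+
    then show ?case using Suc by simp
  qed (use assms in simp)
  then have "f n = (\<Sum>v<n. card {w. (v, w) \<in> E})" by simp
  also have "\<dots> = card (SIGMA v:{..<n}. {w. (v, w) \<in> E})"
  proof (rule card_SigmaI[symmetric])
    show "\<forall>v\<in>{..<n}. finite {w. (v, w) \<in> E}"
      using assms(2) by (auto intro: finite_subset[of _ "{..<n}"])
  qed simp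
  also have "(SIGMA v:{..<n}. {w. (v, w) \<in> E}) = E" using assms(2) by auto
  finally show ?thesis .
qed

text \<open>Every vertex has a neighbour and so is the tail of an arc. This linear bound is what
  absorbs the quadratic passes into \<open>n * m\<close>.\<close>

lemma connected_card_le:
  assumes "E \<subseteq> {..<n} \<times> {..<n}" "\<And>u v. u < n \<Longrightarrow> v < n \<Longrightarrow> (u, v) \<in> E\<^sup>*" "2 \<le> n"
  shows "n \<le> card E"
proof -
  have "{..<n} \<subseteq> fst ` E"
  proof
    fix u assume u: "u \<in> {..<n}"
    have "(if u = 0 then 1 else 0) < n" "(if u = 0 then 1 else 0) \<noteq> u" using assms(3) by auto
    then obtain v where v: "v < n" "v \<noteq> u" by blast
    have "(u, v) \<in> E\<^sup>*" using assms(2) u v by simp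
    then obtain w where "(u, w) \<in> E" using v(2) by (metis converse_rtranclE)
    then show "u \<in> fst ` E" by force
  qed
  moreover have "finite E" using assms(1) finite_subset by blast
  ultimately have "card {..<n} \<le> card (fst ` E)" by (intro card_mono) auto
  also have "\<dots> \<le> card E" using \<open>finite E\<close> by (rule card_image_le)
  finally show ?thesis by simp
qed

text \<open>\<open>e\<close> is the number of arcs, and the summand 1 covers the rounding in
  \<open>num_edges\<close>. From two vertices on, \<open>m\<close> is positive and both
  \<open>e\<close> and \<open>n\<close> are at most \<open>3 * m\<close>; the graph with one vertex
  has no edges and is the reason for \<open>max 1\<close>.\<close>

lemma time_bound:
  fixes n m e :: nat
  assumes "e \<le> 2 * m + 1" "2 \<le> n \<Longrightarrow> n \<le> e" "n = 1 \<Longrightarrow> e = 0" "0 < n"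
  shows "2 * (n * (7 * e + 5 * n + 8) + 2) + (n * 3 + 2) + (n * (n * 4 + 4) + 2)
      + 2 * (n * 5 + 2) + (5 * e + 7 * n + 2) + (n * (n * 5 + 5) + 4) \<le> 200 * max 1 (n * m)"
proof (cases "n = 1")
  case True
  then show ?thesis using assms(3) by simp
next
  case False
  then have n: "2 \<le> n" using assms(4) by simp
  then have "1 \<le> m" using assms(1,2) by linarith
  then have le: "e \<le> 3 * m" "n \<le> 3 * m" using assms(1,2) n by linarith+
  define x where "x = n * m"
  have "n * e \<le> 3 * x" using mult_le_mono2[OF le(1), of n] by (simp add: x_def)
  moreover have "n * n \<le> 3 * x" using mult_le_mono2[OF le(2), of n] by (simp add: x_def)
  moreover have "n \<le> x" using \<open>1 \<le> m\<close> by (simp add: x_def)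
  moreover have "m \<le> x" using n by (simp add: x_def)
  moreover have "2 * (7 * a + 5 * b + 8 * n + 2) + (n * 3 + 2) + (4 * b + 4 * n + 2)
      + 2 * (n * 5 + 2) + (5 * e + 7 * n + 2) + (5 * b + 5 * n + 4) \<le> 200 * x"
    if "a \<le> 3 * x" "b \<le> 3 * x" "n \<le> x" "m \<le> x" for a b
  proof -
    \<comment> \<open>The coefficients on the right add up to 168; 200 is a round bound.\<close>
    have "14 * a \<le> 42 * x" "19 * b \<le> 57 * x" "45 * n \<le> 45 * x" "5 * e \<le> 15 * x" "18 \<le> 9 * x"
      using that le(1) n by simp_all
    then have "14 * a + 19 * b + 45 * n + 5 * e + 18 \<le> 42 * x + 57 * x + 45 * x + 15 * x + 9 * x"
      by (intro add_mono)
    then show ?thesis by simp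
  qed
  ultimately have "2 * (7 * (n * e) + 5 * (n * n) + 8 * n + 2) + (n * 3 + 2) + (4 * (n * n) + 4 * n + 2)
      + 2 * (n * 5 + 2) + (5 * e + 7 * n + 2) + (5 * (n * n) + 5 * n + 4) \<le> 200 * x"
    by blast
  moreover have "x \<le> max 1 (n * m)" by (simp add: x_def)
  ultimately show ?thesis by (simp add: algebra_simps)
qed

text \<open>The exponent is dictated by \<open>n = 1\<close>, where 23 has to be below a power of 2:
  the fourth power is 16, the fifth 32.\<close>

lemma word_bound: "0 < (n :: nat) \<Longrightarrow> n * n + 2 * n + 20 < (n + 1) ^ 5"
proof -
  assume n: "0 < n"
  have "(2::nat) ^ 3 \<le> (n + 1) ^ 3" using n by (intro power_mono) auto
  then have "8 * (n + 1) ^ 2 \<le> (n + 1) ^ 3 * (n + 1) ^ 2" by (intro mult_le_mono1) simp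
  also have "\<dots> = (n + 1) ^ 5" by (simp flip: power_add)
  finally have "8 * (n * n) + 16 * n + 8 \<le> (n + 1) ^ 5" by (simp add: power2_eq_square algebra_simps)
  moreover have "1 \<le> n * n" using n by simp
  ultimately show ?thesis using n by linarith
qed

theorem theorem3:
  shows "\<exists>(c :: nat) (prog :: com) (k :: nat) (C :: nat).
    \<forall>(G :: nat pair_pre_digraph) (s :: state) (n :: nat) (m :: nat).
      pair_graph G \<longrightarrow> connected (with_proj G) \<longrightarrow> K23_induced_minor_free G \<longrightarrow>
      n = card (pverts G) \<longrightarrow> m = num_edges G \<longrightarrow> input_state s G \<longrightarrow>
      (\<exists>t s' H.
         exec ((n + 1) ^ k) prog s t s' \<and> t \<le> C * max 1 (n * m) \<and>
         pair_graph H \<and> stores_graph 3 s' H \<and>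
         pverts H = pverts G \<and>
         treewidth H \<le> 2 \<and>
         (\<forall>u\<in>pverts G. \<forall>v\<in>pverts G. \<bar>gdist G u v - gdist H u v\<bar> \<le> ereal (real c)))"
proof (rule exI[of _ 280], rule exI[of _ program], rule exI[of _ 5], rule exI[of _ 200], intro allI impI)
  fix G :: "nat pair_pre_digraph" and s :: state and n m :: nat
  assume G: "pair_graph G" and con: "connected (with_proj G)" and free: "K23_induced_minor_free G"
    and n: "n = card (pverts G)" and m: "m = num_edges G" and s: "input_state s G"
  define E where "E = parcs G"
  have sg: "stores_graph 0 s G" using s by (simp add: input_state_def)
  then have V: "pverts G = {..<n}" "s 0 0 = n" using n by (auto simp: stores_graph_def)
  have G_eq: "G = \<lparr> pverts = {..<n}, parcs = E \<rparr>" using V by (simp add: E_def)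
  \<comment> \<open>Connectedness excludes the empty graph, so vertex 0 exists and can be the
    root.\<close>
  have n0: "0 < n"
    using con V(1) by (auto simp: connected_def strongly_connected_def mk_symmetric_def)
  have E: "E \<subseteq> {..<n} \<times> {..<n}" "sym E" "irrefl E"
    using G V by (auto simp: pair_graph_iff E_def)
  have reach: "(u, v) \<in> E\<^sup>*" if "u < n" "v < n" for u v
    using connected_rtrancl[OF G con, of u v] V that by (simp add: E_def)
  have adj: "s 1 v \<le> s 1 (Suc v) \<and> bij_betw (s 2) {s 1 v..<s 1 (Suc v)} {w. (v, w) \<in> E}" if "v < n" for v
    using sg that V by (simp add: stores_graph_def E_def numeral_2_eq_2)
  have off0: "s 1 0 = 0" using sg by (simp add: stores_graph_def)
  have off_card: "s 1 n = card E" by (rule stores_graph_card[OF adj E(1) off0])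
  have "card E \<le> card ({..<n} \<times> {..<n})" using E(1) by (intro card_mono) auto
  then have "card E \<le> n * n" by (simp add: card_cartesian_product)
  interpret algorithm "(n + 1) ^ 5" n "s 1" "s 2" E
    using n0 E reach adj off0 off_card \<open>card E \<le> n * n\<close> word_bound[OF n0] free G_eq
    by unfold_locales auto
  have "input s" unfolding input_def using V by blast
  moreover have "s a x = 0" if "a > 2" for a x using s that by (simp add: input_state_def)
  ultimately obtain t s' where run: "exec ((n + 1) ^ 5) program s t s'"
    "t \<le> 2 * (n * (7 * s 1 n + 5 * n + 8) + 2) + (n * 3 + 2) + (n * (n * 4 + 4) + 2)
      + 2 * (n * 5 + 2) + (5 * s 1 n + 7 * n + 2) + (n * (n * 5 + 5) + 4)"
    and out: "s' 3 0 = n" "s' 4 0 = 0" "\<And>v. v < n \<Longrightarrow> s' 4 v \<le> s' 4 (Suc v) \<and>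
       bij_betw (s' 5) {s' 4 v..<s' 4 (Suc v)} {w. (v, w) \<in> EH}"
    using program_correct[of s] unfolding runs_def by blast
  define H where "H = \<lparr> pverts = {..<n}, parcs = EH \<rparr>"
  have "s 1 n \<le> 2 * m + 1" unfolding off_card m num_edges_def E_def by linarith
  moreover have "n \<le> s 1 n" if "2 \<le> n"
    unfolding off_card by (rule connected_card_le[OF E(1) reach that])
  moreover have "n = 1 \<Longrightarrow> s 1 n = 0"
  proof -
    assume "n = 1"
    then have "E = {}" using E(1,3) by (auto simp: irrefl_def)
    then show "s 1 n = 0" using off_card by simp
  qed
  ultimately have "t \<le> 200 * max 1 (n * m)" using time_bound[OF _ _ _ n0] run(2) le_trans by blast
  moreover have "pair_graph H" unfolding H_def by (rule pair_graph_EH)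
  moreover have "stores_graph 3 s' H"
    using out by (simp add: stores_graph_def H_def)
  moreover have "treewidth H \<le> 2"
    unfolding H_def by (rule grouping_treewidth[OF grouping_axioms])
  moreover have "\<bar>gdist G u v - gdist H u v\<bar> \<le> ereal (real 280)" if "u \<in> pverts G" "v \<in> pverts G" for u v
  proof -
    have uv: "u \<in> {..<n}" "v \<in> {..<n}" using that V by auto
    have "gdist G u v = ereal (real (d u v))"
      using gdist_eq_rdist[OF G that(1), of v] reach uv by (simp add: E_def)
    moreover have "gdist H u v = ereal (real (rdist EH u v))"
      using gdist_eq_rdist[OF \<open>pair_graph H\<close>, of u v] uv EH_connected by (simp add: H_def)
    ultimately show ?thesis using dist_EH_le[OF uv] dist_le_EH[OF uv] by simp
  qed
  ultimately show "\<exists>t s' H. exec ((n + 1) ^ 5) program s t s' \<and> t \<le> 200 * max 1 (n * m) \<and>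
      pair_graph H \<and> stores_graph 3 s' H \<and> pverts H = pverts G \<and> treewidth H \<le> 2 \<and>
      (\<forall>u\<in>pverts G. \<forall>v\<in>pverts G. \<bar>gdist G u v - gdist H u v\<bar> \<le> ereal (real 280))"
    using run(1) V(1) by (intro exI[of _ t] exI[of _ s'] exI[of _ H]) (simp add: H_def)
qed

end
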